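(* For every integer $D \ge 10$ there exists a regular matroid $\mathcal{M}$ such that the generalized symmetric edge polytope $\Sigma(\mathcal{M})$ has dimension $D$ and is not $\gamma$-nonnegative, i.e. at least one entry of its $\gamma$-vector $\gamma(\Sigma(\mathcal{M}))$ is negative.
   Context: A matroid $\mathcal{M}$ is regular if it is representable over every field; equivalently, $\mathcal{M}$ is isomorphic to the vector matroid (over $\mathbb{R}$) of a totally unimodular matrix $A$ (every minor is $0$ or $\pm1$). The generalized symmetric edge polytope (generalized SEP) is $\Sigma(\mathcal{M}) = \operatorname{conv}\{\pm u \mid u \text{ is a column of } A\}$; it is well defined up to unimodular equivalence (independent of the choice of totally unimodular representation $A$). For a lattice polytope $P \subset \mathbb{R}^n$, let $L_P(m) = |mP \cap \mathbb{Z}^n|$ for $m\ge 1$ and $L_P(0)=1$; then $\sum_{m \ge 0} L_P(m) t^m = h^*(P;t)/(1-t)^{\dim P + 1}$ for a polynomial $h^*(P;t) = h_0^* + h_1^* t + \cdots + h_d^* t^d$ with $h_d^* \ne 0$, $d \le \dim P$. When $h^*(P;t)$ is symmetric ($h_i^* = h_{d-i}^*$ for all $i$), which is known to hold for $P=\Sigma(\mathcal{M})$ with $\mathcal{M}$ regular of positive rank, there are unique numbers $\gamma_i$ with $h^*(P;t) = \sum_{i=0}^{\lfloor d/2 \rfloor} \gamma_i t^i (1+t)^{d-2i}$. The $\gamma$-vector is $\gamma(P) = (\gamma_0, \dots, \gamma_{\lfloor d/2 \rfloor})$, and $P$ is $\gamma$-nonnegative if all $\gamma_i \ge 0$. *)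

theory Defs
  imports
    "HOL-Analysis.Convex"
    "HOL-Library.Function_Algebras"
    "HOL-Computational_Algebra.Polynomial_FPS"
    "Jordan_Normal_Form.DL_Submatrix"
    "Jordan_Normal_Form.Determinant"
begin

text \<open>
  Real sequences form a real vector space under the pointwise operations. As in
  \<open>HOL-Analysis.Abstract_Euclidean_Space\<close>, the space \<open>\<real>\<^sup>n\<close> for a natural number \<open>n\<close> is
  identified with the sequences vanishing at all indices \<open>i \<ge> n\<close>. This makes the dimension an
  ordinary variable, while linear independence, convex hulls, \<open>span\<close> and \<open>dim\<close>
  are those of the library.
\<close>

instantiation "fun" :: (type, real_vector) real_vector
begin

definition scaleR_fun :: "real \<Rightarrow> ('a \<Rightarrow> 'b) \<Rightarrow> 'a \<Rightarrow> 'b" where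
  "scaleR_fun r f = (\<lambda>x. r *\<^sub>R f x)"

instance
  by standard (auto simp: scaleR_fun_def fun_eq_iff scaleR_add_right scaleR_add_left)

end


section \<open>Regular matroids\<close>

record 'a indep_system =
  ground :: "'a set"
  indep :: "'a set \<Rightarrow> bool"

definition matroid :: "'a indep_system \<Rightarrow> bool" where
  "matroid M \<longleftrightarrow>
     finite (ground M) \<and>
     (\<forall>S. indep M S \<longrightarrow> S \<subseteq> ground M) \<and>
     indep M {} \<and>
     (\<forall>S T. indep M T \<and> S \<subseteq> T \<longrightarrow> indep M S) \<and>
     (\<forall>S T. indep M S \<and> indep M T \<and> card S < card T \<longrightarrow>
        (\<exists>x\<in>T - S. indep M (insert x S)))"

definition matroid_iso :: "'a indep_system \<Rightarrow> 'b indep_system \<Rightarrow> bool" where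
  "matroid_iso M N \<longleftrightarrow>
     (\<exists>f. bij_betw f (ground M) (ground N) \<and>
          (\<forall>S\<subseteq>ground M. indep M S \<longleftrightarrow> indep N (f ` S)))"

definition matrix_column :: "real mat \<Rightarrow> nat \<Rightarrow> (nat \<Rightarrow> real)" where
  "matrix_column A j = (\<lambda>i. if i < dim_row A then A $$ (i, j) else 0)"

text \<open>The injectivity condition makes a set of column indices dependent as soon as two of the
  columns coincide (parallel elements).\<close>

definition vector_matroid :: "real mat \<Rightarrow> nat indep_system" where
  "vector_matroid A =
     \<lparr>ground = {..<dim_col A},
      indep = (\<lambda>S. S \<subseteq> {..<dim_col A} \<and> inj_on (matrix_column A) S \<and> independent (matrix_column A ` S))\<rparr>"

definition totally_unimodular :: "real mat \<Rightarrow> bool" where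
  "totally_unimodular A \<longleftrightarrow>
     (\<forall>I J. I \<subseteq> {..<dim_row A} \<and> J \<subseteq> {..<dim_col A} \<and> card I = card J \<longrightarrow>
        det (submatrix A I J) \<in> {-1, 0, 1})"

definition tu_representation :: "real mat \<Rightarrow> 'a indep_system \<Rightarrow> bool" where
  "tu_representation A M \<longleftrightarrow> totally_unimodular A \<and> matroid_iso M (vector_matroid A)"

definition regular_matroid :: "'a indep_system \<Rightarrow> bool" where
  "regular_matroid M \<longleftrightarrow> matroid M \<and> (\<exists>A. tu_representation A M)"


section \<open>Generalized symmetric edge polytopes\<close>

definition gen_SEP :: "real mat \<Rightarrow> (nat \<Rightarrow> real) set" where
  "gen_SEP A = convex hull {v. \<exists>j<dim_col A. v = matrix_column A j \<or> v = - matrix_column A j}"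


section \<open>Ehrhart theory\<close>

text \<open>The dimension of the affine hull, i.e. of its direction space (the library constant
  \<open>aff_dim\<close> is restricted to Euclidean spaces).\<close>

definition polytope_dim :: "(nat \<Rightarrow> real) set \<Rightarrow> nat" where
  "polytope_dim P = dim {x - y | x y. x \<in> P \<and> y \<in> P}"

definition lattice_count :: "(nat \<Rightarrow> real) set \<Rightarrow> nat \<Rightarrow> nat" where
  "lattice_count P m =
     (if m = 0 then 1
      else card {x. x \<in> (\<lambda>v. real m *\<^sub>R v) ` P \<and> (\<forall>i. x i \<in> \<int>)})"

definition is_hstar :: "(nat \<Rightarrow> real) set \<Rightarrow> real poly \<Rightarrow> bool" where
  "is_hstar P h \<longleftrightarrow>
     Abs_fps (\<lambda>m. real (lattice_count P m)) =
       fps_of_poly h / (1 - fps_X) ^ (polytope_dim P + 1)"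

text \<open>Both \<open>h\<close> and the list \<open>g\<close> of the numbers \<open>\<gamma>\<^sub>i\<close> are uniquely determined by \<open>P\<close>; the
  existence of \<open>g\<close> entails that \<open>h\<close> is symmetric.\<close>

definition is_gamma_vector :: "(nat \<Rightarrow> real) set \<Rightarrow> real list \<Rightarrow> bool" where
  "is_gamma_vector P g \<longleftrightarrow>
     (\<exists>h. is_hstar P h \<and>
          length g = degree h div 2 + 1 \<and>
          h = (\<Sum>i\<le>degree h div 2. monom (g ! i) i * [:1, 1:] ^ (degree h - 2 * i)))"

end

theory Submission
  imports Defs
begin

text \<open>
  The matroid is the dual of the cycle matroid of \<open>K\<^bsub>3,6\<^esub>\<close>, together with \<open>k = D - 10\<close> coloops. In a
  totally unimodular representation the lattice points of \<open>m P\<close> are the integral combinations of the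
  columns with coefficients of total absolute value at most \<open>m\<close>. Each triangle of the dual matroid spans
  a hexagonal lattice, so these lattice points are the six-tuples \<open>x\<close> of points of the hexagonal lattice modulo
  simultaneous translation (and \<open>k\<close> further integers), and the least total absolute value is the minimum over \<open>v\<close> of the
  sum of the hexagonal distances from \<open>v\<close> to the six points. Choosing the minimising \<open>v\<close> by a generic tilt and
  translating it to the origin gives a unique representative, which is characterised by the signs of the
  directional derivatives at the origin in the six lattice directions. As these derivatives come from a
  convex function, the negative ones form a cyclic interval, so representatives can be counted by
  inclusion and exclusion over single directions and pairs of adjacent directions. This leads to
  \<open>h\<^sup>* = (1 + 26t + 297t\<^sup>2 + 1908t\<^sup>3 + 6264t\<^sup>4 + 9108t\<^sup>5 + \<dots>) (1 + t)\<^sup>k\<close> and to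
  \<open>\<gamma>\<^sub>5 = -148\<close>.
\<close>

text \<open>The claim concerns every totally unimodular representation of the matroid. The obstacle
  is to extract from an unknown matrix enough linear algebra for a count: up to renaming and signs
  its columns satisfy exactly the cut relations of K_{3,6}, and at integral points independent
  columns have integral coefficients. The signs come from the vertex cuts, which are circuits of the
  dual. The count has to compare integral with real coefficients. Convexity of the distance sum does
  this: the slopes in six lattice directions at the origin decide minimality over the whole real
  plane, so minimality is a finite condition whose generating function obeys a recursion over the
  points. One example in dimension ten suffices, since each coloop multiplies the h*-polynomial by 1
  + t, which changes the \<gamma>-vector at most by appended zeros.\<close>

section \<open>Linear independence and total unimodularity\<close>

lemma sum_fun_apply: "(\<Sum>e\<in>S. f e) i = (\<Sum>e\<in>S. f e i)"
  for f :: "'e \<Rightarrow> 'i \<Rightarrow> 'b::comm_monoid_add"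
  by (induction S rule: infinite_finite_induct) auto

text \<open>Independence of a family: coefficients are indexed by matroid elements, so parallel
  columns are dependent and the notion behaves well under renaming and rescaling.\<close>

definition fam_indep :: "('e \<Rightarrow> 'v::real_vector) \<Rightarrow> 'e set \<Rightarrow> bool" where
  "fam_indep a S \<longleftrightarrow> (\<forall>c. (\<Sum>e\<in>S. c e *\<^sub>R a e) = 0 \<longrightarrow> (\<forall>e\<in>S. c e = 0))"

lemma fam_indepD: "fam_indep a S \<Longrightarrow> (\<Sum>e\<in>S. c e *\<^sub>R a e) = 0 \<Longrightarrow> e \<in> S \<Longrightarrow> c e = 0"
  by (auto simp: fam_indep_def)

lemma fam_indep_iff:
  assumes "finite S"
  shows "fam_indep a S \<longleftrightarrow> inj_on a S \<and> independent (a ` S)"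
proof
  assume *: "fam_indep a S"
  have inj: "inj_on a S"
  proof (rule inj_onI, rule ccontr)
    fix x y assume xy: "x \<in> S" "y \<in> S" "a x = a y" "x \<noteq> y"
    define c where "c = (\<lambda>e. (if e = x then 1 else 0) - (if e = y then 1 else 0 :: real))"
    have "(\<Sum>e\<in>S. c e *\<^sub>R a e) = (\<Sum>e\<in>S. (if e = x then a e else 0)) - (\<Sum>e\<in>S. (if e = y then a e else 0))"
      unfolding c_def sum_subtractf[symmetric] by (rule sum.cong) (auto simp: algebra_simps)
    also have "\<dots> = 0" using assms xy by simp
    finally have "(\<Sum>e\<in>S. c e *\<^sub>R a e) = 0" .
    from fam_indepD[OF * this xy(1)] show False using xy by (simp add: c_def)
  qed
  have "independent (a ` S)"
    unfolding real_vector.dependent_finite[OF finite_imageI[OF assms]]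
  proof safe
    fix u v assume u: "v \<in> S" "u (a v) \<noteq> 0" "(\<Sum>v\<in>a ` S. u v *\<^sub>R v) = 0"
    then have "(\<Sum>e\<in>S. u (a e) *\<^sub>R a e) = 0" by (simp add: sum.reindex[OF inj] o_def)
    from fam_indepD[OF * this u(1)] u(2) show False by simp
  qed
  with inj show "inj_on a S \<and> independent (a ` S)" by simp
next
  assume *: "inj_on a S \<and> independent (a ` S)"
  show "fam_indep a S" unfolding fam_indep_def
  proof (intro allI impI ballI, rule ccontr)
    fix c e assume c: "(\<Sum>e\<in>S. c e *\<^sub>R a e) = 0" "e \<in> S" "c e \<noteq> 0"
    define u where "u = c \<circ> the_inv_into S a"
    have u: "u (a x) = c x" if "x \<in> S" for x
      using * that by (simp add: u_def the_inv_into_f_f)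
    have "(\<Sum>v\<in>a ` S. u v *\<^sub>R v) = (\<Sum>e\<in>S. c e *\<^sub>R a e)"
      using * by (subst sum.reindex) (auto intro!: sum.cong simp: u)
    with c have "dependent (a ` S)"
      unfolding real_vector.dependent_finite[OF finite_imageI[OF assms]]
      by (auto intro!: exI[of _ u] bexI[of _ e] simp: u)
    with * show False by simp
  qed
qed

lemma fam_indep_mono:
  assumes "fam_indep a T" "S \<subseteq> T" "finite T"
  shows "fam_indep a S"
  unfolding fam_indep_def
proof (intro allI impI ballI)
  fix c e assume c: "(\<Sum>e\<in>S. c e *\<^sub>R a e) = 0" "e \<in> S"
  have "(\<Sum>e\<in>T. (if e \<in> S then c e else 0) *\<^sub>R a e) = (\<Sum>e\<in>S. c e *\<^sub>R a e)"
    using assms by (intro sum.mono_neutral_cong_right) auto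
  with c fam_indepD[OF assms(1), of "\<lambda>e. if e \<in> S then c e else 0" e] assms(2)
  show "c e = 0" by auto
qed

lemma fam_indep_reindex:
  assumes "inj_on f S"
  shows "fam_indep a (f ` S) \<longleftrightarrow> fam_indep (a \<circ> f) S"
proof
  assume *: "fam_indep a (f ` S)"
  show "fam_indep (a \<circ> f) S" unfolding fam_indep_def
  proof (intro allI impI ballI)
    fix c e assume c: "(\<Sum>e\<in>S. c e *\<^sub>R (a \<circ> f) e) = 0" "e \<in> S"
    have "(\<Sum>e\<in>f ` S. c (the_inv_into S f e) *\<^sub>R a e) = (\<Sum>e\<in>S. c e *\<^sub>R (a \<circ> f) e)"
      using assms by (subst sum.reindex) (auto intro!: sum.cong simp: the_inv_into_f_f)
    with c fam_indepD[OF *, of "\<lambda>e. c (the_inv_into S f e)" "f e"] assms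
    show "c e = 0" by (auto simp: the_inv_into_f_f)
  qed
next
  assume *: "fam_indep (a \<circ> f) S"
  show "fam_indep a (f ` S)" unfolding fam_indep_def
  proof (intro allI impI ballI)
    fix c e assume c: "(\<Sum>e\<in>f ` S. c e *\<^sub>R a e) = 0" "e \<in> f ` S"
    then obtain x where x: "x \<in> S" "e = f x" by auto
    have "(\<Sum>e\<in>S. (c \<circ> f) e *\<^sub>R (a \<circ> f) e) = 0"
      using c assms by (simp add: sum.reindex)
    from fam_indepD[OF * this x(1)] x show "c e = 0" by simp
  qed
qed

lemma fam_indep_scale:
  assumes "\<And>e. e \<in> S \<Longrightarrow> s e \<noteq> (0::real)"
  shows "fam_indep (\<lambda>e. s e *\<^sub>R a e) S \<longleftrightarrow> fam_indep a S"
proof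
  assume *: "fam_indep (\<lambda>e. s e *\<^sub>R a e) S"
  show "fam_indep a S" unfolding fam_indep_def
  proof (intro allI impI ballI)
    fix c e assume c: "(\<Sum>e\<in>S. c e *\<^sub>R a e) = 0" "e \<in> S"
    have "(\<Sum>e\<in>S. (c e / s e) *\<^sub>R (s e *\<^sub>R a e)) = (\<Sum>e\<in>S. c e *\<^sub>R a e)"
      by (rule sum.cong) (auto simp: assms)
    with c fam_indepD[OF *, of "\<lambda>e. c e / s e" e] assms show "c e = 0" by auto
  qed
next
  assume *: "fam_indep a S"
  show "fam_indep (\<lambda>e. s e *\<^sub>R a e) S" unfolding fam_indep_def
  proof (intro allI impI ballI)
    fix c e assume c: "(\<Sum>e\<in>S. c e *\<^sub>R s e *\<^sub>R a e) = 0" "e \<in> S"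
    with fam_indepD[OF *, of "\<lambda>e. c e * s e" e] assms show "c e = 0" by auto
  qed
qed

text \<open>Vectors supported on \<open>I\<close> lie in the span of \<open>card I\<close> unit
  vectors. Both halves of \<open>rows_indep_square\<close> rest on this bound, once for columns and
  once for coefficient vectors.\<close>

lemma fam_indep_card_le:
  fixes w :: "'e \<Rightarrow> 'i \<Rightarrow> real"
  assumes "finite I" "finite S" "fam_indep w S" "\<And>e i. e \<in> S \<Longrightarrow> i \<notin> I \<Longrightarrow> w e i = 0"
  shows "card S \<le> card I"
proof -
  define d :: "'i \<Rightarrow> 'i \<Rightarrow> real" where "d = (\<lambda>i k. if k = i then 1 else 0)"
  have "w e = (\<Sum>i\<in>I. w e i *\<^sub>R d i)" if "e \<in> S" for e
  proof
    fix k
    have "(\<Sum>i\<in>I. w e i *\<^sub>R d i) k = (\<Sum>i\<in>I. if k = i then w e i else 0)"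
      by (auto simp: sum_fun_apply scaleR_fun_def d_def intro!: sum.cong)
    also have "\<dots> = w e k" using assms(1,4) that by (auto simp: sum.delta')
    finally show "w e k = (\<Sum>i\<in>I. w e i *\<^sub>R d i) k" by simp
  qed
  then have "w ` S \<subseteq> span (d ` I)"
    by (metis (no_types, lifting) image_eqI image_subsetI span_base span_scale span_sum)
  with real_vector.independent_span_bound[of "d ` I" "w ` S"] assms
  have "card (w ` S) \<le> card (d ` I)" by (auto simp: fam_indep_iff)
  also have "\<dots> \<le> card I" using assms(1) by (rule card_image_le)
  finally show ?thesis using assms by (simp add: fam_indep_iff card_image)
qed

lemma fam_indep_insert_span:
  assumes "finite S" "fam_indep a S" "a x \<notin> span (a ` S)"
  shows "fam_indep a (insert x S)"
proof -
  have "a x \<notin> a ` S" using assms(3) span_base by blast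
  moreover have "independent (insert (a x) (a ` S))"
    using assms by (intro independent_insertI) (auto simp: fam_indep_iff)
  ultimately show ?thesis using assms by (auto simp: fam_indep_iff inj_on_insert)
qed

lemma ground_vector_matroid [simp]: "ground (vector_matroid A) = {..<dim_col A}"
  by (simp add: vector_matroid_def)

lemma indep_vector_matroid:
  "indep (vector_matroid A) S \<longleftrightarrow> S \<subseteq> {..<dim_col A} \<and> fam_indep (matrix_column A) S"
  using finite_subset[of S "{..<dim_col A}"]
  by (auto simp: vector_matroid_def fam_indep_iff)

lemma matroid_vector_matroid: "matroid (vector_matroid A)"
  unfolding matroid_def
proof (intro conjI allI impI)
  show "finite (ground (vector_matroid A))" by simp
  show "indep (vector_matroid A) {}" by (simp add: indep_vector_matroid fam_indep_def)
  show "S \<subseteq> ground (vector_matroid A)" if "indep (vector_matroid A) S" for S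
    using that by (simp add: indep_vector_matroid)
  show "indep (vector_matroid A) S" if "indep (vector_matroid A) T \<and> S \<subseteq> T" for S T
    using that finite_subset[of T "{..<dim_col A}"]
    by (auto simp: indep_vector_matroid intro: fam_indep_mono)
  fix S T assume *: "indep (vector_matroid A) S \<and> indep (vector_matroid A) T \<and> card S < card T"
  let ?a = "matrix_column A"
  have fin: "finite S" "finite T" using * by (auto simp: indep_vector_matroid intro: finite_subset)
  have ST: "fam_indep ?a S" "fam_indep ?a T" "S \<subseteq> {..<dim_col A}" "T \<subseteq> {..<dim_col A}"
    using * by (auto simp: indep_vector_matroid)
  have "\<not> ?a ` T \<subseteq> span (?a ` S)"
  proof
    assume "?a ` T \<subseteq> span (?a ` S)"
    then have "card (?a ` T) \<le> card (?a ` S)"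
      using real_vector.independent_span_bound[of "?a ` S" "?a ` T"] ST fin
      by (auto simp: fam_indep_iff)
    then show False using * ST fin by (auto simp: fam_indep_iff card_image)
  qed
  then obtain x where x: "x \<in> T" "?a x \<notin> span (?a ` S)" by auto
  then have "x \<notin> S" using span_base by blast
  with x show "\<exists>x\<in>T - S. indep (vector_matroid A) (insert x S)"
    using ST fin by (auto simp: indep_vector_matroid intro: fam_indep_insert_span)
qed

text \<open>It is the columns in \<open>S\<close> that are independent, after restriction to the
  rows in \<open>I\<close>. For \<open>card I = card S\<close> this says that the minor does not
  vanish.\<close>

definition rows_indep :: "(nat \<Rightarrow> nat \<Rightarrow> real) \<Rightarrow> nat set \<Rightarrow> nat set \<Rightarrow> bool" where
  "rows_indep M I S \<longleftrightarrow> (\<forall>c. (\<forall>i\<in>I. (\<Sum>e\<in>S. c e * M i e) = 0) \<longrightarrow> (\<forall>e\<in>S. c e = 0))"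

text \<open>Take a minimal set \<open>I\<close> of rows on which the columns stay independent.
  Deleting a row \<open>i\<close> creates a dependency \<open>c i\<close> that fails in row
  \<open>i\<close> only; these coefficient vectors are independent, so there are no more rows than
  columns.\<close>

lemma rows_indep_square:
  assumes R: "finite R" "rows_indep M R S" and S: "finite S"
  obtains I where "I \<subseteq> R" "card I = card S" "rows_indep M I S"
proof -
  define \<I> where "\<I> = {I. I \<subseteq> R \<and> rows_indep M I S}"
  have "finite \<I>" "R \<in> \<I>" using R by (auto simp: \<I>_def)
  then obtain I where I: "I \<in> \<I>" "\<And>J. J \<in> \<I> \<Longrightarrow> J \<subseteq> I \<Longrightarrow> J = I"
    using finite_has_minimal[of \<I>] by auto
  have fI: "finite I" using I(1) R by (auto simp: \<I>_def intro: finite_subset)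
  have IS: "rows_indep M I S" using I(1) by (simp add: \<I>_def)
  have "card S \<le> card I"
  proof (rule fam_indep_card_le[OF fI S, of "\<lambda>e i. if i \<in> I then M i e else 0"])
    show "fam_indep (\<lambda>e i. if i \<in> I then M i e else 0) S"
      unfolding fam_indep_def
    proof (intro allI impI)
      fix c assume c: "(\<Sum>e\<in>S. c e *\<^sub>R (\<lambda>i. if i \<in> I then M i e else 0)) = 0"
      have "(\<Sum>e\<in>S. c e * M i e) = 0" if "i \<in> I" for i
        using that fun_cong[OF c, of i] by (simp add: sum_fun_apply scaleR_fun_def)
      then show "\<forall>e\<in>S. c e = 0" using IS by (auto simp: rows_indep_def)
    qed
  qed auto
  moreover have "card I \<le> card S"
  proof -
    have "\<exists>c. (\<forall>k\<in>I - {i}. (\<Sum>e\<in>S. c e * M k e) = 0) \<and> (\<exists>e\<in>S. c e \<noteq> 0)" if "i \<in> I" for i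
    proof -
      have "I - {i} \<notin> \<I>" using I(2)[of "I - {i}"] that by auto
      then show ?thesis using I(1) by (auto simp: \<I>_def rows_indep_def)
    qed
    then obtain c where c: "\<And>i k. i \<in> I \<Longrightarrow> k \<in> I \<Longrightarrow> k \<noteq> i \<Longrightarrow> (\<Sum>e\<in>S. c i e * M k e) = 0"
      "\<And>i. i \<in> I \<Longrightarrow> \<exists>e\<in>S. c i e \<noteq> 0" by (simp add: Ball_def) metis
    have nz: "(\<Sum>e\<in>S. c i e * M i e) \<noteq> 0" if "i \<in> I" for i
      using IS c that unfolding rows_indep_def by metis
    show ?thesis
    proof (rule fam_indep_card_le[OF S fI, of "\<lambda>i e. if e \<in> S then c i e else 0"])
      show "fam_indep (\<lambda>i e. if e \<in> S then c i e else 0) I"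
        unfolding fam_indep_def
      proof (intro allI impI ballI)
        fix u k assume u: "(\<Sum>i\<in>I. u i *\<^sub>R (\<lambda>e. if e \<in> S then c i e else 0)) = 0" and k: "k \<in> I"
        have "(\<Sum>i\<in>I. u i * c i e) = 0" if "e \<in> S" for e
          using that fun_cong[OF u, of e] by (simp add: sum_fun_apply scaleR_fun_def)
        then have "0 = (\<Sum>e\<in>S. (\<Sum>i\<in>I. u i * c i e) * M k e)" by simp
        also have "\<dots> = (\<Sum>i\<in>I. u i * (\<Sum>e\<in>S. c i e * M k e))"
          by (simp add: sum_distrib_left sum_distrib_right mult.assoc) (rule sum.swap)
        also have "\<dots> = (\<Sum>i\<in>I. if i = k then u k * (\<Sum>e\<in>S. c k e * M k e) else 0)"
          using c(1) k by (intro sum.cong) auto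
        also have "\<dots> = u k * (\<Sum>e\<in>S. c k e * M k e)" using fI k by simp
        finally show "u k = 0" using nz[OF k] by simp
      qed
    qed auto
  qed
  ultimately show ?thesis using that[of I] I(1) by (auto simp: \<I>_def)
qed

section \<open>Minors expressed through coefficient functions\<close>

lemma bij_betw_pick: "finite S \<Longrightarrow> bij_betw (pick S) {..<card S} S"
proof -
  assume fin: "finite S"
  have inj: "inj_on (pick S) {..<card S}"
    by (rule linorder_inj_onI') (use pick_mono_le in fastforce)
  moreover have "pick S ` {..<card S} \<subseteq> S" by (auto intro: pick_in_set_le)
  ultimately show ?thesis
    by (simp add: bij_betw_def card_image card_subset_eq[OF fin])
qed

lemma det_Ints:
  assumes "\<And>i j. i < dim_row M \<Longrightarrow> j < dim_col M \<Longrightarrow> M $$ (i, j) \<in> (\<int> :: 'a::comm_ring_1 set)"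
  shows "det M \<in> \<int>"
proof -
  have "M $$ (i, p i) \<in> \<int>" if "dim_row M = dim_col M" "p permutes {0..<dim_row M}" "i < dim_row M" for p i
    using assms[of i "p i"] that permutes_in_image[OF that(2), of i] by simp
  then show ?thesis unfolding det_def by (auto intro!: Ints_sum Ints_mult Ints_prod)
qed

lemma adj_mat_Ints:
  assumes "M \<in> carrier_mat n n" "\<And>i j. i < n \<Longrightarrow> j < n \<Longrightarrow> M $$ (i, j) \<in> (\<int> :: 'a::comm_ring_1 set)"
    "i < n" "j < n"
  shows "adj_mat M $$ (i, j) \<in> \<int>"
proof -
  have "det (mat_delete M j i) \<in> \<int>"
    using assms by (intro det_Ints) (auto simp: mat_delete_def)
  then show ?thesis using assms by (auto simp: adj_mat_def cofactor_def)
qed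

lemma submatrix_carrier:
  assumes "I \<subseteq> {..<dim_row A}" "J \<subseteq> {..<dim_col A}"
  shows "submatrix A I J \<in> carrier_mat (card I) (card J)"
proof -
  have "{i. i < dim_row A \<and> i \<in> I} = I" "{i. i < dim_col A \<and> i \<in> J} = J" using assms by auto
  then show ?thesis by (intro carrier_matI) (simp_all add: dim_submatrix)
qed

lemma submatrix_pick:
  assumes "I \<subseteq> {..<dim_row A}" "J \<subseteq> {..<dim_col A}" "r < card I" "s < card J"
  shows "submatrix A I J $$ (r, s) = A $$ (pick I r, pick J s)"
proof -
  have "{i. i < dim_row A \<and> i \<in> I} = I" "{i. i < dim_col A \<and> i \<in> J} = J" using assms by auto
  then show ?thesis using assms by (intro submatrix_index) simp_all
qed

lemma submatrix_mult_vec: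
  fixes A :: "real mat"
  assumes "I \<subseteq> {..<dim_row A}" "J \<subseteq> {..<dim_col A}" "r < card I" "n = card J"
  shows "(submatrix A I J *\<^sub>v vec n (\<lambda>s. c (pick J s))) $ r = (\<Sum>e\<in>J. c e * A $$ (pick I r, e))"
proof -
  have "finite J" using assms(2) finite_subset by blast
  then have "(\<Sum>e\<in>J. c e * A $$ (pick I r, e)) = (\<Sum>s<n. c (pick J s) * A $$ (pick I r, pick J s))"
    using sum.reindex_bij_betw[OF bij_betw_pick, of J "\<lambda>e. c e * A $$ (pick I r, e)"] assms(4) by simp
  also have "\<dots> = (submatrix A I J *\<^sub>v vec n (\<lambda>s. c (pick J s))) $ r"
    using assms submatrix_carrier[OF assms(1,2)] 
    by (auto simp: scalar_prod_def submatrix_pick mult.commute lessThan_atLeast0 intro!: sum.cong)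
  finally show ?thesis by simp
qed

lemma vec_as_pick:
  assumes "finite J" "v \<in> carrier_vec (card J)"
  obtains c where "v = vec (card J) (\<lambda>s. c (pick J s))"
proof -
  have "v = vec (card J) (\<lambda>s. (\<lambda>e. v $ card {a\<in>J. a < e}) (pick J s))"
    using assms by (intro eq_vecI) (auto simp: card_pick_le)
  then show ?thesis by (rule that)
qed

text \<open>A square matrix is singular iff it has a nonzero kernel vector, and reading a kernel
  vector along \<open>pick J\<close> makes it a coefficient function on \<open>J\<close>.\<close>

lemma det_submatrix_nonzero_iff:
  fixes A :: "real mat"
  assumes IJ: "I \<subseteq> {..<dim_row A}" "J \<subseteq> {..<dim_col A}" and card: "card I = card J"
  shows "det (submatrix A I J) \<noteq> 0 \<longleftrightarrow> rows_indep (\<lambda>i e. A $$ (i, e)) I J"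
proof -
  let ?n = "card J" and ?M = "submatrix A I J"
  have fin: "finite I" "finite J" using IJ finite_subset by blast+
  have M: "?M \<in> carrier_mat ?n ?n" using submatrix_carrier[OF IJ] card by simp
  have pickI: "pick I ` {..<?n} = I" and pickJ: "pick J ` {..<?n} = J"
    using bij_betw_pick[OF fin(1)] bij_betw_pick[OF fin(2)] card by (auto simp: bij_betw_def)
  have zero: "?M *\<^sub>v vec ?n (\<lambda>s. c (pick J s)) = 0\<^sub>v ?n \<longleftrightarrow> (\<forall>i\<in>I. (\<Sum>e\<in>J. c e * A $$ (i, e)) = 0)" for c
  proof -
    have "?M *\<^sub>v vec ?n (\<lambda>s. c (pick J s)) = 0\<^sub>v ?n \<longleftrightarrow>
        (\<forall>r<?n. (?M *\<^sub>v vec ?n (\<lambda>s. c (pick J s))) $ r = 0)"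
      using M by (auto simp: vec_eq_iff)
    also have "\<dots> \<longleftrightarrow> (\<forall>r\<in>{..<?n}. (\<Sum>e\<in>J. c e * A $$ (pick I r, e)) = 0)"
      using submatrix_mult_vec[OF IJ, of _ ?n c] card by auto
    also have "\<dots> \<longleftrightarrow> (\<forall>i\<in>I. (\<Sum>e\<in>J. c e * A $$ (i, e)) = 0)"
      by (subst (2) pickI[symmetric]) simp
    finally show ?thesis .
  qed
  have nz: "vec ?n (\<lambda>s. c (pick J s)) = 0\<^sub>v ?n \<longleftrightarrow> (\<forall>e\<in>J. c e = 0)" for c :: "nat \<Rightarrow> real"
  proof -
    have "vec ?n (\<lambda>s. c (pick J s)) = 0\<^sub>v ?n \<longleftrightarrow> (\<forall>s\<in>{..<?n}. c (pick J s) = 0)"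
      by (auto simp: vec_eq_iff)
    also have "\<dots> \<longleftrightarrow> (\<forall>e\<in>J. c e = 0)" by (subst (2) pickJ[symmetric]) simp
    finally show ?thesis .
  qed
  have "det ?M = 0 \<longleftrightarrow> (\<exists>c. vec ?n (\<lambda>s. c (pick J s)) \<noteq> 0\<^sub>v ?n \<and>
      ?M *\<^sub>v vec ?n (\<lambda>s. c (pick J s)) = 0\<^sub>v ?n)"
    unfolding det_0_iff_vec_prod_zero[OF M]
    by (metis vec_as_pick[OF fin(2)] vec_carrier)
  then show ?thesis unfolding zero nz rows_indep_def by blast
qed

text \<open>Cramer's rule: coefficients are recovered from the row sums, up to the factor
  \<open>det M\<close>, by means of the adjugate, whose entries are integral for integral
  \<open>M\<close>.\<close>

lemma adj_mat_mult_vec: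
  assumes M: "(M :: real mat) \<in> carrier_mat n n" and v: "v \<in> carrier_vec n" and s: "s < n"
  shows "(\<Sum>r<n. adj_mat M $$ (s, r) * (M *\<^sub>v v) $ r) = det M * v $ s"
proof -
  have "(\<Sum>r<n. adj_mat M $$ (s, r) * (M *\<^sub>v v) $ r) = (adj_mat M *\<^sub>v (M *\<^sub>v v)) $ s"
    using adj_mat(1)[OF M] M s by (auto simp: scalar_prod_def lessThan_atLeast0 intro!: sum.cong)
  also have "adj_mat M *\<^sub>v (M *\<^sub>v v) = (adj_mat M * M) *\<^sub>v v"
    using adj_mat(1)[OF M] M v by (simp add: assoc_mult_mat_vec)
  also have "\<dots> = det M \<cdot>\<^sub>v v" using adj_mat(3)[OF M] v by auto
  finally show ?thesis using v s by simp
qed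

lemma totally_unimodular_entry:
  assumes "totally_unimodular A" "i < dim_row A" "j < dim_col A"
  shows "A $$ (i, j) \<in> {-1, 0, 1}"
proof -
  have M: "submatrix A {i} {j} \<in> carrier_mat 1 1"
    using submatrix_carrier[of "{i}" A "{j}"] assms by simp
  have "det (submatrix A {i} {j}) \<in> {-1, 0, 1}"
    using assms unfolding totally_unimodular_def by (metis card.empty card.insert empty_iff empty_subsetI finite.intros(1) insert_subset lessThan_iff)
  moreover have "det (submatrix A {i} {j}) = A $$ (i, j)"
    using M submatrix_pick[of "{i}" A "{j}" 0 0] assms pick_in_set_le[of 0 "{i}"] pick_in_set_le[of 0 "{j}"]
    by (simp add: det_single)
  ultimately show ?thesis by simp
qed

text \<open>On a square nonsingular set of rows the minor is 1 or -1, so Cramer's rule introduces no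
  denominators. This turns integral points into integral combinations of independent
  columns.\<close>

lemma totally_unimodular_integral:
  assumes tu: "totally_unimodular A" and S: "S \<subseteq> {..<dim_col A}"
    and ind: "fam_indep (matrix_column A) S"
    and int: "\<And>i. (\<Sum>e\<in>S. c e *\<^sub>R matrix_column A e) i \<in> \<int>" and e: "e \<in> S"
  shows "c e \<in> \<int>"
proof -
  let ?A = "\<lambda>i e. A $$ (i, e)"
  have fin: "finite S" using S finite_subset by blast
  have col: "(\<Sum>e\<in>S. c e *\<^sub>R matrix_column A e) i = (if i < dim_row A then \<Sum>e\<in>S. c e * A $$ (i, e) else 0)" for c i
    by (auto simp: sum_fun_apply scaleR_fun_def matrix_column_def)
  have "rows_indep ?A {..<dim_row A} S"
    unfolding rows_indep_def
  proof (intro allI impI)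
    fix c assume "\<forall>i\<in>{..<dim_row A}. (\<Sum>e\<in>S. c e * A $$ (i, e)) = 0"
    then have "(\<Sum>e\<in>S. c e *\<^sub>R matrix_column A e) = 0" unfolding fun_eq_iff col by auto
    then show "\<forall>e\<in>S. c e = 0" using ind by (auto simp: fam_indep_def)
  qed
  from rows_indep_square[OF finite_lessThan this fin]
  obtain I where I: "I \<subseteq> {..<dim_row A}" "card I = card S" "rows_indep ?A I S" .
  define M where "M = submatrix A I S"
  define n where "n = card S"
  have M: "M \<in> carrier_mat n n" using submatrix_carrier[OF I(1) S] I(2) by (simp add: M_def n_def)
  have pickI: "pick I r \<in> I" if "r < n" for r using that I(2) by (auto simp: n_def intro: pick_in_set_le)
  have pickS: "pick S r \<in> S" if "r < n" for r using that by (auto simp: n_def intro: pick_in_set_le)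
  have "det M \<in> {-1, 0, 1}" using tu I(1,2) S by (auto simp: totally_unimodular_def M_def)
  moreover have "det M \<noteq> 0" unfolding M_def using I S by (subst det_submatrix_nonzero_iff) auto
  ultimately have detM: "det M \<in> {-1, 1}" by simp
  have entry: "M $$ (r, s) \<in> \<int>" if "r < n" "s < n" for r s
  proof -
    have "M $$ (r, s) = A $$ (pick I r, pick S s)"
      using that I S by (simp add: M_def n_def submatrix_pick)
    then show ?thesis
      using totally_unimodular_entry[OF tu, of "pick I r" "pick S s"] pickI[OF that(1)] pickS[OF that(2)] I(1) S
      by fastforce
  qed
  define v where "v = vec n (\<lambda>s. c (pick S s))"
  obtain s where s: "s < n" "e = pick S s"
    using bij_betw_imp_surj_on[OF bij_betw_pick[OF fin]] e unfolding n_def by blast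
  have "(M *\<^sub>v v) $ r \<in> \<int>" if "r < n" for r
  proof -
    have "(M *\<^sub>v v) $ r = (\<Sum>e\<in>S. c e * A $$ (pick I r, e))"
      unfolding M_def v_def using that I S by (intro submatrix_mult_vec) (auto simp: n_def)
    also have "\<dots> \<in> \<int>" using int[of "pick I r"] pickI[OF that] I(1) by (auto simp: col)
    finally show ?thesis .
  qed
  then have "det M * v $ s \<in> \<int>"
    unfolding adj_mat_mult_vec[OF M vec_carrier[of n "\<lambda>s. c (pick S s)", folded v_def] s(1), symmetric]
    using adj_mat_Ints[OF M entry s(1)] by (auto intro!: Ints_sum Ints_mult)
  moreover have "v $ s = c e" using s by (simp add: v_def)
  ultimately show ?thesis using detM by auto
qed

lemma Ints_mult_eq_1:
  assumes "x * y = 1" "x \<in> \<int>" "y \<in> \<int>"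
  shows "x = 1 \<or> x = (-1::real)"
proof -
  obtain m n where mn: "x = of_int m" "y = of_int n" using assms by (auto elim!: Ints_cases)
  then have "m * n = 1" using assms(1) by (metis of_int_eq_1_iff of_int_mult)
  then show ?thesis using mn by (auto simp: zmult_eq_1_iff)
qed

text \<open>A nonsingular minor is \<open>\<plusminus>1\<close> as soon as the inverse matrix is integral.\<close>

lemma totally_unimodularI:
  assumes entries: "\<And>i e. i < dim_row A \<Longrightarrow> e < dim_col A \<Longrightarrow> A $$ (i, e) \<in> \<int>"
    and int: "\<And>I J c e. I \<subseteq> {..<dim_row A} \<Longrightarrow> J \<subseteq> {..<dim_col A} \<Longrightarrow> rows_indep (\<lambda>i e. A $$ (i, e)) I J \<Longrightarrow>
      (\<And>i. i \<in> I \<Longrightarrow> (\<Sum>e\<in>J. c e * A $$ (i, e)) \<in> \<int>) \<Longrightarrow> e \<in> J \<Longrightarrow> c e \<in> \<int>"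
  shows "totally_unimodular A"
  unfolding totally_unimodular_def
proof (intro allI impI)
  fix I J assume IJ: "I \<subseteq> {..<dim_row A} \<and> J \<subseteq> {..<dim_col A} \<and> card I = card J"
  let ?M = "submatrix A I J" and ?n = "card J"
  have M: "?M \<in> carrier_mat ?n ?n" using submatrix_carrier[of I A J] IJ by simp
  have fin: "finite I" "finite J" using IJ finite_subset by blast+
  have entry: "?M $$ (r, s) \<in> \<int>" if "r < ?n" "s < ?n" for r s
    using that IJ entries[of "pick I r" "pick J s"] pick_in_set_le[of r I] pick_in_set_le[of s J]
    by (auto simp: submatrix_pick)
  show "det ?M \<in> {-1, 0, 1}"
  proof (cases "det ?M = 0")
    case False
    then have ri: "rows_indep (\<lambda>i e. A $$ (i, e)) I J" using IJ by (simp add: det_submatrix_nonzero_iff)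
    define N where "N = mat ?n ?n (\<lambda>(s, k). adj_mat ?M $$ (s, k) / det ?M)"
    have N: "N \<in> carrier_mat ?n ?n" by (simp add: N_def)
    have MN: "?M * N = 1\<^sub>m ?n"
    proof (rule eq_matI)
      fix r k assume "r < dim_row (1\<^sub>m ?n :: real mat)" "k < dim_col (1\<^sub>m ?n :: real mat)"
      then have rk: "r < ?n" "k < ?n" by auto
      have "(?M * N) $$ (r, k) = (\<Sum>s<?n. ?M $$ (r, s) * adj_mat ?M $$ (s, k)) / det ?M"
        using M N rk by (auto simp: scalar_prod_def N_def sum_divide_distrib lessThan_atLeast0)
      also have "(\<Sum>s<?n. ?M $$ (r, s) * adj_mat ?M $$ (s, k)) = (?M * adj_mat ?M) $$ (r, k)"
        using M adj_mat(1)[OF M] rk by (auto simp: scalar_prod_def lessThan_atLeast0)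
      finally show "(?M * N) $$ (r, k) = 1\<^sub>m ?n $$ (r, k)"
        using adj_mat(2)[OF M] rk False by simp
    qed (use M N in auto)
    have "N $$ (s, k) \<in> \<int>" if sk: "s < ?n" "k < ?n" for s k
    proof -
      \<comment> \<open>Column \<open>k\<close> of the inverse as a coefficient function on
        \<open>J\<close>; its row sums are the entries of an identity column, so the integrality
        hypothesis applies.\<close>
      define c where "c = (\<lambda>e. N $$ (card {a\<in>J. a < e}, k))"
      have cp: "c (pick J s) = N $$ (s, k)" if "s < ?n" for s using that by (simp add: c_def card_pick_le)
      have "c (pick J s) \<in> \<int>"
      proof (rule int[of I J])
        fix i assume "i \<in> I"
        then obtain r where r: "r < ?n" "i = pick I r"
          using bij_betw_imp_surj_on[OF bij_betw_pick[OF fin(1)]] IJ by (metis imageE lessThan_iff)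
        have "(\<Sum>e\<in>J. c e * A $$ (i, e)) = (?M *\<^sub>v vec ?n (\<lambda>s. c (pick J s))) $ r"
          using IJ r by (simp add: submatrix_mult_vec)
        also have "\<dots> = (?M * N) $$ (r, k)"
          using M N r sk by (auto simp: scalar_prod_def cp intro!: sum.cong)
        also have "\<dots> \<in> \<int>" using MN r sk by auto
        finally show "(\<Sum>e\<in>J. c e * A $$ (i, e)) \<in> \<int>" .
      qed (use IJ ri sk in \<open>auto intro: pick_in_set_le\<close>)
      then show ?thesis using cp sk by simp
    qed
    then have "det N \<in> \<int>" using N by (intro det_Ints) auto
    moreover have "det ?M \<in> \<int>" using M entry by (intro det_Ints) auto
    moreover have "det ?M * det N = 1" using det_mult[OF M N] MN by simp
    ultimately show ?thesis using Ints_mult_eq_1 by fastforce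
  qed simp
qed

section \<open>The dual of the cycle matroid of $K_{3,6}$\<close>

text \<open>Column \<open>3 * j + s\<close> is the edge of \<open>K\<^bsub>3,6\<^esub>\<close> joining vertex \<open>s < 3\<close> to vertex \<open>j < 6\<close>;
  the columns \<open>e \<ge> 18\<close> are coloops. The columns with \<open>e < 15\<close>, \<open>e mod 3 < 2\<close> and the coloops are
  the unit vectors.\<close>

definition rep_mat :: "nat \<Rightarrow> real mat" where
  "rep_mat k = mat (10 + k) (18 + k) (\<lambda>(i, e).
     if i < 10 then of_bool (e = 3 * (i div 2) + i mod 2) - of_bool (e = 3 * (i div 2) + 2)
       - of_bool (e = 15 + i mod 2) + of_bool (e = 17)
     else of_bool (e = i + 8))"

text \<open>The linear dependencies among the columns: the cut space of \<open>K\<^bsub>3,6\<^esub>\<close>.\<close>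

definition cut_vector :: "nat \<Rightarrow> (nat \<Rightarrow> real) \<Rightarrow> bool" where
  "cut_vector k c \<longleftrightarrow>
     (\<forall>j<5. c (3 * j) - c (3 * j + 2) = c 15 - c 17 \<and> c (3 * j + 1) - c (3 * j + 2) = c 16 - c 17) \<and>
     (\<forall>e\<in>{18..<18 + k}. c e = 0)"

lemma dim_rep_mat [simp]: "dim_row (rep_mat k) = 10 + k" "dim_col (rep_mat k) = 18 + k"
  by (simp_all add: rep_mat_def)

lemma less_5_cases: "(j::nat) < 5 \<Longrightarrow> j = 0 \<or> j = 1 \<or> j = 2 \<or> j = 3 \<or> j = 4"
  and less_6_cases: "(j::nat) < 6 \<Longrightarrow> j = 0 \<or> j = 1 \<or> j = 2 \<or> j = 3 \<or> j = 4 \<or> j = 5"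
  by auto

lemma rep_row:
  assumes "j < 5" "s < 2"
  shows "(\<Sum>e<18 + k. c e * rep_mat k $$ (2 * j + s, e)) = c (3 * j + s) - c (3 * j + 2) - c (15 + s) + c 17"
proof -
  have "(\<Sum>e<18 + k. c e * rep_mat k $$ (2 * j + s, e)) =
      (\<Sum>e<18 + k. (if e = 3 * j + s then c e else 0) - (if e = 3 * j + 2 then c e else 0)
        - (if e = 15 + s then c e else 0) + (if e = 17 then c e else 0))"
    using assms by (intro sum.cong) (auto simp: rep_mat_def)
  then show ?thesis using assms by (simp add: sum.distrib sum_subtractf)
qed

lemma rep_row_coloop:
  assumes "i < k"
  shows "(\<Sum>e<18 + k. c e * rep_mat k $$ (10 + i, e)) = c (18 + i)"
proof -
  have "(\<Sum>e<18 + k. c e * rep_mat k $$ (10 + i, e)) = (\<Sum>e<18 + k. if e = 18 + i then c e else 0)"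
    using assms by (intro sum.cong) (auto simp: rep_mat_def)
  then show ?thesis using assms by simp
qed

lemma rep_rows_cases:
  fixes i :: nat
  assumes "i < 10 + k"
  obtains j s where "j < 5" "s < 2" "i = 2 * j + s" | l where "l < k" "i = 10 + l"
proof (cases "i < 10")
  case True
  then show ?thesis using that(1)[of "i div 2" "i mod 2"] by auto
next
  case False
  then show ?thesis using that(2)[of "i - 10"] assms by auto
qed

lemma sum_restrict:
  fixes c :: "nat \<Rightarrow> real"
  assumes "J \<subseteq> {..<n}"
  shows "(\<Sum>e\<in>J. c e * M e) = (\<Sum>e<n. (if e \<in> J then c e else 0) * M e)"
  using assms by (intro sum.mono_neutral_cong_left) auto

lemma rows_indepD:
  assumes "rows_indep M I S" "\<And>i. i \<in> I \<Longrightarrow> (\<Sum>e\<in>S. c e * M i e) = 0" "e \<in> S"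
  shows "c e = 0"
  using assms(1)[unfolded rows_indep_def, THEN spec[of _ c]] assms(2,3) by simp

text \<open>Instead of evaluating minors, the integrality criterion is verified: coefficients with
  integral row sums on the rows \<open>I\<close> could fail to be integral only at the price of a
  real dependency among the columns in \<open>J\<close>, restricted to \<open>I\<close>.\<close>

lemma totally_unimodular_rep_mat: "totally_unimodular (rep_mat k)"
proof (rule totally_unimodularI)
  fix i e assume "i < dim_row (rep_mat k)" "e < dim_col (rep_mat k)"
  then show "rep_mat k $$ (i, e) \<in> \<int>" by (auto simp: rep_mat_def)
next
  fix I J and c :: "nat \<Rightarrow> real" and e
  assume I: "I \<subseteq> {..<dim_row (rep_mat k)}" and J: "J \<subseteq> {..<dim_col (rep_mat k)}"
    and ri: "rows_indep (\<lambda>i e. rep_mat k $$ (i, e)) I J"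
    and int: "\<And>i. i \<in> I \<Longrightarrow> (\<Sum>e\<in>J. c e * rep_mat k $$ (i, e)) \<in> \<int>" and e: "e \<in> J"
  define c0 where "c0 = (\<lambda>e. if e \<in> J then c e else 0)"
  have sumJ: "(\<Sum>e\<in>J. f e * rep_mat k $$ (i, e)) = (\<Sum>e<18 + k. (if e \<in> J then f e else 0) * rep_mat k $$ (i, e))" for f i
    using J by (intro sum_restrict) simp
  have sum_c0: "(\<Sum>e\<in>J. c e * rep_mat k $$ (i, e)) = (\<Sum>e<18 + k. c0 e * rep_mat k $$ (i, e))" for i
    by (simp add: sumJ c0_def)
  have row_int: "c0 (3 * j + s) - c0 (3 * j + 2) - c0 (15 + s) + c0 17 \<in> \<int>"
    if "j < 5" "s < 2" "2 * j + s \<in> I" for j s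
    using int[OF that(3)] unfolding sum_c0 rep_row[OF that(1,2)] .
  \<comment> \<open>No unit column of a deleted row occurs, as it would vanish on the remaining rows.\<close>
  have unit: "2 * j + s \<in> I" if "j < 5" "s < 2" "3 * j + s \<in> J" for j s
  proof (rule ccontr)
    assume *: "2 * j + s \<notin> I"
    have "(\<Sum>e\<in>J. of_bool (e = 3 * j + s) * rep_mat k $$ (i, e)) = 0" if i: "i \<in> I" for i
    proof -
      have "i < 10 + k" using i I by auto
      then show ?thesis
      proof (cases rule: rep_rows_cases)
        case (1 j' s')
        then have "3 * j' + s' \<noteq> 3 * j + s"
        proof -
          have ne: "2 * j' + s' \<noteq> 2 * j + s" using * i 1 by metis
          have "(3 * j' + s') div 3 = j'" "(3 * j' + s') mod 3 = s'"
            "(3 * j + s) div 3 = j" "(3 * j + s) mod 3 = s" using 1(2) \<open>s < 2\<close> by auto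
          with ne show ?thesis by metis
        qed
        moreover have "3 * j' + 2 \<noteq> 3 * j + s"
        proof -
          have "(3 * j' + 2) mod 3 = 2" by (subst mod_mult_self4) simp
          moreover have "(3 * j + s) mod 3 = s" using \<open>s < 2\<close> by auto
          ultimately show ?thesis using \<open>s < 2\<close> by auto
        qed
        ultimately show ?thesis unfolding sumJ using 1 \<open>j < 5\<close> \<open>s < 2\<close> by (auto simp: rep_row)
      next
        case (2 l)
        then show ?thesis unfolding sumJ using \<open>j < 5\<close> \<open>s < 2\<close> by (auto simp: rep_row_coloop)
      qed
    qed
    from rows_indepD[OF ri this that(3)] show False by simp
  qed
  have coloop: "10 + l \<in> I" if "l < k" "18 + l \<in> J" for l
  proof (rule ccontr)
    assume *: "10 + l \<notin> I"
    have "(\<Sum>e\<in>J. of_bool (e = 18 + l) * rep_mat k $$ (i, e)) = 0" if i: "i \<in> I" for i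
    proof -
      have "i < 10 + k" using i I by auto
      then show ?thesis
      proof (cases rule: rep_rows_cases)
        case (1 j' s')
        then show ?thesis unfolding sumJ by (auto simp: rep_row)
      next
        case (2 l')
        then show ?thesis unfolding sumJ using * i by (auto simp: rep_row_coloop)
      qed
    qed
    from rows_indepD[OF ri this that(2)] show False by simp
  qed
  \<comment> \<open>Modulo 1, \<open>c0\<close> is the difference of a potential on the vertices of \<open>K\<^bsub>3,6\<^esub>\<close> (away from the deleted
    rows), and the vertices with integral potential define a cut \<open>d\<close> that is supported on the edges where
    \<open>c0\<close> is not integral. As no such cut exists, \<open>c0\<close> is integral.\<close>
  define z where "z = (\<lambda>x::real. of_bool (x \<in> \<int>) :: real)"
  define p where "p = (\<lambda>s. c0 (15 + s) - c0 17)"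
  \<comment> \<open>Vertex \<open>j\<close> gets the potential \<open>c0 (3 * j + 2)\<close> and
    vertex \<open>s\<close> gets \<open>- p s\<close>; a number is integral iff its negative is, so
    \<open>z\<close> may be applied to \<open>p s\<close>.\<close>
  define d where "d = (\<lambda>e. if e \<ge> 18 then 0 else z (c0 (3 * (e div 3) + 2)) - z (p (e mod 3)))"
  have p2: "p 2 = 0" by (simp add: p_def)
  have d: "d (3 * j + s) = z (c0 (3 * j + 2)) - z (p s)" if "j < 6" "s < 3" for j s
    using that by (auto simp: d_def)
  have z_add: "z x = z y" if "x + y \<in> \<int>" for x y
    using that Ints_diff[OF that, of x] Ints_diff[OF that, of y] by (auto simp: z_def)
  have dJ: "d (3 * j + s) = 0" if "j < 6" "s < 3" "3 * j + s \<notin> J"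
    "s = 2 \<or> j = 5 \<or> 2 * j + s \<in> I" for j s
  proof -
    have c0: "c0 (3 * j + s) = 0" using that(3) by (simp add: c0_def)
    have "c0 (3 * j + 2) + p s \<in> \<int>"
    proof (cases "s = 2 \<or> j = 5")
      case True
      then show ?thesis using c0 p2 by (auto simp: p_def)
    next
      case False
      then have "c0 (3 * j + s) - c0 (3 * j + 2) - c0 (15 + s) + c0 17 \<in> \<int>"
        using that by (intro row_int) auto
      then have "- (c0 (3 * j + 2) + p s) \<in> \<int>" using c0 by (simp add: p_def algebra_simps)
      then show ?thesis by (simp only: minus_in_Ints_iff)
    qed
    then show ?thesis using d[OF that(1,2)] z_add by simp
  qed
  have "(\<Sum>e\<in>J. d e * rep_mat k $$ (i, e)) = 0" if i: "i \<in> I" for i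
  proof -
    \<comment> \<open>Cutting \<open>d\<close> down to \<open>J\<close> does not change the rows in
      \<open>I\<close>: by \<open>dJ\<close> the entries of these rows outside \<open>J\<close> are
      zero already.\<close>
    define d0 where "d0 = (\<lambda>e. if e \<in> J then d e else 0)"
    have "i < 10 + k" using i I by auto
    then show ?thesis
    proof (cases rule: rep_rows_cases)
      case (1 j s)
      have eq: "d0 (3 * j + s) = d (3 * j + s)" if "j < 6" "s < 3" "s = 2 \<or> j = 5 \<or> 2 * j + s \<in> I" for j s
        using dJ[of j s] that by (auto simp: d0_def)
      have "d0 (3 * j + s) - d0 (3 * j + 2) - d0 (3 * 5 + s) + d0 (3 * 5 + 2) =
          d (3 * j + s) - d (3 * j + 2) - d (3 * 5 + s) + d (3 * 5 + 2)"
        using 1 i by (subst (1 2 3 4) eq) auto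
      also have "\<dots> = 0" using 1 by (subst (1 2 3 4) d) auto
      finally have "(\<Sum>e<18 + k. d0 e * rep_mat k $$ (2 * j + s, e)) = 0"
        unfolding rep_row[OF 1(1,2)] by simp
      then show ?thesis by (simp add: sumJ d0_def 1)
    next
      case (2 l)
      then show ?thesis unfolding sumJ by (simp add: rep_row_coloop d_def)
    qed
  qed
  then have d0: "\<forall>e\<in>J. d e = 0" using rows_indepD[OF ri, of d] by blast
  \<comment> \<open>The normalisation \<open>p 2 = 0\<close> is integral, so the edges with
    \<open>s = 2\<close> force an integral potential at every \<open>j\<close>, and the edges at
    \<open>j = 5\<close> then at every \<open>s\<close>.\<close>
  have d_nonunit: "d (3 * j + s) = 0" if "j < 6" "s < 3" "s = 2 \<or> j = 5" for j s
    using d0 dJ[of j s] that by blast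
  have z0: "z 0 = 1" by (simp add: z_def)
  have q: "c0 (3 * j + 2) \<in> \<int>" if "j < 6" for j
    using d_nonunit[of j 2] d[of j 2] that p2 z0 by (auto simp: z_def split: if_splits)
  have p: "p s \<in> \<int>" if "s < 3" for s
    using d_nonunit[of 5 s] d[of 5 s] q[of 5] that by (auto simp: z_def split: if_splits)
  have "c0 e \<in> \<int>"
  proof (cases "e < 18")
    case True
    define j s where "j = e div 3" and "s = e mod 3"
    have js: "e = 3 * j + s" "j < 6" "s < 3" using True by (auto simp: j_def s_def)
    have "c0 (3 * j + s) - c0 (3 * j + 2) - p s \<in> \<int>"
    proof (cases "s = 2 \<or> j = 5")
      case True
      then show ?thesis using p2 by (auto simp: p_def)
    next
      case False
      then have *: "j < 5" "s < 2" using js by auto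
      from row_int[OF this unit[OF this]] e js(1) show ?thesis by (simp add: p_def algebra_simps)
    qed
    from Ints_add[OF this Ints_add[OF q[OF js(2)] p[OF js(3)]]] show ?thesis using js(1) by simp
  next
    case False
    define l where "l = e - 18"
    have l: "l < k" "e = 18 + l" using False e J by (auto simp: l_def)
    from int[OF coloop[OF l(1)]] e l show ?thesis
      unfolding sum_c0 by (simp add: rep_row_coloop)
  qed
  then show "c e \<in> \<int>" using e by (simp add: c0_def)
qed

section \<open>Dependencies and circuits of an arbitrary representation\<close>

lemma sum_restrict_family:
  fixes a :: "nat \<Rightarrow> 'v::real_vector"
  assumes "S \<subseteq> {..<n::nat}"
  shows "(\<Sum>e\<in>S. c e *\<^sub>R a e) = (\<Sum>e<n. (if e \<in> S then c e else 0) *\<^sub>R a e)"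
  using assms by (intro sum.mono_neutral_cong_left) auto

text \<open>Sums of columns are determined by their coefficients modulo cuts. Any family with this
  property has the matroid of \<open>rep_mat k\<close>, and the count needs nothing else about the
  vectors except integrality.\<close>

definition cut_dependencies :: "nat \<Rightarrow> (nat \<Rightarrow> 'v::real_vector) \<Rightarrow> bool" where
  "cut_dependencies k a \<longleftrightarrow> (\<forall>c. (\<Sum>e<18 + k. c e *\<^sub>R a e) = 0 \<longleftrightarrow> cut_vector k c)"

lemma cut_dependencies_rep: "cut_dependencies k (matrix_column (rep_mat k))"
  unfolding cut_dependencies_def
proof
  fix c
  have col: "(\<Sum>e<18 + k. c e *\<^sub>R matrix_column (rep_mat k) e) i =
      (if i < 10 + k then \<Sum>e<18 + k. c e * rep_mat k $$ (i, e) else 0)" for i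
    by (auto simp: sum_fun_apply scaleR_fun_def matrix_column_def)
  have "(\<Sum>e<18 + k. c e *\<^sub>R matrix_column (rep_mat k) e) = 0 \<longleftrightarrow>
      (\<forall>i<10 + k. (\<Sum>e<18 + k. c e * rep_mat k $$ (i, e)) = 0)"
    unfolding fun_eq_iff col by auto
  also have "\<dots> \<longleftrightarrow> (\<forall>j<5. \<forall>s<2. (\<Sum>e<18 + k. c e * rep_mat k $$ (2 * j + s, e)) = 0) \<and>
      (\<forall>l<k. (\<Sum>e<18 + k. c e * rep_mat k $$ (10 + l, e)) = 0)"
    by (auto elim!: rep_rows_cases)
  also have "\<dots> \<longleftrightarrow> (\<forall>j<5. \<forall>s<2. c (3 * j + s) - c (3 * j + 2) - c (15 + s) + c 17 = 0) \<and>
      (\<forall>l<k. c (18 + l) = 0)"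
    by (simp add: rep_row rep_row_coloop)
  also have "(\<forall>l<k. c (18 + l) = 0) \<longleftrightarrow> (\<forall>e\<in>{18..<18 + k}. c e = 0)"
    by (metis add_less_cancel_left atLeastLessThan_iff le_add1 le_Suc_ex)
  also have "(\<forall>j<5. \<forall>s<2. c (3 * j + s) - c (3 * j + 2) - c (15 + s) + c 17 = 0) \<longleftrightarrow>
      (\<forall>j<5. c (3 * j) - c (3 * j + 2) = c 15 - c 17 \<and> c (3 * j + 1) - c (3 * j + 2) = c 16 - c 17)"
    by (auto simp: less_2_cases_iff algebra_simps)
  finally show "(\<Sum>e<18 + k. c e *\<^sub>R matrix_column (rep_mat k) e) = 0 \<longleftrightarrow> cut_vector k c"
    unfolding cut_vector_def .
qed

lemma cut_dependencies_fam_indep: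
  assumes "cut_dependencies k a" "S \<subseteq> {..<18 + k}"
  shows "fam_indep a S \<longleftrightarrow> (\<forall>c. (\<forall>e. e \<notin> S \<longrightarrow> c e = 0) \<longrightarrow> cut_vector k c \<longrightarrow> (\<forall>e. c e = 0))"
proof
  assume *: "fam_indep a S"
  show "\<forall>c. (\<forall>e. e \<notin> S \<longrightarrow> c e = 0) \<longrightarrow> cut_vector k c \<longrightarrow> (\<forall>e. c e = 0)"
  proof (intro allI impI)
    fix c e assume c: "\<forall>e. e \<notin> S \<longrightarrow> c e = 0" "cut_vector k c"
    have "(\<Sum>e\<in>S. c e *\<^sub>R a e) = (\<Sum>e<18 + k. c e *\<^sub>R a e)"
      unfolding sum_restrict_family[OF assms(2)] using c(1) by (intro sum.cong) auto
    also have "\<dots> = 0" using assms(1) c(2) by (simp add: cut_dependencies_def)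
    finally show "c e = 0" using * c(1) by (cases "e \<in> S") (auto simp: fam_indep_def)
  qed
next
  assume *: "\<forall>c. (\<forall>e. e \<notin> S \<longrightarrow> c e = 0) \<longrightarrow> cut_vector k c \<longrightarrow> (\<forall>e. c e = 0)"
  show "fam_indep a S" unfolding fam_indep_def
  proof (intro allI impI ballI)
    fix c e assume "(\<Sum>e\<in>S. c e *\<^sub>R a e) = 0" "e \<in> S"
    then have "cut_vector k (\<lambda>e. if e \<in> S then c e else 0)"
      using assms unfolding sum_restrict_family[OF assms(2)] cut_dependencies_def by blast
    with *[rule_format, of "\<lambda>e. if e \<in> S then c e else 0" e] \<open>e \<in> S\<close> show "c e = 0" by simp
  qed
qed

lemma fam_indep_sparse:
  assumes "fam_indep a (S - {x})" "x \<in> S" "finite S" "(\<Sum>e\<in>S. c e *\<^sub>R a e) = 0" "c x = 0" "e \<in> S"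
  shows "c e = 0"
proof (cases "e = x")
  case False
  have "(\<Sum>e\<in>S - {x}. c e *\<^sub>R a e) = 0" using assms by (simp add: sum.remove)
  with fam_indepD[OF assms(1)] False assms(6) show ?thesis by simp
qed (use assms in simp)

text \<open>Stated for families, so that columns can be renamed and their signs changed without
  rebuilding a matrix.\<close>

definition integral_coefficients :: "nat \<Rightarrow> (nat \<Rightarrow> nat \<Rightarrow> real) \<Rightarrow> bool" where
  "integral_coefficients n a \<longleftrightarrow> (\<forall>S c. S \<subseteq> {..<n} \<longrightarrow> fam_indep a S \<longrightarrow>
     (\<forall>i. (\<Sum>e\<in>S. c e *\<^sub>R a e) i \<in> \<int>) \<longrightarrow> (\<forall>e\<in>S. c e \<in> \<int>))"

lemma integral_coefficientsD:
  "integral_coefficients n a \<Longrightarrow> S \<subseteq> {..<n} \<Longrightarrow> fam_indep a S \<Longrightarrow> (\<And>i. (\<Sum>e\<in>S. c e *\<^sub>R a e) i \<in> \<int>) \<Longrightarrow> e \<in> S \<Longrightarrow> c e \<in> \<int>"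
  unfolding integral_coefficients_def by blast

text \<open>Solving a circuit relation for the element \<open>x\<close> writes \<open>- a x\<close>
  in terms of the independent rest with coefficients \<open>c e / c x\<close>, which are therefore
  integral. Exchanging \<open>e\<close> and \<open>x\<close> shows that the inverse ratio is
  integral too, so all ratios are 1 or -1.\<close>

lemma unit_circuit:
  fixes a :: "nat \<Rightarrow> nat \<Rightarrow> real"
  assumes int: "integral_coefficients n a"
    and aint: "\<And>e i. e < n \<Longrightarrow> a e i \<in> \<int>"
    and C: "C \<subseteq> {..<n}" "\<not> fam_indep a C" "\<And>e. e \<in> C \<Longrightarrow> fam_indep a (C - {e})"
  obtains \<epsilon> where "\<And>e. \<epsilon> e \<in> {-1, 1::real}" "(\<Sum>e\<in>C. \<epsilon> e *\<^sub>R a e) = 0"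
proof -
  have fin: "finite C" using C(1) finite_subset by blast
  obtain c e0 where c: "(\<Sum>e\<in>C. c e *\<^sub>R a e) = 0" "e0 \<in> C" "c e0 \<noteq> 0"
    using C(2) by (auto simp: fam_indep_def)
  have nz: "c e \<noteq> 0" if "e \<in> C" for e
    using fam_indep_sparse[OF C(3)[OF that] that fin c(1) _ c(2)] c(3) by blast
  have ratio: "c e / c x \<in> \<int>" if "x \<in> C" "e \<in> C" for e x
  proof (cases "e = x")
    case False
    show ?thesis
    proof (rule integral_coefficientsD[OF int, of "C - {x}" "\<lambda>e. c e / c x" e])
      fix i
      have "c x *\<^sub>R a x + (\<Sum>e\<in>C - {x}. c e *\<^sub>R a e) = 0" using c(1) fin that by (simp add: sum.remove)
      then have "(\<Sum>e\<in>C - {x}. c e *\<^sub>R a e) = - c x *\<^sub>R a x" by (simp add: eq_neg_iff_add_eq_0 add.commute)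
      then have "(1 / c x) *\<^sub>R (\<Sum>e\<in>C - {x}. c e *\<^sub>R a e) = - a x" using nz[OF that(1)] by simp
      then have "(\<Sum>e\<in>C - {x}. (c e / c x) *\<^sub>R a e) = - a x"
        by (simp add: scaleR_sum_right)
      then show "(\<Sum>e\<in>C - {x}. (c e / c x) *\<^sub>R a e) i \<in> \<int>" using aint[of x i] that C(1) by auto
    next
      show "C - {x} \<subseteq> {..<n}" using C(1) by blast
      show "fam_indep a (C - {x})" by (rule C(3)[OF that(1)])
      show "e \<in> C - {x}" using that(2) False by blast
    qed
  qed (simp add: nz[OF that(1)])
  define \<epsilon> where "\<epsilon> = (\<lambda>e. if e \<in> C then c e / c e0 else 1)"
  have sgn: "\<epsilon> e \<in> {-1, 1}" for e
  proof (cases "e \<in> C")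
    case True
    have "(c e / c e0) * (c e0 / c e) = 1" using nz[OF True] c(3) by simp
    from Ints_mult_eq_1[OF this ratio[OF c(2) True] ratio[OF True c(2)]] True
    show ?thesis by (auto simp: \<epsilon>_def)
  qed (simp add: \<epsilon>_def)
  have "(\<Sum>e\<in>C. \<epsilon> e *\<^sub>R a e) = (1 / c e0) *\<^sub>R (\<Sum>e\<in>C. c e *\<^sub>R a e)"
    by (simp add: \<epsilon>_def scaleR_sum_right)
  with c(1) have "(\<Sum>e\<in>C. \<epsilon> e *\<^sub>R a e) = 0" by simp
  then show ?thesis by (rule that[OF sgn])
qed

text \<open>The edges off the spanning tree of K_{3,6} formed by all edges at the vertices
  \<open>s = 2\<close> and \<open>j = 5\<close>, with the coloops; the complement of a spanning tree
  is a basis of the dual.\<close>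

definition base :: "nat \<Rightarrow> nat set" where
  "base k = {0, 1, 3, 4, 6, 7, 9, 10, 12, 13} \<union> {18..<18 + k}"

lemma cut_vector_unroll: "cut_vector k c \<longleftrightarrow>
    c 0 - c 2 = c 15 - c 17 \<and> c 1 - c 2 = c 16 - c 17 \<and> c 3 - c 5 = c 15 - c 17 \<and> c 4 - c 5 = c 16 - c 17 \<and>
    c 6 - c 8 = c 15 - c 17 \<and> c 7 - c 8 = c 16 - c 17 \<and> c 9 - c 11 = c 15 - c 17 \<and> c 10 - c 11 = c 16 - c 17 \<and>
    c 12 - c 14 = c 15 - c 17 \<and> c 13 - c 14 = c 16 - c 17 \<and> (\<forall>e\<in>{18..<18 + k}. c e = 0)"
proof -
  have all5: "(\<forall>j<5. P j) \<longleftrightarrow> P 0 \<and> P 1 \<and> P 2 \<and> P 3 \<and> P (4::nat)" for P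
    using less_5_cases by (auto simp: numeral_eq_Suc less_Suc_eq)
  show ?thesis unfolding cut_vector_def all5 by (auto simp: numeral_eq_Suc)
qed

lemma all_less_18: "(\<forall>e<18. P e) \<longleftrightarrow> P 0 \<and> P 1 \<and> P 2 \<and> P 3 \<and> P 4 \<and> P 5 \<and> P 6 \<and> P 7 \<and> P 8 \<and> P 9 \<and> P 10 \<and>
    P 11 \<and> P 12 \<and> P 13 \<and> P 14 \<and> P 15 \<and> P 16 \<and> P (17::nat)"
  by (simp add: numeral_eq_Suc All_less_Suc2 conj_ac) 

lemma cut_dependencies_fam_indepI:
  assumes "cut_dependencies k a" "S \<subseteq> {..<18 + k}"
    and "\<And>c. (\<forall>e. e \<notin> S \<longrightarrow> c e = 0) \<Longrightarrow> cut_vector k c \<Longrightarrow> \<forall>e<18. c e = 0"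
  shows "fam_indep a S"
  unfolding cut_dependencies_fam_indep[OF assms(1,2)]
proof (intro allI impI)
  fix c e assume c: "\<forall>e. e \<notin> S \<longrightarrow> c e = 0" "cut_vector k c"
  consider "e < 18" | "e \<in> {18..<18 + k}" | "e \<notin> S" using assms(2) by fastforce
  then show "c e = 0"
    using assms(3)[OF c] c by cases (auto simp: cut_vector_def)
qed

lemma not_fam_indepI:
  assumes "cut_dependencies k a" "S \<subseteq> {..<18 + k}" "cut_vector k c" "\<And>e. e \<notin> S \<Longrightarrow> c e = 0" "c e \<noteq> 0"
  shows "\<not> fam_indep a S"
  using assms(3-5) unfolding cut_dependencies_fam_indep[OF assms(1,2)] by blast

text \<open>A cut that vanishes on a spanning tree is zero.\<close>

lemma fam_indep_base:
  assumes "cut_dependencies k a"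
  shows "fam_indep a (base k)"
proof (rule cut_dependencies_fam_indepI[OF assms])
  show "base k \<subseteq> {..<18 + k}" by (auto simp: base_def)
  fix c assume c: "\<forall>e. e \<notin> base k \<longrightarrow> c e = (0::real)" and cv: "cut_vector k c"
  have "c 2 = 0" "c 5 = 0" "c 8 = 0" "c 11 = 0" "c 14 = 0" "c 15 = 0" "c 16 = 0" "c 17 = 0"
    by (rule c[rule_format], simp add: base_def)+
  then show "\<forall>e<18. c e = 0" using cv unfolding cut_vector_unroll all_less_18 by simp
qed

definition triangle :: "nat \<Rightarrow> nat set" where
  "triangle j = {3 * j, 3 * j + 1, 3 * j + 2}"

definition star :: "nat \<Rightarrow> nat set" where
  "star s = {s, 3 + s, 6 + s, 9 + s, 12 + s, 15 + s}"

text \<open>The edges at one vertex form a minimal cut of K_{3,6}, that is, a circuit of the dual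
  matroid; \<open>star_circuit\<close> is the same for the vertices of the other side.\<close>

lemma triangle_circuit:
  assumes "cut_dependencies k a" "j < 6"
  shows "\<not> fam_indep a (triangle j)" "e \<in> triangle j \<Longrightarrow> fam_indep a (triangle j - {e})"
proof -
  have sub: "triangle j \<subseteq> {..<18 + k}" using assms(2) by (auto simp: triangle_def)
  show "\<not> fam_indep a (triangle j)"
  proof (rule not_fam_indepI[OF assms(1) sub])
    show "cut_vector k (\<lambda>e. of_bool (e \<in> triangle j))"
      using less_6_cases[OF assms(2)] by (elim disjE) (auto simp: cut_vector_unroll triangle_def simp del: add_2_eq_Suc add_2_eq_Suc' One_nat_def)
    show "of_bool (3 * j \<in> triangle j) \<noteq> (0::real)" by (simp add: triangle_def)
  qed simp
  assume e: "e \<in> triangle j"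
  show "fam_indep a (triangle j - {e})"
  proof (rule cut_dependencies_fam_indepI[OF assms(1)])
    fix c assume c: "\<forall>x. x \<notin> triangle j - {e} \<longrightarrow> c x = (0::real)" and cv: "cut_vector k c"
    have "\<forall>x<18. x \<notin> triangle j \<longrightarrow> c x = 0" "c e = 0" using c by auto
    then show "\<forall>x<18. c x = 0"
      using less_6_cases[OF assms(2)] e cv unfolding triangle_def
      by (elim disjE) (auto simp: cut_vector_unroll all_less_18 simp del: add_2_eq_Suc add_2_eq_Suc' One_nat_def)
  qed (use sub in auto)
qed

lemma star_circuit:
  assumes "cut_dependencies k a" "s < 3"
  shows "\<not> fam_indep a (star s)" "e \<in> star s \<Longrightarrow> fam_indep a (star s - {e})"
proof -
  have s: "s = 0 \<or> s = 1 \<or> s = 2" using assms(2) by auto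
  have sub: "star s \<subseteq> {..<18 + k}" using assms(2) by (auto simp: star_def)
  show "\<not> fam_indep a (star s)"
  proof (rule not_fam_indepI[OF assms(1) sub])
    show "cut_vector k (\<lambda>e. of_bool (e \<in> star s))"
      using s by (elim disjE) (auto simp: cut_vector_unroll star_def simp del: add_2_eq_Suc add_2_eq_Suc' One_nat_def)
    show "of_bool (s \<in> star s) \<noteq> (0::real)" by (simp add: star_def)
  qed simp
  assume e: "e \<in> star s"
  show "fam_indep a (star s - {e})"
  proof (rule cut_dependencies_fam_indepI[OF assms(1)])
    fix c assume c: "\<forall>x. x \<notin> star s - {e} \<longrightarrow> c x = (0::real)" and cv: "cut_vector k c"
    have "\<forall>x<18. x \<notin> star s \<longrightarrow> c x = 0" "c e = 0" using c by auto
    then show "\<forall>x<18. c x = 0"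
      using s e cv unfolding star_def
      by (elim disjE) (auto simp: cut_vector_unroll all_less_18 simp del: add_2_eq_Suc add_2_eq_Suc' One_nat_def)
  qed (use sub in auto)
qed

lemma sum_less_18_plus:
  fixes f :: "nat \<Rightarrow> 'b::comm_monoid_add"
  shows "(\<Sum>e<18 + k. f e) = f 0 + f 1 + f 2 + f 3 + f 4 + f 5 + f 6 + f 7 + f 8 + f 9 + f 10 + f 11 + f 12 + f 13
    + f 14 + f 15 + f 16 + f 17 + (\<Sum>e\<in>{18..<18 + k}. f e)"
proof -
  have "(\<Sum>e<18 + k. f e) = (\<Sum>e<18. f e) + (\<Sum>e\<in>{18..<18 + k}. f e)"
    by (subst sum.union_disjoint[symmetric]) (auto intro!: sum.cong)
  also have "(\<Sum>e<18. f e) = f 0 + f 1 + f 2 + f 3 + f 4 + f 5 + f 6 + f 7 + f 8 + f 9 + f 10 + f 11 + f 12 + f 13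
    + f 14 + f 15 + f 16 + f 17" by (simp add: eval_nat_numeral)
  finally show ?thesis .
qed

lemma sum_base:
  fixes f :: "nat \<Rightarrow> 'b::comm_monoid_add"
  shows "(\<Sum>e\<in>base k. f e) = f 0 + f 1 + f 3 + f 4 + f 6 + f 7 + f 9 + f 10 + f 12 + f 13 + (\<Sum>e\<in>{18..<18 + k}. f e)"
  unfolding base_def by (subst sum.union_disjoint) (auto simp: add_ac)

lemma triangle_solve:
  fixes a :: "nat \<Rightarrow> 'v::real_vector"
  assumes "\<And>j. j < 6 \<Longrightarrow> a (3 * j) + a (3 * j + 1) + a (3 * j + 2) = 0"
  shows "a 2 = - a 0 - a 1" "a 5 = - a 3 - a 4" "a 8 = - a 6 - a 7" "a 11 = - a 9 - a 10"
    "a 14 = - a 12 - a 13" "a 17 = - a 15 - a 16"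
  using assms[of 0] assms[of 1] assms[of 2] assms[of 3] assms[of 4] assms[of 5]
  unfolding add_eq_0_iff by (simp_all del: add_2_eq_Suc add_2_eq_Suc' One_nat_def)

text \<open>The six triangle relations and two star relations express the eight columns outside the
  base. In \<open>d\<close> are the resulting coefficients, and independence of the base leaves
  exactly the cut equations. The third star relation follows, as stars and triangles have the same
  total sum.\<close>

lemma cut_dependenciesI:
  fixes a :: "nat \<Rightarrow> 'v::real_vector"
  assumes ind: "fam_indep a (base k)"
    and tri: "\<And>j. j < 6 \<Longrightarrow> a (3 * j) + a (3 * j + 1) + a (3 * j + 2) = 0"
    and st0: "a 0 + a 3 + a 6 + a 9 + a 12 + a 15 = 0"
    and st1: "a 1 + a 4 + a 7 + a 10 + a 13 + a 16 = 0"
  shows "cut_dependencies k a"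
  unfolding cut_dependencies_def
proof
  fix c :: "nat \<Rightarrow> real"
  define d where "d = (\<lambda>e. if 18 \<le> e then c e
     else if e mod 3 = 0 then c e - c (e + 2) - (c 15 - c 17)
     else c e - c (e + 1) - (c 16 - c 17))"
  have t: "a 2 = - a 0 - a 1" "a 5 = - a 3 - a 4" "a 8 = - a 6 - a 7" "a 11 = - a 9 - a 10" "a 14 = - a 12 - a 13"
    "a 17 = - a 15 - a 16"
    using triangle_solve[of a, OF tri] by blast+
  have s: "a 15 = - a 0 - a 3 - a 6 - a 9 - a 12" "a 16 = - a 1 - a 4 - a 7 - a 10 - a 13"
    using st0 st1 unfolding add_eq_0_iff by simp_all
  have dvals: "d 0 = c 0 - c 2 - (c 15 - c 17)" "d 1 = c 1 - c 2 - (c 16 - c 17)"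
    "d 3 = c 3 - c 5 - (c 15 - c 17)" "d 4 = c 4 - c 5 - (c 16 - c 17)"
    "d 6 = c 6 - c 8 - (c 15 - c 17)" "d 7 = c 7 - c 8 - (c 16 - c 17)"
    "d 9 = c 9 - c 11 - (c 15 - c 17)" "d 10 = c 10 - c 11 - (c 16 - c 17)"
    "d 12 = c 12 - c 14 - (c 15 - c 17)" "d 13 = c 13 - c 14 - (c 16 - c 17)"
    by (simp_all add: d_def del: add_2_eq_Suc add_2_eq_Suc' One_nat_def)
  have rest: "(\<Sum>e\<in>{18..<18 + k}. d e *\<^sub>R a e) = (\<Sum>e\<in>{18..<18 + k}. c e *\<^sub>R a e)"
    by (intro sum.cong) (auto simp: d_def)
  have "(\<Sum>e<18 + k. c e *\<^sub>R a e) = (\<Sum>e\<in>base k. d e *\<^sub>R a e)"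
    unfolding sum_less_18_plus sum_base rest dvals t s by (simp add: algebra_simps)
  then have "(\<Sum>e<18 + k. c e *\<^sub>R a e) = 0 \<longleftrightarrow> (\<forall>e\<in>base k. d e = 0)"
    using fam_indepD[OF ind, of d] by auto
  also have "\<dots> \<longleftrightarrow> cut_vector k c"
    unfolding base_def cut_vector_unroll ball_Un by (auto simp: dvals simp del: add_2_eq_Suc add_2_eq_Suc' One_nat_def) (auto simp: d_def)
  finally show "(\<Sum>e<18 + k. c e *\<^sub>R a e) = 0 \<longleftrightarrow> cut_vector k c" .
qed

text \<open>All columns are written in the base with the unknown signs \<delta>. The coefficients of
  the third star relation must then vanish: at the columns \<open>3 * j\<close> this makes all
  \<eta> equal, and at the columns \<open>3 * j + 1\<close> all \<delta>.\<close>

lemma third_star: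
  fixes a :: "nat \<Rightarrow> 'v::real_vector" and \<delta> \<eta> :: "nat \<Rightarrow> real"
  assumes base0: "fam_indep a (base 0)"
    and tri: "\<And>j. j < 6 \<Longrightarrow> a (3 * j) + a (3 * j + 1) + a (3 * j + 2) = 0"
    and st0: "a 0 + a 3 + a 6 + a 9 + a 12 + a 15 = 0"
    and \<delta>sum: "\<delta> 1 *\<^sub>R a 1 + \<delta> 4 *\<^sub>R a 4 + \<delta> 7 *\<^sub>R a 7 + \<delta> 10 *\<^sub>R a 10 + \<delta> 13 *\<^sub>R a 13 + \<delta> 16 *\<^sub>R a 16 = 0"
    and \<eta>sum: "\<eta> 2 *\<^sub>R a 2 + \<eta> 5 *\<^sub>R a 5 + \<eta> 8 *\<^sub>R a 8 + \<eta> 11 *\<^sub>R a 11 + \<eta> 14 *\<^sub>R a 14 + \<eta> 17 *\<^sub>R a 17 = 0"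
    and \<delta>: "\<And>e. \<delta> e \<in> {-1, 1::real}" and \<eta>: "\<And>e. \<eta> e \<in> {-1, 1::real}"
  shows "a 1 + a 4 + a 7 + a 10 + a 13 + a 16 = 0"
proof -
  have t: "a 2 = - a 0 - a 1" "a 5 = - a 3 - a 4" "a 8 = - a 6 - a 7" "a 11 = - a 9 - a 10"
    "a 14 = - a 12 - a 13" "a 17 = - a 15 - a 16"
    using triangle_solve[of a, OF tri] by blast+
  have a5: "a 15 = - a 0 - a 3 - a 6 - a 9 - a 12"
    using st0 unfolding add_eq_0_iff by simp
  have "a 16 = \<delta> 16 *\<^sub>R \<delta> 16 *\<^sub>R a 16" using \<delta>[of 16] by auto
  also have "\<delta> 16 *\<^sub>R a 16 = - \<delta> 1 *\<^sub>R a 1 - \<delta> 4 *\<^sub>R a 4 - \<delta> 7 *\<^sub>R a 7 - \<delta> 10 *\<^sub>R a 10 - \<delta> 13 *\<^sub>R a 13"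
    using \<delta>sum unfolding add_eq_0_iff by simp
  finally have a6: "a 16 = - (\<delta> 16 * \<delta> 1) *\<^sub>R a 1 - (\<delta> 16 * \<delta> 4) *\<^sub>R a 4 - (\<delta> 16 * \<delta> 7) *\<^sub>R a 7
     - (\<delta> 16 * \<delta> 10) *\<^sub>R a 10 - (\<delta> 16 * \<delta> 13) *\<^sub>R a 13"
    by (simp add: scaleR_diff_right)
  define d where "d = (\<lambda>e. if e mod 3 = 0 then \<eta> (e + 2) - \<eta> 17 else \<eta> (e + 1) - \<eta> 17 * (\<delta> 16 * \<delta> e))"
  have "(\<Sum>e\<in>base 0. d e *\<^sub>R a e) = 0"
    using \<eta>sum unfolding sum_base t a5 a6 by (simp add: d_def algebra_simps del: add_2_eq_Suc add_2_eq_Suc' One_nat_def)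
  then have d0: "d e = 0" if "e \<in> base 0" for e using fam_indepD[OF base0 _ that] by blast
  have \<eta>eq: "\<eta> 2 = \<eta> 17" "\<eta> 5 = \<eta> 17" "\<eta> 8 = \<eta> 17" "\<eta> 11 = \<eta> 17" "\<eta> 14 = \<eta> 17"
    using d0[of 0] d0[of 3] d0[of 6] d0[of 9] d0[of 12] by (simp_all add: d_def base_def del: add_2_eq_Suc add_2_eq_Suc' One_nat_def)
  have \<delta>eq: "\<delta> 16 * \<delta> 1 = 1" "\<delta> 16 * \<delta> 4 = 1" "\<delta> 16 * \<delta> 7 = 1" "\<delta> 16 * \<delta> 10 = 1" "\<delta> 16 * \<delta> 13 = 1"
    using d0[of 1] d0[of 4] d0[of 7] d0[of 10] d0[of 13] \<eta>eq \<eta>[of 17] by (auto simp: d_def base_def simp del: add_2_eq_Suc add_2_eq_Suc' One_nat_def)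
  show "a 1 + a 4 + a 7 + a 10 + a 13 + a 16 = 0"
    unfolding a6 \<delta>eq by simp
qed

lemma sign_mult: "x \<in> {-1, 1::real} \<Longrightarrow> y \<in> {-1, 1} \<Longrightarrow> x * y \<in> {-1, 1}"
  by auto

text \<open>Triangles and the first star fix the signs; the remaining two stars are then
  automatically consistent.\<close>

lemma obtain_signs:
  fixes a :: "nat \<Rightarrow> nat \<Rightarrow> real" and b :: "nat \<Rightarrow> 'v::real_vector"
  assumes b: "cut_dependencies k b"
    and ind: "\<And>S. S \<subseteq> {..<18 + k} \<Longrightarrow> fam_indep a S \<longleftrightarrow> fam_indep b S"
    and int: "integral_coefficients (18 + k) a"
    and aint: "\<And>e i. e < 18 + k \<Longrightarrow> a e i \<in> \<int>"
  obtains \<sigma> where "\<And>e. \<sigma> e \<in> {-1, 1::real}" "cut_dependencies k (\<lambda>e. \<sigma> e *\<^sub>R a e)"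
proof -
  have "\<exists>\<epsilon>. (\<forall>e. \<epsilon> e \<in> {-1, 1::real}) \<and> (\<Sum>e\<in>triangle j. \<epsilon> e *\<^sub>R a e) = 0" if "j < 6" for j
  proof (rule unit_circuit[OF int aint, of "triangle j"])
    show sub: "triangle j \<subseteq> {..<18 + k}" using that by (auto simp: triangle_def)
    show "\<not> fam_indep a (triangle j)" using triangle_circuit(1)[OF b that] ind[OF sub] by simp
    show "fam_indep a (triangle j - {e})" if "e \<in> triangle j" for e
      using triangle_circuit(2)[OF b \<open>j < 6\<close> that] ind[of "triangle j - {e}"] sub by auto
  qed blast+
  then obtain \<tau> where \<tau>: "\<And>j e. j < 6 \<Longrightarrow> \<tau> j e \<in> {-1, 1::real}"
    "\<And>j. j < 6 \<Longrightarrow> (\<Sum>e\<in>triangle j. \<tau> j e *\<^sub>R a e) = 0" by metis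
  have "\<exists>\<epsilon>. (\<forall>e. \<epsilon> e \<in> {-1, 1::real}) \<and> (\<Sum>e\<in>star s. \<epsilon> e *\<^sub>R a e) = 0" if "s < 3" for s
  proof (rule unit_circuit[OF int aint, of "star s"])
    show sub: "star s \<subseteq> {..<18 + k}" using that by (auto simp: star_def)
    show "\<not> fam_indep a (star s)" using star_circuit(1)[OF b that] ind[OF sub] by simp
    show "fam_indep a (star s - {e})" if "e \<in> star s" for e
      using star_circuit(2)[OF b \<open>s < 3\<close> that] ind[of "star s - {e}"] sub by auto
  qed blast+
  then obtain \<rho> where \<rho>: "\<And>s e. s < 3 \<Longrightarrow> \<rho> s e \<in> {-1, 1::real}"
    "\<And>s. s < 3 \<Longrightarrow> (\<Sum>e\<in>star s. \<rho> s e *\<^sub>R a e) = 0" by metis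
  \<comment> \<open>Each triangle relation is rescaled so that its sign at the edge
    \<open>3 * j\<close>, the one shared with the first star, becomes the sign of the star
    relation.\<close>
  define \<sigma> where "\<sigma> = (\<lambda>e. if e < 18 then \<rho> 0 (3 * (e div 3)) * \<tau> (e div 3) (3 * (e div 3)) * \<tau> (e div 3) e else 1)"
  have \<sigma>: "\<sigma> e \<in> {-1, 1}" for e
  proof (cases "e < 18")
    case True
    then have "e div 3 < 6" by auto
    then show ?thesis using \<tau>(1) \<rho>(1)[of 0] True unfolding \<sigma>_def
      by (simp del: insert_iff add: sign_mult)
  qed (simp add: \<sigma>_def)
  define a1 where "a1 = (\<lambda>e. \<sigma> e *\<^sub>R a e)"
  have ind1: "fam_indep a1 S \<longleftrightarrow> fam_indep a S" for S
  proof -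
    have "\<sigma> e \<noteq> 0" for e using \<sigma>[of e] by auto
    then show ?thesis unfolding a1_def by (intro fam_indep_scale)
  qed
  have tri: "a1 (3 * j) + a1 (3 * j + 1) + a1 (3 * j + 2) = 0" if "j < 6" for j
  proof -
    have "a1 (3 * j + s) = (\<rho> 0 (3 * j) * \<tau> j (3 * j)) *\<^sub>R \<tau> j (3 * j + s) *\<^sub>R a (3 * j + s)" if "s < 3" for s
      using that \<open>j < 6\<close> by (simp add: a1_def \<sigma>_def)
    from this[of 0] this[of 1] this[of 2]
    have "a1 (3 * j) + a1 (3 * j + 1) + a1 (3 * j + 2) =
        (\<rho> 0 (3 * j) * \<tau> j (3 * j)) *\<^sub>R (\<Sum>e\<in>triangle j. \<tau> j e *\<^sub>R a e)"
      by (simp add: triangle_def scaleR_add_right add.assoc)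
    then show ?thesis using \<tau>(2)[OF that] by simp
  qed
  have star_sum: "(\<rho> s s * \<sigma> s) *\<^sub>R a1 s + (\<rho> s (3 + s) * \<sigma> (3 + s)) *\<^sub>R a1 (3 + s) + (\<rho> s (6 + s) * \<sigma> (6 + s)) *\<^sub>R a1 (6 + s)
      + (\<rho> s (9 + s) * \<sigma> (9 + s)) *\<^sub>R a1 (9 + s) + (\<rho> s (12 + s) * \<sigma> (12 + s)) *\<^sub>R a1 (12 + s)
      + (\<rho> s (15 + s) * \<sigma> (15 + s)) *\<^sub>R a1 (15 + s) = 0" if "s < 3" for s
  proof -
    have "(\<rho> s e * \<sigma> e) *\<^sub>R a1 e = \<rho> s e *\<^sub>R a e" for e
      using \<sigma>[of e] by (auto simp: a1_def)
    then show ?thesis using \<rho>(2)[OF that] by (simp add: star_def add.assoc)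
  qed
  have r0: "\<rho> 0 e * \<sigma> e = 1" if "e \<in> star 0" for e
  proof -
    have e: "e < 18" "3 * (e div 3) = e" "e div 3 < 6" using that by (auto simp: star_def)
    show ?thesis using \<rho>(1)[of 0 e] \<tau>(1)[OF e(3), of e] e by (auto simp: \<sigma>_def)
  qed
  have st0: "a1 0 + a1 3 + a1 6 + a1 9 + a1 12 + a1 15 = 0"
    using star_sum[of 0] r0[of 0] r0[of 3] r0[of 6] r0[of 9] r0[of 12] r0[of 15] by (simp add: star_def)
  define \<delta> where "\<delta> = (\<lambda>e. \<rho> 1 e * \<sigma> e)"
  define \<eta> where "\<eta> = (\<lambda>e. \<rho> 2 e * \<sigma> e)"
  have \<delta>: "\<delta> e \<in> {-1, 1}" and \<eta>: "\<eta> e \<in> {-1, 1}" for e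
    unfolding \<delta>_def \<eta>_def using \<rho>(1)[of 1 e] \<rho>(1)[of 2 e] \<sigma>[of e] by (intro sign_mult; simp)+
  have \<delta>sum: "\<delta> 1 *\<^sub>R a1 1 + \<delta> 4 *\<^sub>R a1 4 + \<delta> 7 *\<^sub>R a1 7 + \<delta> 10 *\<^sub>R a1 10 + \<delta> 13 *\<^sub>R a1 13 + \<delta> 16 *\<^sub>R a1 16 = 0"
    using star_sum[of 1] by (simp add: \<delta>_def)
  have \<eta>sum: "\<eta> 2 *\<^sub>R a1 2 + \<eta> 5 *\<^sub>R a1 5 + \<eta> 8 *\<^sub>R a1 8 + \<eta> 11 *\<^sub>R a1 11 + \<eta> 14 *\<^sub>R a1 14 + \<eta> 17 *\<^sub>R a1 17 = 0"
    using star_sum[of 2] by (simp add: \<eta>_def)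
  have subk: "base k \<subseteq> {..<18 + k}" by (auto simp: base_def)
  have basek: "fam_indep a1 (base k)" unfolding ind1 ind[OF subk] by (rule fam_indep_base[OF b])
  have "base 0 \<subseteq> base k" "finite (base k)" by (auto simp: base_def)
  from fam_indep_mono[OF basek this] have base0: "fam_indep a1 (base 0)" .
  note st1 = third_star[OF base0 tri st0 \<delta>sum \<eta>sum \<delta> \<eta>]
  from cut_dependenciesI[OF basek tri st0 st1] show ?thesis using that[of \<sigma>] \<sigma> by (simp add: a1_def)
qed

section \<open>The hexagonal norm\<close>

text \<open>The range of \<open>a\<close>, \<open>b\<close>, \<open>0\<close>, which is the minimum
  over t of \<open>|a - t| + |b - t| + |t|\<close>: the cost of a point in terms of three columns
  with sum zero. The unit ball is the hexagon with vertices \<open>hexdir i\<close>. Real arguments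
  are needed because points of the polytope have real coefficients.\<close>

definition hexr :: "real \<Rightarrow> real \<Rightarrow> real" where
  "hexr a b = max (max a b) 0 - min (min a b) 0"

definition hex :: "int \<times> int \<Rightarrow> nat" where
  "hex x = nat (max (max (fst x) (snd x)) 0 - min (min (fst x) (snd x)) 0)"

definition hexdir :: "nat \<Rightarrow> int \<times> int" where
  "hexdir i = [(1, 0), (1, 1), (0, 1), (-1, 0), (-1, -1), (0, -1)] ! i"

text \<open>The change of the distance to \<open>x\<close> as the reference point moves from the
  origin to \<open>hexdir i\<close>; the distance is linear along this step, so this is a
  directional derivative.\<close>

definition slope :: "nat \<Rightarrow> int \<times> int \<Rightarrow> int" where
  "slope i x = int (hex (fst x - fst (hexdir i), snd x - snd (hexdir i))) - int (hex x)"

text \<open>Directions are numbered cyclically, and \<open>hexdir i\<close> and \<open>hexdir (succ6 i)\<close> span a unimodular cone.\<close>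

definition succ6 :: "nat \<Rightarrow> nat" where
  "succ6 i = (if i = 5 then 0 else Suc i)"

lemma hexdir_simps [simp]:
  "hexdir 0 = (1, 0)" "hexdir (Suc 0) = (1, 1)" "hexdir 2 = (0, 1)"
  "hexdir 3 = (-1, 0)" "hexdir 4 = (-1, -1)" "hexdir 5 = (0, -1)"
  by (simp_all add: hexdir_def)

lemma succ6_simps [simp]:
  "succ6 0 = Suc 0" "succ6 (Suc 0) = 2" "succ6 2 = 3" "succ6 3 = 4" "succ6 4 = 5" "succ6 5 = 0"
  by (simp_all add: succ6_def)

lemma less_6_E:
  assumes "i < (6::nat)"
  obtains "i = 0" | "i = Suc 0" | "i = 2" | "i = 3" | "i = 4" | "i = 5"
  using assms by fastforce

lemma all_less_6: "(\<forall>i<6. P i) \<longleftrightarrow> P 0 \<and> P (Suc 0) \<and> P 2 \<and> P 3 \<and> P 4 \<and> P (5::nat)"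
  by (auto elim!: less_6_E)

lemma sum_less_6: "(\<Sum>i<6. f i) = f 0 + f (Suc 0) + f 2 + f 3 + f 4 + f (5::nat)"
  for f :: "nat \<Rightarrow> 'a::comm_monoid_add"
  by (simp add: eval_nat_numeral)

lemma hexr_of_int: "hexr (of_int (fst x)) (of_int (snd x)) = real (hex x)"
proof -
  have "hexr (of_int (fst x)) (of_int (snd x)) = of_int (max (max (fst x) (snd x)) 0 - min (min (fst x) (snd x)) 0)"
    by (simp add: hexr_def of_int_max of_int_min)
  also have "\<dots> = real (hex x)" by (simp add: hex_def)
  finally show ?thesis .
qed

lemma hexr_ge:
  assumes "(u, v) \<in> {(1, 0), (0, 1), (-1, 0), (0, -1), (1, -1), (-1, 1 :: int)}"
  shows "hexr a b \<ge> of_int u * a + of_int v * b"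
  using assms by (auto simp: hexr_def max_def min_def)

lemma int_hex: "int (hex x) = max (max (fst x) (snd x)) 0 - min (min (fst x) (snd x)) 0"
  by (simp add: hex_def max_def min_def)

lemma int_hex_cases:
  "a \<ge> b \<Longrightarrow> b \<ge> 0 \<Longrightarrow> int (hex (a, b)) = a" "b \<ge> a \<Longrightarrow> a \<ge> 0 \<Longrightarrow> int (hex (a, b)) = b"
  "a \<ge> 0 \<Longrightarrow> b \<le> 0 \<Longrightarrow> int (hex (a, b)) = a - b" "b \<ge> 0 \<Longrightarrow> a \<le> 0 \<Longrightarrow> int (hex (a, b)) = b - a"
  "a \<ge> b \<Longrightarrow> a \<le> 0 \<Longrightarrow> int (hex (a, b)) = - b" "b \<ge> a \<Longrightarrow> b \<le> 0 \<Longrightarrow> int (hex (a, b)) = - a"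
  by (auto simp: int_hex max_def min_def)

text \<open>The lines along which the norm changes its linear formula are lattice lines and do not
  cut the triangle with vertices \<open>x\<close>, \<open>x - hexdir i\<close> and
  \<open>x - hexdir (succ6 i)\<close>. The cases are the sectors that contain it.\<close>

lemma hex_linear_on_triangle:
  assumes "i < 6"
  obtains u v where "(u, v) \<in> {(1, 0), (0, 1), (-1, 0), (0, -1), (1, -1), (-1, 1 :: int)}"
    "int (hex x) = u * fst x + v * snd x"
    "slope i x = - u * fst (hexdir i) - v * snd (hexdir i)"
    "slope (succ6 i) x = - u * fst (hexdir (succ6 i)) - v * snd (hexdir (succ6 i))"
proof -
  obtain p q where x: "x = (p, q)" by (cases x)
  have "\<exists>(u, v) \<in> {(1, 0), (0, 1), (-1, 0), (0, -1), (1, -1), (-1, 1 :: int)}.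
    int (hex x) = u * fst x + v * snd x \<and>
    slope i x = - u * fst (hexdir i) - v * snd (hexdir i) \<and>
    slope (succ6 i) x = - u * fst (hexdir (succ6 i)) - v * snd (hexdir (succ6 i))"
    using assms
  proof (cases rule: less_6_E)
    case 1
    consider "p \<ge> q + 1" "q \<ge> 1" | "p \<ge> 1" "q \<le> 0" | "p \<le> 0" "p \<ge> q + 1" | "q \<ge> p" "p \<ge> 1" | "q \<ge> 1" "p \<le> 0" | "q \<le> 0" "p \<le> q"
      by linarith
    then show ?thesis by cases (simp_all add: 1 x slope_def int_hex_cases)
  next
    case 2
    consider "p \<ge> q" "q \<ge> 1" | "p \<ge> 1" "q \<le> 0" | "p \<le> 0" "p \<ge> q" | "q \<ge> p + 1" "p \<ge> 1" | "q \<ge> 1" "p \<le> 0" | "q \<le> 0" "p + 1 \<le> q"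
      by linarith
    then show ?thesis by cases (simp_all add: 2 x slope_def int_hex_cases)
  next
    case 3
    consider "p \<ge> q" "q \<ge> 1" | "p \<ge> 0" "q \<le> 0" | "p + 1 \<le> 0" "p \<ge> q" | "q \<ge> p + 1" "p \<ge> 0" | "q \<ge> 1" "p + 1 \<le> 0" | "q \<le> 0" "p + 1 \<le> q"
      by linarith
    then show ?thesis by cases (simp_all add: 3 x slope_def int_hex_cases)
  next
    case 4
    consider "p \<ge> q" "q \<ge> 0" | "p \<ge> 0" "q + 1 \<le> 0" | "p + 1 \<le> 0" "p \<ge> q" | "q \<ge> p + 1" "p \<ge> 0" | "q \<ge> 0" "p + 1 \<le> 0" | "q + 1 \<le> 0" "p + 1 \<le> q"
      by linarith
    then show ?thesis by cases (simp_all add: 4 x slope_def int_hex_cases)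
  next
    case 5
    consider "p \<ge> q + 1" "q \<ge> 0" | "p \<ge> 0" "q + 1 \<le> 0" | "p + 1 \<le> 0" "p \<ge> q + 1" | "q \<ge> p" "p \<ge> 0" | "q \<ge> 0" "p + 1 \<le> 0" | "q + 1 \<le> 0" "p \<le> q"
      by linarith
    then show ?thesis by cases (simp_all add: 5 x slope_def int_hex_cases)
  next
    case 6
    consider "p \<ge> q + 1" "q \<ge> 0" | "p \<ge> 1" "q + 1 \<le> 0" | "p \<le> 0" "p \<ge> q + 1" | "q \<ge> p" "p \<ge> 1" | "q \<ge> 0" "p \<le> 0" | "q + 1 \<le> 0" "p \<le> q"
      by linarith
    then show ?thesis by cases (simp_all add: 6 x slope_def int_hex_cases)
  qed
  then obtain w where w: "w \<in> {(1, 0), (0, 1), (-1, 0), (0, -1), (1, -1), (-1, 1 :: int)}"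
    "case w of (u, v) \<Rightarrow> int (hex x) = u * fst x + v * snd x \<and>
      slope i x = - u * fst (hexdir i) - v * snd (hexdir i) \<and>
      slope (succ6 i) x = - u * fst (hexdir (succ6 i)) - v * snd (hexdir (succ6 i))"
    by (rule bexE)
  obtain u v where uv: "w = (u, v)" by (cases w)
  show ?thesis
    by (rule that[OF w(1)[unfolded uv]]) (use w(2)[unfolded uv prod.case] in blast)+
qed

text \<open>The functional that is exact on the triangle is a lower bound for the norm everywhere,
  so two integral slopes control all real displacements.\<close>

lemma hexr_slope:
  assumes "i < 6"
  shows "hexr (of_int (fst x) - (\<alpha> * of_int (fst (hexdir i)) + \<beta> * of_int (fst (hexdir (succ6 i)))))
      (of_int (snd x) - (\<alpha> * of_int (snd (hexdir i)) + \<beta> * of_int (snd (hexdir (succ6 i)))))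
    \<ge> real (hex x) + \<alpha> * of_int (slope i x) + \<beta> * of_int (slope (succ6 i) x)"
proof -
  obtain u v where uv: "(u, v) \<in> {(1, 0), (0, 1), (-1, 0), (0, -1), (1, -1), (-1, 1 :: int)}"
    "int (hex x) = u * fst x + v * snd x"
    "slope i x = - u * fst (hexdir i) - v * snd (hexdir i)"
    "slope (succ6 i) x = - u * fst (hexdir (succ6 i)) - v * snd (hexdir (succ6 i))"
    using hex_linear_on_triangle[OF assms] by metis
  have "real (hex x) = of_int u * of_int (fst x) + of_int v * of_int (snd x)"
    using arg_cong[OF uv(2), of "of_int :: int \<Rightarrow> real"] by simp
  then show ?thesis
    using hexr_ge[OF uv(1), of "of_int (fst x) - (\<alpha> * of_int (fst (hexdir i)) + \<beta> * of_int (fst (hexdir (succ6 i))))"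
      "of_int (snd x) - (\<alpha> * of_int (snd (hexdir i)) + \<beta> * of_int (snd (hexdir (succ6 i))))"]
    unfolding uv(3,4) by (simp add: algebra_simps)
qed

text \<open>\<open>hexdir (succ6 i)\<close> is the sum of its two neighbours, and directional
  derivatives of a convex function are subadditive; for opposite directions the same fact gives
  \<open>slope_opposite\<close>.\<close>

lemma slope_subadditive:
  assumes "i < 6"
  shows "slope (succ6 i) x \<le> slope i x + slope (succ6 (succ6 i)) x"
  using assms by (cases rule: less_6_E; cases x; simp add: slope_def int_hex; simp add: max_def min_def)

lemma slope_opposite:
  assumes "i < 3"
  shows "0 \<le> slope i x + slope (i + 3) x"
proof -
  have "i = 0 \<or> i = Suc 0 \<or> i = 2" using assms by auto
  then show ?thesis by (elim disjE; cases x; simp add: slope_def int_hex; simp add: max_def min_def)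
qed

lemma hexagonal_cone:
  obtains i and \<alpha> \<beta> :: real where "i < 6" "\<alpha> \<ge> 0" "\<beta> \<ge> 0"
    "a = \<alpha> * of_int (fst (hexdir i)) + \<beta> * of_int (fst (hexdir (succ6 i)))"
    "b = \<alpha> * of_int (snd (hexdir i)) + \<beta> * of_int (snd (hexdir (succ6 i)))"
proof -
  consider "a \<ge> b" "b \<ge> 0" | "b \<ge> a" "a \<ge> 0" | "a \<le> 0" "b \<ge> 0" | "a \<le> b" "b \<le> 0" | "b \<le> a" "a \<le> 0" | "a \<ge> 0" "b \<le> 0"
    by linarith
  then show ?thesis
  proof cases
    case 1 then show ?thesis using that[of 0 "a - b" b] by simp
  next
    case 2 then show ?thesis using that[of "Suc 0" a "b - a"] by simp
  next
    case 3 then show ?thesis using that[of 2 b "- a"] by simp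
  next
    case 4 then show ?thesis using that[of 3 "b - a" "- b"] by simp
  next
    case 5 then show ?thesis using that[of 4 "- a" "a - b"] by simp
  next
    case 6 then show ?thesis using that[of 5 "- b" a] by simp
  qed
qed

section \<open>Canonical representatives modulo translations\<close>

text \<open>The list is canonical if the origin minimises \<open>v \<mapsto> 3 * (\<Sum>x\<leftarrow>xs. hex (x - v)) + fst v + snd v\<close>;
  the linear term selects a unique minimiser of the sum of the distances.\<close>

definition tilt :: "nat \<Rightarrow> int" where
  "tilt i = fst (hexdir i) + snd (hexdir i)"

definition total_slope :: "nat \<Rightarrow> (int \<times> int) list \<Rightarrow> int" where
  "total_slope i xs = sum_list (map (slope i) xs)"

definition canonical :: "(int \<times> int) list \<Rightarrow> bool" where
  "canonical xs \<longleftrightarrow> (\<forall>i<6. 3 * total_slope i xs + tilt i \<ge> 0)"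

definition distance_sum :: "(int \<times> int) list \<Rightarrow> real \<Rightarrow> real \<Rightarrow> real" where
  "distance_sum xs a b = (\<Sum>x\<leftarrow>xs. hexr (of_int (fst x) - a) (of_int (snd x) - b))"

definition total_hex :: "(int \<times> int) list \<Rightarrow> nat" where
  "total_hex xs = sum_list (map hex xs)"

definition translate :: "int \<Rightarrow> int \<Rightarrow> (int \<times> int) list \<Rightarrow> (int \<times> int) list" where
  "translate a b xs = map (\<lambda>x. (fst x - a, snd x - b)) xs"

lemma length_translate [simp]: "length (translate a b xs) = length xs"
  by (simp add: translate_def)

lemma translate_nth: "j < length xs \<Longrightarrow> translate a b xs ! j = (fst (xs ! j) - a, snd (xs ! j) - b)"
  by (simp add: translate_def)

lemma distance_sum_0: "distance_sum xs 0 0 = real (total_hex xs)"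
  by (induction xs) (simp_all add: distance_sum_def total_hex_def hexr_of_int)

lemma distance_sum_translate: "distance_sum (translate a b xs) c d = distance_sum xs (of_int a + c) (of_int b + d)"
  by (simp add: distance_sum_def translate_def o_def algebra_simps)

lemma distance_sum_hexdir:
  "distance_sum xs (of_int (fst (hexdir i))) (of_int (snd (hexdir i))) = real (total_hex xs) + of_int (total_slope i xs)"
proof (induction xs)
  case (Cons x xs)
  have "hexr (of_int (fst x) - of_int (fst (hexdir i))) (of_int (snd x) - of_int (snd (hexdir i))) =
      real (hex x) + of_int (slope i x)"
    using hexr_of_int[of "(fst x - fst (hexdir i), snd x - snd (hexdir i))"] by (simp add: slope_def)
  with Cons show ?case by (simp add: distance_sum_def total_hex_def total_slope_def)
qed (simp add: distance_sum_def total_hex_def total_slope_def)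

lemma distance_sum_cone:
  assumes "i < 6"
  shows "distance_sum xs (\<alpha> * of_int (fst (hexdir i)) + \<beta> * of_int (fst (hexdir (succ6 i))))
      (\<alpha> * of_int (snd (hexdir i)) + \<beta> * of_int (snd (hexdir (succ6 i))))
    \<ge> real (total_hex xs) + \<alpha> * of_int (total_slope i xs) + \<beta> * of_int (total_slope (succ6 i) xs)"
proof (induction xs)
  case (Cons x xs)
  with hexr_slope[OF assms, of x \<alpha> \<beta>] show ?case
    by (simp add: distance_sum_def total_hex_def total_slope_def algebra_simps)
qed (simp add: distance_sum_def total_hex_def total_slope_def)

lemma tilt_bounds:
  assumes "i < 6"
  shows "\<bar>tilt i\<bar> \<le> 2" "\<not> 3 dvd tilt i"
  using assms by (cases rule: less_6_E; simp add: tilt_def)+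

lemma succ6_less: "i < 6 \<Longrightarrow> succ6 i < 6"
  by (auto simp: succ6_def)

text \<open>This is why the slopes are tripled: the tilt is at most 2 in absolute value and never
  divisible by 3, so the tilted inequality is strict and still forces the slope itself to be
  nonnegative.\<close>

lemma canonical_slope_pos:
  assumes "canonical xs" "i < 6"
  shows "3 * total_slope i xs + tilt i \<ge> 1" "total_slope i xs \<ge> 0"
proof -
  have ge: "3 * total_slope i xs + tilt i \<ge> 0" using assms by (simp add: canonical_def)
  have "3 * total_slope i xs + tilt i \<noteq> 0"
  proof
    assume "3 * total_slope i xs + tilt i = 0"
    then have "tilt i = 3 * (- total_slope i xs)" by simp
    then show False using tilt_bounds(2)[OF assms(2)] by (metis dvd_triv_left)
  qed
  with ge show "3 * total_slope i xs + tilt i \<ge> 1" by simp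
  show "total_slope i xs \<ge> 0" using ge tilt_bounds(1)[OF assms(2)] by linarith
qed

text \<open>Every displacement lies in one of the six cones spanned by adjacent directions, where
  the two slopes bound the sum from below. The untilted inequality serves to bound the weights of
  real coefficients, the tilted ones give uniqueness.\<close>

lemma canonical_distance_sum:
  assumes "canonical xs"
  shows "distance_sum xs a b \<ge> real (total_hex xs)"
    "3 * distance_sum xs a b + a + b \<ge> 3 * real (total_hex xs)"
    "3 * distance_sum xs a b + a + b = 3 * real (total_hex xs) \<Longrightarrow> a = 0 \<and> b = 0"
proof -
  obtain i \<alpha> \<beta> where i: "i < 6" "\<alpha> \<ge> 0" "\<beta> \<ge> 0" and
    a: "a = \<alpha> * of_int (fst (hexdir i)) + \<beta> * of_int (fst (hexdir (succ6 i)))" and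
    b: "b = \<alpha> * of_int (snd (hexdir i)) + \<beta> * of_int (snd (hexdir (succ6 i)))"
    using hexagonal_cone[of a b] by metis
  let ?s = "of_int (total_slope i xs) :: real" and ?s' = "of_int (total_slope (succ6 i) xs) :: real"
  have ge: "distance_sum xs a b \<ge> real (total_hex xs) + \<alpha> * ?s + \<beta> * ?s'"
    unfolding a b by (rule distance_sum_cone[OF i(1)])
  have pos: "?s \<ge> 0" "?s' \<ge> 0"
    using canonical_slope_pos(2)[OF assms] i(1) succ6_less by auto
  then show "distance_sum xs a b \<ge> real (total_hex xs)" using ge i by (smt (verit) mult_nonneg_nonneg)
  have ab: "a + b = \<alpha> * of_int (tilt i) + \<beta> * of_int (tilt (succ6 i))"
    unfolding a b tilt_def by (simp add: algebra_simps)
  have "real_of_int (3 * total_slope i xs + tilt i) \<ge> 1" "real_of_int (3 * total_slope (succ6 i) xs + tilt (succ6 i)) \<ge> 1"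
    using canonical_slope_pos(1)[OF assms] i(1) succ6_less by (metis of_int_1_le_iff)+
  then have "\<alpha> * (3 * ?s + of_int (tilt i)) \<ge> \<alpha> * 1" "\<beta> * (3 * ?s' + of_int (tilt (succ6 i))) \<ge> \<beta> * 1"
    using i by (intro mult_left_mono; simp)+
  then have strong: "3 * distance_sum xs a b + a + b \<ge> 3 * real (total_hex xs) + \<alpha> + \<beta>"
    using ge ab by (simp add: algebra_simps)
  then show "3 * distance_sum xs a b + a + b \<ge> 3 * real (total_hex xs)" using i by simp
  assume "3 * distance_sum xs a b + a + b = 3 * real (total_hex xs)"
  then have "\<alpha> = 0" "\<beta> = 0" using strong i by linarith+
  then show "a = 0 \<and> b = 0" by (simp add: a b)
qed

text \<open>Up to translation the two lists minimise the same tilted sum, whose minimiser is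
  unique.\<close>

lemma canonical_unique:
  assumes "canonical xs" "canonical (translate a b xs)"
  shows "a = 0 \<and> b = 0"
proof -
  have "3 * distance_sum (translate a b xs) (of_int (- a)) (of_int (- b)) + of_int (- a) + of_int (- b) \<ge>
      3 * real (total_hex (translate a b xs))"
    by (rule canonical_distance_sum(2)[OF assms(2)])
  then have "3 * real (total_hex xs) \<ge> 3 * distance_sum xs (of_int a) (of_int b) + of_int a + of_int b"
    unfolding distance_sum_translate distance_sum_0[symmetric, of "translate a b xs"] by (simp add: distance_sum_0)
  with canonical_distance_sum(2,3)[OF assms(1), of "of_int a" "of_int b"] show ?thesis by simp
qed

lemma distance_sum_of_int: "distance_sum xs (of_int a) (of_int b) = real (total_hex (translate a b xs))"
  unfolding distance_sum_0[symmetric] distance_sum_translate by simp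

lemma canonical_exists:
  assumes "xs \<noteq> []"
  obtains a b where "canonical (translate a b xs)"
proof -
  define G where "G = (\<lambda>(a, b). 3 * int (total_hex (translate a b xs)) + a + b)"
  obtain x ys where xs: "xs = x # ys" using assms by (cases xs) auto
  \<comment> \<open>The tripled distance from a single point outweighs the linear term, so an
    integral minimum exists.\<close>
  have lb: "G (a, b) \<ge> fst x + snd x" for a b
    unfolding G_def xs by (simp add: total_hex_def translate_def int_hex)
      (simp add: max_def min_def; linarith)
  then obtain v where v: "\<And>u. nat (G v - (fst x + snd x)) \<le> nat (G u - (fst x + snd x))"
    using ex_has_least_nat[of "\<lambda>_. True" _ "\<lambda>u. nat (G u - (fst x + snd x))"] by auto
  then have min: "G v \<le> G u" for u
  proof -
    have "int (nat (G v - (fst x + snd x))) \<le> int (nat (G u - (fst x + snd x)))"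
      unfolding of_nat_le_iff by (rule v)
    then show ?thesis using lb[of "fst u" "snd u"] lb[of "fst v" "snd v"] by simp
  qed
  obtain a b where ab: "v = (a, b)" by (cases v)
  have "3 * total_slope i (translate a b xs) + tilt i \<ge> 0" for i
  proof -
    let ?c = "fst (hexdir i)" and ?d = "snd (hexdir i)"
    have "real (total_hex (translate a b xs)) + of_int (total_slope i (translate a b xs)) =
        distance_sum (translate a b xs) (of_int ?c) (of_int ?d)"
      by (rule distance_sum_hexdir[symmetric])
    also have "\<dots> = real (total_hex (translate (a + ?c) (b + ?d) xs))"
      using distance_sum_of_int[of xs "a + ?c" "b + ?d"] by (simp add: distance_sum_translate)
    finally have "int (total_hex (translate a b xs)) + total_slope i (translate a b xs) =
        int (total_hex (translate (a + ?c) (b + ?d) xs))" by linarith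
    then show ?thesis using min[of "(a + ?c, b + ?d)"] by (simp add: ab G_def tilt_def)
  qed
  then show ?thesis using that by (auto simp: canonical_def)
qed

text \<open>Two opposite entries are never both negative, and an entry between two negative ones is
  negative. So the negative entries form an arc of the hexagon, empty or with at most three
  vertices, and a nonempty arc has one vertex more than edges.\<close>

lemma all_nonneg_indicator:
  fixes S :: "nat \<Rightarrow> int"
  assumes sub: "\<And>i. i < 6 \<Longrightarrow> S (succ6 i) \<le> S i + S (succ6 (succ6 i))"
    and opp: "\<And>i. i < 3 \<Longrightarrow> 0 \<le> S i + S (i + 3)"
  shows "of_bool (\<forall>i<6. S i \<ge> 0) = (1 - (\<Sum>i<6. of_bool (S i < 0)) + (\<Sum>i<6. of_bool (S i < 0 \<and> S (succ6 i) < 0)) :: 'a::comm_ring_1)"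
proof -
  have s: "S (Suc 0) \<le> S 0 + S 2" "S 2 \<le> S (Suc 0) + S 3" "S 3 \<le> S 2 + S 4" "S 4 \<le> S 3 + S 5"
    "S 5 \<le> S 4 + S 0" "S 0 \<le> S 5 + S (Suc 0)"
    using sub[of 0] sub[of "Suc 0"] sub[of 2] sub[of 3] sub[of 4] sub[of 5] by simp_all
  have t: "0 \<le> S 0 + S 3" "0 \<le> S (Suc 0) + S 4" "0 \<le> S 2 + S 5"
    using opp[of 0] opp[of "Suc 0"] opp[of 2] by (simp_all add: numeral_eq_Suc)
  show ?thesis unfolding all_less_6 sum_less_6 succ6_simps
    using s t by (cases "S 0 < 0"; cases "S (Suc 0) < 0"; cases "S 2 < 0"; cases "S 3 < 0"; cases "S 4 < 0"; cases "S 5 < 0";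
      simp)
qed

section \<open>Generating functions of weighted sets\<close>

text \<open>An infinite set has \<open>card\<close> 0, so a coefficient of \<open>gf\<close> is
  meaningful only for a finite fibre; finiteness is therefore proved along with each generating
  function.\<close>

definition finite_fibres :: "'a set \<Rightarrow> ('a \<Rightarrow> nat) \<Rightarrow> bool" where
  "finite_fibres A w \<longleftrightarrow> (\<forall>m. finite {x\<in>A. w x = m})"

definition gf :: "'a set \<Rightarrow> ('a \<Rightarrow> nat) \<Rightarrow> real fps" where
  "gf A w = Abs_fps (\<lambda>m. real (card {x\<in>A. w x = m}))"

lemma gf_nth: "fps_nth (gf A w) m = real (card {x\<in>A. w x = m})"
  by (simp add: gf_def)

lemma
  assumes bij: "bij_betw f A B" and w: "\<And>x. x \<in> A \<Longrightarrow> w' (f x) = w x"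
  shows gf_bij: "gf B w' = gf A w" and finite_fibres_bij: "finite_fibres B w' \<longleftrightarrow> finite_fibres A w"
proof -
  have eq: "bij_betw f {x\<in>A. w x = m} {y\<in>B. w' y = m}" for m
    by (rule bij_betw_subset[OF bij]) (use bij w in \<open>auto simp: bij_betw_def\<close>)
  show "gf B w' = gf A w"
    using bij_betw_same_card[OF eq] by (simp add: fps_eq_iff gf_nth)
  show "finite_fibres B w' \<longleftrightarrow> finite_fibres A w"
    using bij_betw_finite[OF eq] by (simp add: finite_fibres_def)
qed

lemma
  assumes "finite_fibres A w" "finite_fibres B v"
  shows gf_times: "gf (A \<times> B) (\<lambda>(x, y). w x + v y) = gf A w * gf B v"
    and finite_fibres_times: "finite_fibres (A \<times> B) (\<lambda>(x, y). w x + v y)"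
proof -
  have eq: "{p \<in> A \<times> B. (case p of (x, y) \<Rightarrow> w x + v y) = m} =
      (\<Union>i\<in>{0..m}. {x\<in>A. w x = i} \<times> {y\<in>B. v y = m - i})" for m
    by auto
  have fin: "finite ({x\<in>A. w x = i} \<times> {y\<in>B. v y = j})" for i j
    using assms by (simp add: finite_fibres_def)
  show "finite_fibres (A \<times> B) (\<lambda>(x, y). w x + v y)"
    unfolding finite_fibres_def eq using fin by blast
  have "card {p \<in> A \<times> B. (case p of (x, y) \<Rightarrow> w x + v y) = m} =
      (\<Sum>i=0..m. card ({x\<in>A. w x = i} \<times> {y\<in>B. v y = m - i}))" for m
    unfolding eq using fin by (intro card_UN_disjoint) auto
  then show "gf (A \<times> B) (\<lambda>(x, y). w x + v y) = gf A w * gf B v"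
    by (simp add: fps_eq_iff gf_nth fps_mult_nth card_cartesian_product)
qed

lemma
  assumes "finite I" "\<And>i. i \<in> I \<Longrightarrow> finite_fibres (A i) (w i)"
  shows gf_Sigma: "gf (SIGMA i:I. A i) (\<lambda>(i, x). w i x) = (\<Sum>i\<in>I. gf (A i) (w i))"
    and finite_fibres_Sigma: "finite_fibres (SIGMA i:I. A i) (\<lambda>(i, x). w i x)"
proof -
  have eq: "{p \<in> (SIGMA i:I. A i). (case p of (i, x) \<Rightarrow> w i x) = m} = (SIGMA i:I. {x\<in>A i. w i x = m})" for m
    by auto
  have fin: "finite {x\<in>A i. w i x = m}" if "i \<in> I" for i m
    using assms(2)[OF that] by (simp add: finite_fibres_def)
  show "finite_fibres (SIGMA i:I. A i) (\<lambda>(i, x). w i x)"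
    unfolding finite_fibres_def eq using fin assms(1) by auto
  show "gf (SIGMA i:I. A i) (\<lambda>(i, x). w i x) = (\<Sum>i\<in>I. gf (A i) (w i))"
    unfolding fps_eq_iff fps_sum_nth gf_nth eq using fin assms(1) by (simp add: card_SigmaI)
qed

lemma
  assumes "finite_fibres A w"
  shows gf_shift: "gf A (\<lambda>x. c + w x) = fps_X ^ c * gf A w"
    and finite_fibres_shift: "finite_fibres A (\<lambda>x. c + w x)"
proof -
  have eq: "{x\<in>A. c + w x = m} = (if m < c then {} else {x\<in>A. w x = m - c})" for m by auto
  show "gf A (\<lambda>x. c + w x) = fps_X ^ c * gf A w"
    unfolding fps_eq_iff fps_X_power_mult_nth gf_nth eq by simp
  show "finite_fibres A (\<lambda>x. c + w x)"
    unfolding finite_fibres_def eq using assms by (simp add: finite_fibres_def)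
qed

lemma mult_one_minus_X_nth: "fps_nth (f * (1 - fps_X)) n = (fps_nth f n - (if n = 0 then 0 else fps_nth f (n - 1)) :: real)"
  by (simp add: right_diff_distrib)

lemma gf_nat: "gf UNIV (\<lambda>n::nat. n) * (1 - fps_X) = 1"
  by (simp add: fps_eq_iff mult_one_minus_X_nth gf_nth)

lemma finite_fibres_nat: "finite_fibres UNIV (\<lambda>n::nat. n)"
  by (simp add: finite_fibres_def)

text \<open>Dilation by \<open>m\<close> collects all weights up to \<open>m\<close>; these partial
  sums account for the last factor of the Ehrhart denominator.\<close>

lemma gf_cumulative:
  assumes "finite_fibres A w"
  shows "Abs_fps (\<lambda>m. real (card {x\<in>A. w x \<le> m})) * (1 - fps_X) = gf A w"
proof -
  have fin: "finite {x\<in>A. w x \<le> m}" for m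
  proof -
    have "{x\<in>A. w x \<le> m} = (\<Union>i\<in>{..m}. {x\<in>A. w x = i})" by auto
    then show ?thesis using assms by (simp add: finite_fibres_def)
  qed
  have "card {x\<in>A. w x \<le> Suc m} = card {x\<in>A. w x \<le> m} + card {x\<in>A. w x = Suc m}" for m
  proof -
    have "{x\<in>A. w x \<le> Suc m} = {x\<in>A. w x \<le> m} \<union> {x\<in>A. w x = Suc m}" by auto
    moreover have "finite {x\<in>A. w x = Suc m}" using assms by (simp add: finite_fibres_def)
    ultimately show ?thesis using fin by (simp add: card_Un_disjoint disjoint_iff)
  qed
  then show ?thesis
    unfolding fps_eq_iff mult_one_minus_X_nth gf_nth by (auto simp: gr0_conv_Suc)
qed

section \<open>Counting canonical representatives\<close>

text \<open>The slopes in two adjacent directions are constant on six half-open cones that partition the plane.\<close>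

definition cone_point :: "nat \<Rightarrow> nat \<times> nat \<Rightarrow> int \<times> int" where
  "cone_point r = (\<lambda>(a, b). [(int a + int b + 2, int b + 1), (int a + 1, - int b), (int a + 1, int a + 1 + int b),
     (- int b, int a + 1), (- int b, - int a - 1 - int b), (- int a - int b, - int b)] ! r)"

definition cone_weight :: "nat \<Rightarrow> nat" where
  "cone_weight r = [2, 1, 1, 1, 1, 0] ! r"

definition cone_slope :: "nat \<Rightarrow> int" where
  "cone_slope r = [-1, -1, 0, 1, 0, 1] ! r"

definition cone_slope' :: "nat \<Rightarrow> int" where
  "cone_slope' r = [-1, 0, -1, 0, 1, 1] ! r"

lemmas cone_defs = cone_point_def cone_weight_def cone_slope_def cone_slope'_def

lemma hex_cone_point: "r < 6 \<Longrightarrow> hex (cone_point r (a, b)) = cone_weight r + (a + b)"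
  by (erule less_6_E; simp add: cone_defs hex_def)

lemma slope_cone_point:
  assumes "r < 6"
  shows "slope 0 (cone_point r ab) = cone_slope r" "slope (Suc 0) (cone_point r ab) = cone_slope' r"
  using assms by (cases ab; cases rule: less_6_E; simp add: cone_defs slope_def int_hex)+

lemma cone_point_inject:
  assumes "r < 6" "r' < 6" "cone_point r ab = cone_point r' ab'"
  shows "r = r' \<and> ab = ab'"
  by (insert assms(3); cases ab; cases ab'; rule less_6_E[OF assms(1)]; rule less_6_E[OF assms(2)];
      simp add: cone_point_def)

lemma cone_point_surj:
  obtains r a b where "r < 6" "x = cone_point r (a, b)"
proof -
  obtain p q where x: "x = (p, q)" by (cases x)
  consider "p \<ge> q + 1" "q \<ge> 1" | "p \<ge> 1" "q \<le> 0" | "p \<ge> 1" "q \<ge> p" | "p \<le> 0" "q \<ge> 1" | "p \<le> 0" "q \<le> p - 1" | "p \<le> q" "q \<le> 0"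
    by linarith
  then show ?thesis
  proof cases
    case 1 then show ?thesis using that[of 0 "nat (p - q - 1)" "nat (q - 1)"] by (simp add: x cone_point_def)
  next
    case 2 then show ?thesis using that[of "Suc 0" "nat (p - 1)" "nat (- q)"] by (simp add: x cone_point_def)
  next
    case 3 then show ?thesis using that[of 2 "nat (p - 1)" "nat (q - p)"] by (simp add: x cone_point_def)
  next
    case 4 then show ?thesis using that[of 3 "nat (q - 1)" "nat (- p)"] by (simp add: x cone_point_def)
  next
    case 5 then show ?thesis using that[of 4 "nat (p - q - 1)" "nat (- p)"] by (simp add: x cone_point_def)
  next
    case 6 then show ?thesis using that[of 5 "nat (q - p)" "nat (- q)"] by (simp add: x cone_point_def)
  qed
qed

text \<open>A bound of \<open>int n\<close> admits every list of length \<open>n\<close>, so the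
  same sets express no condition, a condition on one direction, or conditions on two adjacent
  ones.\<close>

definition slope_lists :: "nat \<Rightarrow> nat \<Rightarrow> int \<Rightarrow> int \<Rightarrow> (int \<times> int) list set" where
  "slope_lists i n P Q = {xs. length xs = n \<and> total_slope i xs \<le> P \<and> total_slope (succ6 i) xs \<le> Q}"

text \<open>The numerator of the generating function of \<open>slope_lists 0 n P Q\<close> over
  \<open>(1 - t) ^ (2 * n)\<close>. The six summands belong to the cones of the first point, and the
  power of t is its \<open>cone_weight\<close>.\<close>

fun slope_poly :: "nat \<Rightarrow> int \<Rightarrow> int \<Rightarrow> real poly" where
  "slope_poly 0 P Q = (if P \<ge> 0 \<and> Q \<ge> 0 then 1 else 0)"
| "slope_poly (Suc n) P Q = [:0, 0, 1:] * slope_poly n (P + 1) (Q + 1) +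
     [:0, 1:] * (slope_poly n (P + 1) Q + slope_poly n P (Q + 1) + slope_poly n (P - 1) Q + slope_poly n P (Q - 1)) +
     slope_poly n (P - 1) (Q - 1)"

lemma gf_pairs: "gf UNIV (\<lambda>(a, b). a + b) * (1 - fps_X) ^ 2 = 1"
  and finite_fibres_pairs: "finite_fibres UNIV (\<lambda>(a, b). a + b :: nat)"
proof -
  have "gf UNIV (\<lambda>(a, b). a + b) = gf UNIV (\<lambda>n. n) * gf UNIV (\<lambda>n. n)"
    using gf_times[OF finite_fibres_nat finite_fibres_nat] by simp
  then have "gf UNIV (\<lambda>(a, b). a + b) * (1 - fps_X) ^ 2 =
      (gf UNIV (\<lambda>n. n) * (1 - fps_X)) * (gf UNIV (\<lambda>n. n) * (1 - fps_X))"
    by (simp only: power2_eq_square mult_ac)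
  then show "gf UNIV (\<lambda>(a, b). a + b) * (1 - fps_X) ^ 2 = 1" by (simp only: gf_nat mult_1_left)
  show "finite_fibres UNIV (\<lambda>(a, b). a + b :: nat)"
    using finite_fibres_times[OF finite_fibres_nat finite_fibres_nat] by simp
qed

lemma bij_slope_lists_Suc:
  "bij_betw (\<lambda>(r, ab, ys). cone_point r ab # ys)
    (SIGMA r:{..<6}. UNIV \<times> slope_lists 0 n (P - cone_slope r) (Q - cone_slope' r)) (slope_lists 0 (Suc n) P Q)"
  unfolding bij_betw_def
proof
  show "inj_on (\<lambda>(r, ab, ys). cone_point r ab # ys)
      (SIGMA r:{..<6}. UNIV \<times> slope_lists 0 n (P - cone_slope r) (Q - cone_slope' r))"
  proof (rule inj_onI)
    fix p q
    assume p: "p \<in> (SIGMA r:{..<6}. UNIV \<times> slope_lists 0 n (P - cone_slope r) (Q - cone_slope' r))"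
      and q: "q \<in> (SIGMA r:{..<6}. UNIV \<times> slope_lists 0 n (P - cone_slope r) (Q - cone_slope' r))"
      and eq: "(case p of (r, ab, ys) \<Rightarrow> cone_point r ab # ys) = (case q of (r, ab, ys) \<Rightarrow> cone_point r ab # ys)"
    obtain r ab ys r' ab' ys' where pq: "p = (r, ab, ys)" "q = (r', ab', ys')" by (metis prod_cases3)
    show "p = q" using cone_point_inject[of r r' ab ab'] p q eq by (simp add: pq)
  qed
  show "(\<lambda>(r, ab, ys). cone_point r ab # ys) `
      (SIGMA r:{..<6}. UNIV \<times> slope_lists 0 n (P - cone_slope r) (Q - cone_slope' r)) = slope_lists 0 (Suc n) P Q"
  proof (intro equalityI subsetI)
    fix xs assume "xs \<in> (\<lambda>(r, ab, ys). cone_point r ab # ys) `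
      (SIGMA r:{..<6}. UNIV \<times> slope_lists 0 n (P - cone_slope r) (Q - cone_slope' r))"
    then obtain r ab ys where "r < 6" "ys \<in> slope_lists 0 n (P - cone_slope r) (Q - cone_slope' r)" "xs = cone_point r ab # ys"
      by auto
    then show "xs \<in> slope_lists 0 (Suc n) P Q"
      by (simp add: slope_lists_def total_slope_def slope_cone_point)
  next
    fix xs assume xs: "xs \<in> slope_lists 0 (Suc n) P Q"
    then obtain x ys where x: "xs = x # ys" by (cases xs) (auto simp: slope_lists_def)
    obtain r a b where r: "r < 6" "x = cone_point r (a, b)" using cone_point_surj .
    have "ys \<in> slope_lists 0 n (P - cone_slope r) (Q - cone_slope' r)"
      using xs r by (simp add: x slope_lists_def total_slope_def slope_cone_point)
    then show "xs \<in> (\<lambda>(r, ab, ys). cone_point r ab # ys) `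
      (SIGMA r:{..<6}. UNIV \<times> slope_lists 0 n (P - cone_slope r) (Q - cone_slope' r))"
      using r by (intro image_eqI[of _ _ "(r, (a, b), ys)"]) (simp_all add: x)
  qed
qed

text \<open>The first point is split off: its cone fixes the two slopes and the least weight, and
  its two free coordinates contribute the factor \<open>1 / (1 - t) ^ 2\<close>.\<close>

lemma gf_slope_lists_0:
  "finite_fibres (slope_lists 0 n P Q) total_hex \<and>
   gf (slope_lists 0 n P Q) total_hex * (1 - fps_X) ^ (2 * n) = fps_of_poly (slope_poly n P Q)"
proof (induction n arbitrary: P Q)
  case 0
  have L: "slope_lists 0 0 P Q = (if P \<ge> 0 \<and> Q \<ge> 0 then {[]} else {})"
    by (auto simp: slope_lists_def total_slope_def)
  have "{x\<in>{[]}. total_hex x = m} = (if m = 0 then {[]} else {})" for m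
    by (auto simp: total_hex_def)
  then have "gf {[]} total_hex = 1" "finite_fibres {[]} total_hex"
    by (simp_all add: fps_eq_iff gf_nth finite_fibres_def)
  moreover have "gf {} total_hex = 0" "finite_fibres {} total_hex"
    by (simp_all add: fps_eq_iff gf_nth finite_fibres_def)
  ultimately show ?case unfolding L by simp
next
  case (Suc n)
  define A where "A = (\<lambda>r. slope_lists 0 n (P - cone_slope r) (Q - cone_slope' r))"
  define w where "w = (\<lambda>r::nat. \<lambda>(ab, ys). cone_weight r + ((case ab of (a, b) \<Rightarrow> a + b) + total_hex ys))"
  have finA: "finite_fibres (A r) total_hex" for r using Suc.IH by (simp add: A_def)
  have wr: "w r = (\<lambda>x. cone_weight r + (case x of (ab, ys) \<Rightarrow> (case ab of (a, b) \<Rightarrow> a + b) + total_hex ys))" for r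
    by (simp add: w_def fun_eq_iff)
  note fin = finite_fibres_times[OF finite_fibres_pairs finA]
  have gfr: "gf (UNIV \<times> A r) (w r) * (1 - fps_X) ^ (2 * Suc n) =
      fps_X ^ cone_weight r * fps_of_poly (slope_poly n (P - cone_slope r) (Q - cone_slope' r))" for r
  proof -
    have "gf (UNIV \<times> A r) (w r) * (1 - fps_X) ^ (2 * Suc n) = fps_X ^ cone_weight r *
        (gf UNIV (\<lambda>(a, b). a + b) * (1 - fps_X) ^ 2) * (gf (A r) total_hex * (1 - fps_X) ^ (2 * n))"
      unfolding wr gf_shift[OF fin] gf_times[OF finite_fibres_pairs finA] mult_Suc_right power_add
      by (simp only: mult_ac)
    then show ?thesis using Suc.IH by (simp add: gf_pairs A_def)
  qed
  have weight: "total_hex (case p of (r, ab, ys) \<Rightarrow> cone_point r ab # ys) = (case p of (r, x) \<Rightarrow> w r x)"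
    if "p \<in> (SIGMA r:{..<6}. UNIV \<times> A r)" for p
    using that by (auto simp: w_def total_hex_def hex_cone_point)
  have bij: "bij_betw (\<lambda>(r, ab, ys). cone_point r ab # ys) (SIGMA r:{..<6}. UNIV \<times> A r) (slope_lists 0 (Suc n) P Q)"
    unfolding A_def by (rule bij_slope_lists_Suc)
  have fin_r: "finite_fibres (UNIV \<times> A r) (w r)" for r unfolding wr by (rule finite_fibres_shift[OF fin])
  have "finite_fibres (slope_lists 0 (Suc n) P Q) total_hex \<longleftrightarrow>
      finite_fibres (SIGMA r:{..<6}. UNIV \<times> A r) (\<lambda>(r, x). w r x)"
    by (rule finite_fibres_bij[OF bij]) (rule weight)
  also have "\<dots>" by (rule finite_fibres_Sigma) (simp_all add: fin_r)
  finally have fin_Suc: "finite_fibres (slope_lists 0 (Suc n) P Q) total_hex" .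
  have "gf (slope_lists 0 (Suc n) P Q) total_hex = gf (SIGMA r:{..<6}. UNIV \<times> A r) (\<lambda>(r, x). w r x)"
    by (rule gf_bij[OF bij]) (rule weight)
  then have "gf (slope_lists 0 (Suc n) P Q) total_hex = (\<Sum>r<6. gf (UNIV \<times> A r) (w r))"
    by (subst (asm) gf_Sigma) (simp_all add: fin_r)
  then have "gf (slope_lists 0 (Suc n) P Q) total_hex * (1 - fps_X) ^ (2 * Suc n) =
      (\<Sum>r<6. fps_X ^ cone_weight r * fps_of_poly (slope_poly n (P - cone_slope r) (Q - cone_slope' r)))"
    by (simp only: sum_distrib_right gfr)
  also have "\<dots> = fps_of_poly (slope_poly (Suc n) P Q)"
  proof -
    have X2: "fps_of_poly [:0, 0, 1:] = (fps_X ^ 2 :: real fps)" "fps_of_poly [:0, 1:] = (fps_X :: real fps)"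
      by (simp_all add: fps_of_poly_pCons power2_eq_square)
    show ?thesis
      by (simp add: sum_less_6 cone_defs fps_of_poly_add fps_of_poly_mult X2 algebra_simps)
        (simp add: numeral_2_eq_2 monom_Suc monom_0)
  qed
  finally show ?case using fin_Suc by simp
qed

text \<open>The rotation of the hexagonal lattice by sixty degrees: it takes \<open>hexdir i\<close>
  to \<open>hexdir (succ6 i)\<close>, so only the directions 0 and 1 have to be counted.\<close>

definition rot :: "int \<times> int \<Rightarrow> int \<times> int" where
  "rot x = (fst x - snd x, fst x)"

lemma bij_rot: "bij rot"
  by (rule bij_betw_byWitness[where f' = "\<lambda>y. (snd y, snd y - fst y)"]) (auto simp: rot_def)

lemma hex_rot: "hex (rot x) = hex x"
  by (simp add: hex_def rot_def max_def min_def)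

lemma slope_rot:
  assumes "i < 6"
  shows "slope (succ6 i) (rot x) = slope i x"
proof -
  have "(fst (rot x) - fst (hexdir (succ6 i)), snd (rot x) - snd (hexdir (succ6 i))) =
      rot (fst x - fst (hexdir i), snd x - snd (hexdir i))"
    using assms by (cases rule: less_6_E) (simp_all add: rot_def)
  then show ?thesis by (simp add: slope_def hex_rot)
qed

lemma total_slope_rot: "i < 6 \<Longrightarrow> total_slope (succ6 i) (map rot xs) = total_slope i xs"
  by (simp add: total_slope_def slope_rot o_def)

lemma total_hex_rot: "total_hex (map rot xs) = total_hex xs"
  by (simp add: total_hex_def hex_rot o_def)

lemma bij_slope_lists_rot:
  assumes "i < 6"
  shows "bij_betw (map rot) (slope_lists i n P Q) (slope_lists (succ6 i) n P Q)"
  unfolding bij_betw_def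
proof
  show "inj_on (map rot) (slope_lists i n P Q)"
    using bij_rot by (meson bij_is_inj inj_mapI inj_on_subset subset_UNIV)
  have "xs \<in> map rot ` slope_lists i n P Q" if xs: "xs \<in> slope_lists (succ6 i) n P Q" for xs
  proof -
    define ys where "ys = map (\<lambda>y. (snd y, snd y - fst y)) xs"
    have "xs = map rot ys" by (simp add: ys_def o_def rot_def)
    moreover from this have "ys \<in> slope_lists i n P Q"
      using xs assms total_slope_rot[OF assms, of ys] total_slope_rot[OF succ6_less[OF assms], of ys]
      by (simp add: slope_lists_def)
    ultimately show ?thesis by blast
  qed
  moreover have "map rot xs \<in> slope_lists (succ6 i) n P Q" if "xs \<in> slope_lists i n P Q" for xs
    using that assms by (simp add: slope_lists_def total_slope_rot succ6_less)
  ultimately show "map rot ` slope_lists i n P Q = slope_lists (succ6 i) n P Q" by blast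
qed

lemma gf_slope_lists_rot:
  assumes "i < 6"
  shows "gf (slope_lists i n P Q) total_hex = gf (slope_lists 0 n P Q) total_hex"
proof -
  have *: "gf (slope_lists (succ6 i) n P Q) total_hex = gf (slope_lists i n P Q) total_hex" if "i < 6" for i
    by (rule gf_bij[OF bij_slope_lists_rot[OF that]]) (rule total_hex_rot)
  show ?thesis using assms *[of 0] *[of "Suc 0"] *[of 2] *[of 3] *[of 4]
    by (cases rule: less_6_E) simp_all
qed

section \<open>Inclusion and exclusion over the six directions\<close>

lemma slope_le_1: "i < 6 \<Longrightarrow> slope i x \<le> 1"
  by (erule less_6_E; cases x; simp add: slope_def int_hex; simp add: max_def min_def)

lemma total_slope_le: "i < 6 \<Longrightarrow> total_slope i xs \<le> int (length xs)"
proof (induction xs)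
  case (Cons x xs)
  then show ?case using slope_le_1[of i x] by (simp add: total_slope_def)
qed (simp add: total_slope_def)

lemma total_slope_subadditive:
  "i < 6 \<Longrightarrow> total_slope (succ6 i) xs \<le> total_slope i xs + total_slope (succ6 (succ6 i)) xs"
proof (induction xs)
  case (Cons x xs)
  then show ?case using slope_subadditive[of i x] by (simp add: total_slope_def)
qed (simp add: total_slope_def)

lemma total_slope_opposite: "i < 3 \<Longrightarrow> 0 \<le> total_slope i xs + total_slope (i + 3) xs"
proof (induction xs)
  case (Cons x xs)
  then show ?case using slope_opposite[of i x] by (simp add: total_slope_def)
qed (simp add: total_slope_def)

text \<open>The largest integer \<open>s\<close> with \<open>3 * s + tilt i < 0\<close>: it is -1
  for a positive tilt and 0 for a negative one.\<close>

definition threshold :: "nat \<Rightarrow> int" where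
  "threshold i = (if i < 3 then -1 else 0)"

lemma tilted_slope_neg_iff:
  assumes "i < 6"
  shows "3 * s + tilt i < 0 \<longleftrightarrow> s \<le> threshold i"
  using assms by (cases rule: less_6_E) (auto simp: tilt_def threshold_def)

lemma canonical_indicator:
  "of_bool (canonical xs) = 1 - (\<Sum>i<6. of_bool (total_slope i xs \<le> threshold i)) +
     (\<Sum>i<6. of_bool (total_slope i xs \<le> threshold i \<and> total_slope (succ6 i) xs \<le> threshold (succ6 i)) :: real)"
proof -
  define S where "S = (\<lambda>i. 3 * total_slope i xs + tilt i)"
  have "of_bool (\<forall>i<6. S i \<ge> 0) = 1 - (\<Sum>i<6. of_bool (S i < 0)) + (\<Sum>i<6. of_bool (S i < 0 \<and> S (succ6 i) < 0) :: real)"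
  proof (rule all_nonneg_indicator)
    fix i :: nat assume i: "i < 6"
    have "tilt (succ6 i) = tilt i + tilt (succ6 (succ6 i))"
      using i by (cases rule: less_6_E) (simp_all add: tilt_def)
    then show "S (succ6 i) \<le> S i + S (succ6 (succ6 i))"
      using total_slope_subadditive[OF i, of xs] by (simp add: S_def)
  next
    fix i :: nat assume i: "i < 3"
    then have "i = 0 \<or> i = Suc 0 \<or> i = 2" by auto
    then have "tilt i + tilt (i + 3) = 0" by (elim disjE) (simp_all add: tilt_def)
    then show "0 \<le> S i + S (i + 3)"
      using total_slope_opposite[OF i, of xs] by (simp add: S_def)
  qed
  then show ?thesis
    by (simp add: S_def canonical_def tilted_slope_neg_iff succ6_less cong: sum.cong_simp)
qed

lemma sum_of_bool_card: "finite B \<Longrightarrow> (\<Sum>x\<in>B. of_bool (P x) :: real) = real (card {x\<in>B. P x})"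
proof -
  assume "finite B"
  moreover have "B \<inter> {x. P x} = {x\<in>B. P x}" by auto
  ultimately show ?thesis by simp
qed

text \<open>The indicator identity is summed over the lists of fixed length and weight; these are
  finitely many by \<open>gf_slope_lists_0\<close> with the bounds \<open>int n\<close>.\<close>

lemma gf_canonical_inclusion_exclusion:
  "gf {xs. length xs = n \<and> canonical xs} total_hex =
     gf (slope_lists 0 n (int n) (int n)) total_hex
     - (\<Sum>i<6. gf (slope_lists i n (threshold i) (int n)) total_hex)
     + (\<Sum>i<6. gf (slope_lists i n (threshold i) (threshold (succ6 i))) total_hex)"
  and finite_fibres_canonical: "finite_fibres {xs. length xs = n \<and> canonical xs} total_hex"
proof -
  define B where "B = (\<lambda>m. {xs. length xs = n \<and> total_hex xs = m})"
  have L: "{xs\<in>slope_lists 0 n (int n) (int n). total_hex xs = m} = B m" for m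
    using total_slope_le by (fastforce simp: slope_lists_def B_def)
  have fin: "finite (B m)" for m
    using gf_slope_lists_0[of n "int n" "int n"] by (simp add: finite_fibres_def L)
  have sub: "{xs\<in>{xs. length xs = n \<and> canonical xs}. total_hex xs = m} = {xs\<in>B m. canonical xs}" for m
    by (auto simp: B_def)
  show "finite_fibres {xs. length xs = n \<and> canonical xs} total_hex"
    unfolding finite_fibres_def sub using fin by simp
  have 1: "{xs\<in>slope_lists i n (threshold i) (int n). total_hex xs = m} = {xs\<in>B m. total_slope i xs \<le> threshold i}"
    if "i < 6" for i m
    using total_slope_le[OF succ6_less[OF that]] by (fastforce simp: slope_lists_def B_def)
  have 2: "{xs\<in>slope_lists i n (threshold i) (threshold (succ6 i)). total_hex xs = m} =
      {xs\<in>B m. total_slope i xs \<le> threshold i \<and> total_slope (succ6 i) xs \<le> threshold (succ6 i)}" for i m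
    by (auto simp: slope_lists_def B_def)
  show "gf {xs. length xs = n \<and> canonical xs} total_hex =
     gf (slope_lists 0 n (int n) (int n)) total_hex
     - (\<Sum>i<6. gf (slope_lists i n (threshold i) (int n)) total_hex)
     + (\<Sum>i<6. gf (slope_lists i n (threshold i) (threshold (succ6 i))) total_hex)"
  proof (rule fps_ext)
    fix m
    have "real (card {xs\<in>B m. canonical xs}) = (\<Sum>xs\<in>B m. of_bool (canonical xs))"
      using fin by (simp only: sum_of_bool_card)
    also have "\<dots> = real (card (B m)) - (\<Sum>i<6. \<Sum>xs\<in>B m. of_bool (total_slope i xs \<le> threshold i)) +
        (\<Sum>i<6. \<Sum>xs\<in>B m. of_bool (total_slope i xs \<le> threshold i \<and> total_slope (succ6 i) xs \<le> threshold (succ6 i)))"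
      unfolding canonical_indicator sum.distrib sum_subtractf
      by (subst (1 3) sum.swap) simp
    also have "(\<Sum>i<6. \<Sum>xs\<in>B m. of_bool (total_slope i xs \<le> threshold i)) =
        (\<Sum>i<6. fps_nth (gf (slope_lists i n (threshold i) (int n)) total_hex) m)"
      by (intro sum.cong refl) (simp only: gf_nth 1 sum_of_bool_card[OF fin] lessThan_iff)
    also have "(\<Sum>i<6. \<Sum>xs\<in>B m. of_bool (total_slope i xs \<le> threshold i \<and> total_slope (succ6 i) xs \<le> threshold (succ6 i))) =
        (\<Sum>i<6. fps_nth (gf (slope_lists i n (threshold i) (threshold (succ6 i))) total_hex) m)"
      by (intro sum.cong refl) (simp only: gf_nth 2 sum_of_bool_card[OF fin])
    finally show "fps_nth (gf {xs. length xs = n \<and> canonical xs} total_hex) m =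
      fps_nth (gf (slope_lists 0 n (int n) (int n)) total_hex
       - (\<Sum>i<6. gf (slope_lists i n (threshold i) (int n)) total_hex)
       + (\<Sum>i<6. gf (slope_lists i n (threshold i) (threshold (succ6 i))) total_hex)) m"
      by (simp only: gf_nth sub L fps_sum_nth fps_add_nth fps_sub_nth)
  qed
qed

text \<open>The polynomials \<open>slope_poly n P Q\<close> depend only on \<open>P\<close> and \<open>Q\<close> cut off at \<open>n\<close> and vanish
  if one of them is less than \<open>- n\<close>; \<open>slope_table n\<close> lists their coefficients for \<open>P\<close>, \<open>Q\<close> between \<open>- n\<close>
  and \<open>n\<close>.\<close>

fun ladd :: "int list \<Rightarrow> int list \<Rightarrow> int list" where
  "ladd [] ys = ys"
| "ladd xs [] = xs"
| "ladd (x # xs) (y # ys) = (x + y) # ladd xs ys"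

definition look :: "int \<Rightarrow> int list list list \<Rightarrow> int \<Rightarrow> int \<Rightarrow> int list" where
  "look n t P Q = (if P < - n \<or> Q < - n then [] else t ! nat (min P n + n) ! nat (min Q n + n))"

definition cell :: "int \<Rightarrow> int list list list \<Rightarrow> int \<Rightarrow> int \<Rightarrow> int list" where
  "cell n t P Q = ladd (0 # 0 # look n t (P + 1) (Q + 1))
     (ladd (0 # ladd (ladd (look n t (P + 1) Q) (look n t P (Q + 1))) (ladd (look n t (P - 1) Q) (look n t P (Q - 1))))
       (look n t (P - 1) (Q - 1)))"

definition grid :: "int \<Rightarrow> int list list list \<Rightarrow> int list list list" where
  "grid n t = map (\<lambda>P. map (cell n t P) [- (n + 1)..n + 1]) [- (n + 1)..n + 1]"

primrec slope_table :: "nat \<Rightarrow> int list list list" where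
  "slope_table 0 = [[[1]]]"
| "slope_table (Suc n) = grid (int n) (slope_table n)"

definition rpoly :: "int list \<Rightarrow> real poly" where
  "rpoly cs = Poly (map of_int cs)"

lemma rpoly_simps: "rpoly [] = 0" "rpoly (c # cs) = pCons (of_int c) (rpoly cs)"
  by (simp_all add: rpoly_def)

lemma rpoly_ladd: "rpoly (ladd xs ys) = rpoly xs + rpoly ys"
  by (induction xs ys rule: ladd.induct) (simp_all add: rpoly_simps)

text \<open>Each of the \<open>n\<close> points changes a slope by at most one, so a bound below
  \<open>- n\<close> cannot be met and a bound above \<open>n\<close> acts like
  \<open>n\<close>.\<close>

lemma slope_poly_bounds:
  "P < - int n \<or> Q < - int n \<Longrightarrow> slope_poly n P Q = 0"
  "slope_poly n (min P (int n)) (min Q (int n)) = slope_poly n P Q"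
proof -
  show "P < - int n \<or> Q < - int n \<Longrightarrow> slope_poly n P Q = 0"
    by (induction n arbitrary: P Q) auto
  have cut: "slope_poly n P Q = slope_poly n P' Q'"
    if "P = P' \<or> int n \<le> P \<and> int n \<le> P'" "Q = Q' \<or> int n \<le> Q \<and> int n \<le> Q'" for P P' Q Q'
    using that
  proof (induction n arbitrary: P P' Q Q')
    case (Suc n)
    have "slope_poly n (P + c) (Q + d) = slope_poly n (P' + c) (Q' + d)" if "\<bar>c\<bar> \<le> 1" "\<bar>d\<bar> \<le> 1" for c d
      using Suc.prems that by (intro Suc.IH) auto
    from this[of 1 1] this[of 1 0] this[of 0 1] this[of "-1" 0] this[of 0 "-1"] this[of "-1" "-1"]
    show ?case by simp
  qed auto
  show "slope_poly n (min P (int n)) (min Q (int n)) = slope_poly n P Q"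
    by (rule cut) (simp_all add: min_def)
qed

lemma rpoly_look_cell:
  assumes "\<And>P Q. rpoly (look (int n) t P Q) = slope_poly n P Q"
  shows "rpoly (cell (int n) t P Q) = slope_poly (Suc n) P Q"
  by (simp add: cell_def rpoly_ladd rpoly_simps assms)

lemma rpoly_slope_table: "rpoly (look (int n) (slope_table n) P Q) = slope_poly n P Q"
proof (induction n arbitrary: P Q)
  case 0
  then show ?case by (auto simp: look_def rpoly_simps)
next
  case (Suc n)
  show ?case
  proof (cases "P < - int (Suc n) \<or> Q < - int (Suc n)")
    case True
    then show ?thesis using slope_poly_bounds(1)[OF True] by (simp only: look_def if_True rpoly_simps)
  next
    case False
    define m where "m = int (Suc n)"
    have table: "slope_table (Suc n) = map (\<lambda>P. map (cell (int n) (slope_table n) P) [- m..m]) [- m..m]"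
      by (simp add: grid_def m_def add.commute)
    have "look m (slope_table (Suc n)) P Q = cell (int n) (slope_table n) (min P m) (min Q m)"
    proof -
      have idx: "nat (x + m) < length [- m..m]" "[- m..m] ! nat (x + m) = x" if "- m \<le> x" "x \<le> m" for x
        using that by (simp_all add: nth_upto)
      have "- m \<le> min P m" "- m \<le> min Q m" using False unfolding m_def by linarith+
      then show ?thesis
        using False unfolding look_def table m_def[symmetric] by (simp only: if_False nth_map idx min.cobounded2)
    qed
    then show ?thesis
      using rpoly_look_cell[OF Suc.IH] slope_poly_bounds(2)[where n = "Suc n"] by (simp only: m_def)
  qed
qed

text \<open>The last step, from five to six points, is evaluated only at the pairs that occur in the
  inclusion and exclusion: no threshold, one threshold, or the thresholds of two adjacent
  directions.\<close>

definition slope_values :: "int list list list \<Rightarrow> int list list" where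
  "slope_values t = map (\<lambda>(P, Q). cell 5 t P Q) [(6, 6), (-1, 6), (0, 6), (-1, -1), (-1, 0), (0, -1), (0, 0)]"

lemma slope_values_computed:
  "slope_values (grid 4 (grid 3 (grid 2 (grid 1 (grid 0 [[[1]]]))))) =
   [[1, 24, 246, 1400, 4815, 10224, 13236, 10224, 4815, 1400, 246, 24, 1],
    [0, 0, 0, 0, 135, 1476, 4826, 6528, 4200, 1380, 246, 24, 1],
    [0, 0, 0, 20, 615, 3696, 8410, 8748, 4680, 1400, 246, 24, 1],
    [0, 0, 0, 0, 0, 120, 1982, 3972, 3675, 1360, 246, 24, 1],
    [0, 0, 0, 0, 0, 630, 2844, 5682, 4065, 1380, 246, 24, 1],
    [0, 0, 0, 0, 0, 630, 2844, 5682, 4065, 1380, 246, 24, 1],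
    [0, 0, 0, 0, 90, 1140, 5566, 7392, 4545, 1400, 246, 24, 1]]"
  by code_simp

lemma slope_poly_6:
  "slope_poly 6 6 6 = [:1, 24, 246, 1400, 4815, 10224, 13236, 10224, 4815, 1400, 246, 24, 1:]"
  "slope_poly 6 (-1) 6 = [:0, 0, 0, 0, 135, 1476, 4826, 6528, 4200, 1380, 246, 24, 1:]"
  "slope_poly 6 0 6 = [:0, 0, 0, 20, 615, 3696, 8410, 8748, 4680, 1400, 246, 24, 1:]"
  "slope_poly 6 (-1) (-1) = [:0, 0, 0, 0, 0, 120, 1982, 3972, 3675, 1360, 246, 24, 1:]"
  "slope_poly 6 (-1) 0 = [:0, 0, 0, 0, 0, 630, 2844, 5682, 4065, 1380, 246, 24, 1:]"
  "slope_poly 6 0 (-1) = [:0, 0, 0, 0, 0, 630, 2844, 5682, 4065, 1380, 246, 24, 1:]"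
  "slope_poly 6 0 0 = [:0, 0, 0, 0, 90, 1140, 5566, 7392, 4545, 1400, 246, 24, 1:]"
proof -
  have table: "slope_table 5 = grid 4 (grid 3 (grid 2 (grid 1 (grid 0 [[[1]]]))))"
    by (simp add: numeral_eq_Suc)
  have "slope_poly 6 P Q = rpoly (cell 5 (slope_table 5) P Q)" for P Q
    using rpoly_look_cell[where n = 5 and t = "slope_table 5", OF rpoly_slope_table] by simp
  then have "map (\<lambda>(P, Q). slope_poly 6 P Q) [(6, 6), (-1, 6), (0, 6), (-1, -1), (-1, 0), (0, -1), (0, 0)] =
      map rpoly (slope_values (slope_table 5))"
    by (simp add: slope_values_def)
  then show "slope_poly 6 6 6 = [:1, 24, 246, 1400, 4815, 10224, 13236, 10224, 4815, 1400, 246, 24, 1:]"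
    "slope_poly 6 (-1) 6 = [:0, 0, 0, 0, 135, 1476, 4826, 6528, 4200, 1380, 246, 24, 1:]"
    "slope_poly 6 0 6 = [:0, 0, 0, 20, 615, 3696, 8410, 8748, 4680, 1400, 246, 24, 1:]"
    "slope_poly 6 (-1) (-1) = [:0, 0, 0, 0, 0, 120, 1982, 3972, 3675, 1360, 246, 24, 1:]"
    "slope_poly 6 (-1) 0 = [:0, 0, 0, 0, 0, 630, 2844, 5682, 4065, 1380, 246, 24, 1:]"
    "slope_poly 6 0 (-1) = [:0, 0, 0, 0, 0, 630, 2844, 5682, 4065, 1380, 246, 24, 1:]"
    "slope_poly 6 0 0 = [:0, 0, 0, 0, 90, 1140, 5566, 7392, 4545, 1400, 246, 24, 1:]"
    unfolding table slope_values_computed by (simp_all add: rpoly_simps)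
qed

section \<open>The numerator in dimension ten\<close>

definition hstar10 :: "real poly" where
  "hstar10 = [:1, 26, 297, 1908, 6264, 9108, 6264, 1908, 297, 26, 1:]"

text \<open>Six points in the plane give the denominator \<open>(1 - t) ^ 12\<close>. Translations
  use up two dimensions, and accordingly \<open>(1 - t) ^ 2\<close> divides the alternating sum of
  the numerators; the quotient is \<open>hstar10\<close>.\<close>

lemma gf_canonical:
  "gf {xs. length xs = 6 \<and> canonical xs} total_hex * (1 - fps_X) ^ 10 = fps_of_poly hstar10"
proof -
  let ?g = "gf {xs. length xs = 6 \<and> canonical xs} total_hex"
  have gfL: "gf (slope_lists i 6 P Q) total_hex * (1 - fps_X) ^ 12 = fps_of_poly (slope_poly 6 P Q)" if "i < 6" for i P Q
    using gf_slope_lists_0[of 6 P Q] gf_slope_lists_rot[OF that, of 6 P Q] by simp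
  have "?g * (1 - fps_X) ^ 12 = fps_of_poly (slope_poly 6 6 6
     - (\<Sum>i<6. slope_poly 6 (threshold i) 6) + (\<Sum>i<6. slope_poly 6 (threshold i) (threshold (succ6 i))))"
    unfolding gf_canonical_inclusion_exclusion[of 6] ring_distribs sum_distrib_right
    by (simp add: gfL fps_of_poly_add fps_of_poly_diff fps_of_poly_sum)
  also have "slope_poly 6 6 6 - (\<Sum>i<6. slope_poly 6 (threshold i) 6) + (\<Sum>i<6. slope_poly 6 (threshold i) (threshold (succ6 i)))
      = hstar10 * [:1, -1:] ^ 2"
    unfolding sum_less_6 succ6_simps threshold_def hstar10_def
    by (simp add: slope_poly_6 power2_eq_square)
  also have "fps_of_poly (hstar10 * [:1, -1:] ^ 2) = fps_of_poly hstar10 * (1 - fps_X) ^ 2"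
    by (simp add: fps_of_poly_mult fps_of_poly_power fps_of_poly_pCons)
  finally have "(?g * (1 - fps_X) ^ 10) * (1 - fps_X) ^ 2 = fps_of_poly hstar10 * (1 - fps_X) ^ 2"
    by (simp add: power_add[symmetric] mult.assoc)
  moreover have "(1 - fps_X :: real fps) ^ 2 \<noteq> 0"
    using fps_X_neq_one by auto
  ultimately show ?thesis by simp
qed

section \<open>Coloops and the Ehrhart series\<close>

definition total_abs :: "int list \<Rightarrow> nat" where
  "total_abs zs = sum_list (map (\<lambda>z. nat \<bar>z\<bar>) zs)"

lemma gf_int: "gf UNIV (\<lambda>z. nat \<bar>z\<bar>) * (1 - fps_X) = 1 + fps_X"
  and finite_fibres_int: "finite_fibres UNIV (\<lambda>z. nat \<bar>z\<bar>)"
proof -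
  have eq: "{z\<in>UNIV. nat \<bar>z\<bar> = m} = {int m, - int m}" for m by auto
  show "finite_fibres UNIV (\<lambda>z. nat \<bar>z\<bar>)" unfolding finite_fibres_def eq by simp
  have "card {z\<in>UNIV. nat \<bar>z\<bar> = m} = (if m = 0 then 1 else 2)" for m
    unfolding eq by (simp add: card_insert_if)
  then show "gf UNIV (\<lambda>z. nat \<bar>z\<bar>) * (1 - fps_X) = 1 + fps_X"
    by (simp add: fps_eq_iff mult_one_minus_X_nth gf_nth fps_X_nth)
qed

lemma gf_total_abs:
  "finite_fibres {zs. length zs = k} total_abs \<and>
   gf {zs. length zs = k} total_abs * (1 - fps_X) ^ k = (1 + fps_X) ^ k"
proof (induction k)
  case 0
  have "{zs\<in>{zs. length zs = 0}. total_abs zs = m} = (if m = 0 then {[]} else {})" for m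
    by (auto simp: total_abs_def)
  then show ?case by (simp add: fps_eq_iff gf_nth finite_fibres_def)
next
  case (Suc k)
  have bij: "bij_betw (\<lambda>(z, zs). z # zs) (UNIV \<times> {zs::int list. length zs = k}) {zs. length zs = Suc k}"
    by (auto simp: bij_betw_def inj_on_def length_Suc_conv image_iff)
  have w: "total_abs (case p of (z, zs) \<Rightarrow> z # zs) = (case p of (z, zs) \<Rightarrow> nat \<bar>z\<bar> + total_abs zs)" for p
    by (auto simp: total_abs_def split: prod.split)
  have fin: "finite_fibres {zs. length zs = k} total_abs" using Suc by blast
  have "gf {zs. length zs = Suc k} total_abs * (1 - fps_X) ^ Suc k =
      (gf UNIV (\<lambda>z. nat \<bar>z\<bar>) * (1 - fps_X)) * (gf {zs. length zs = k} total_abs * (1 - fps_X) ^ k)"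
    unfolding gf_bij[OF bij, where w' = total_abs, OF w] gf_times[OF finite_fibres_int fin] power_Suc by (simp only: mult_ac)
  also have "\<dots> = (1 + fps_X) ^ Suc k" unfolding gf_int using Suc by simp
  finally show ?case
    using finite_fibres_times[OF finite_fibres_int fin] finite_fibres_bij[OF bij, where w' = total_abs, OF w] by simp
qed

text \<open>The exponent is 10 for the points modulo translation, \<open>k\<close> for the coloops,
  and 1 for the passage from weight \<open>m\<close> to weight at most \<open>m\<close>.\<close>

lemma count_canonical_ball:
  "Abs_fps (\<lambda>m. real (card {(xs, zs). length xs = 6 \<and> canonical xs \<and> length zs = k \<and> total_hex xs + total_abs zs \<le> m}))
    * (1 - fps_X) ^ (10 + k + 1) = fps_of_poly (hstar10 * [:1, 1:] ^ k)"
proof -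
  let ?A = "{xs. length xs = 6 \<and> canonical xs}" and ?B = "{zs :: int list. length zs = k}"
  let ?w = "\<lambda>(xs, zs). total_hex xs + total_abs zs"
  have finB: "finite_fibres ?B total_abs" and gfB: "gf ?B total_abs * (1 - fps_X) ^ k = (1 + fps_X) ^ k"
    using gf_total_abs[of k] by auto
  have eq: "{(xs, zs). length xs = 6 \<and> canonical xs \<and> length zs = k \<and> total_hex xs + total_abs zs \<le> m} =
      {p\<in>?A \<times> ?B. ?w p \<le> m}" for m by auto
  have "Abs_fps (\<lambda>m. real (card {p\<in>?A \<times> ?B. ?w p \<le> m})) * (1 - fps_X) ^ (10 + k + 1) =
      (Abs_fps (\<lambda>m. real (card {p\<in>?A \<times> ?B. ?w p \<le> m})) * (1 - fps_X)) * ((1 - fps_X) ^ 10 * (1 - fps_X) ^ k)"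
    by (simp only: power_add power_one_right mult_ac)
  also have "\<dots> = (gf ?A total_hex * (1 - fps_X) ^ 10) * (gf ?B total_abs * (1 - fps_X) ^ k)"
    unfolding gf_cumulative[OF finite_fibres_times[OF finite_fibres_canonical finB]]
      gf_times[OF finite_fibres_canonical finB] by (simp only: mult_ac)
  also have "\<dots> = fps_of_poly (hstar10 * [:1, 1:] ^ k)"
    unfolding gf_canonical gfB by (simp add: fps_of_poly_mult fps_of_poly_power fps_of_poly_pCons)
  finally show ?thesis unfolding eq .
qed

section \<open>Lattice points of the polytope\<close>

text \<open>The hull is the image of a cross-polytope under the linear map that takes the unit
  vectors to the \<open>a e\<close>.\<close>

lemma symmetric_convex_hull:
  fixes a :: "nat \<Rightarrow> 'v::real_vector"
  assumes "n > 0"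
  shows "convex hull {v. \<exists>e<n. v = a e \<or> v = - a e} = {\<Sum>e<n. c e *\<^sub>R a e | c. (\<Sum>e<n. \<bar>c e\<bar>) \<le> 1}"
    (is "?P = ?Q")
proof
  have "convex ?Q"
  proof (rule convexI)
    fix x y and u v :: real assume uv: "0 \<le> u" "0 \<le> v" "u + v = 1" and "x \<in> ?Q" "y \<in> ?Q"
    then obtain c d where c: "x = (\<Sum>e<n. c e *\<^sub>R a e)" "(\<Sum>e<n. \<bar>c e\<bar>) \<le> 1"
      and d: "y = (\<Sum>e<n. d e *\<^sub>R a e)" "(\<Sum>e<n. \<bar>d e\<bar>) \<le> 1" by auto
    have "(\<Sum>e<n. \<bar>u * c e + v * d e\<bar>) \<le> (\<Sum>e<n. u * \<bar>c e\<bar> + v * \<bar>d e\<bar>)"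
      using uv by (intro sum_mono) (metis abs_mult abs_of_nonneg abs_triangle_ineq)
    also have "\<dots> = u * (\<Sum>e<n. \<bar>c e\<bar>) + v * (\<Sum>e<n. \<bar>d e\<bar>)"
      by (simp add: sum.distrib sum_distrib_left)
    also have "\<dots> \<le> u * 1 + v * 1" using uv c(2) d(2) by (intro add_mono mult_left_mono)
    finally have "(\<Sum>e<n. \<bar>u * c e + v * d e\<bar>) \<le> 1" using uv by simp
    moreover have "u *\<^sub>R x + v *\<^sub>R y = (\<Sum>e<n. (u * c e + v * d e) *\<^sub>R a e)"
      unfolding c(1) d(1) by (simp add: scaleR_sum_right sum.distrib scaleR_add_left)
    ultimately show "u *\<^sub>R x + v *\<^sub>R y \<in> ?Q" by (intro CollectI exI[of _ "\<lambda>e. u * c e + v * d e"]) simp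
  qed
  moreover have "s *\<^sub>R a e \<in> ?Q" if "e < n" "\<bar>s\<bar> \<le> 1" for s e
  proof -
    have "(\<Sum>e'<n. (if e' = e then s else 0) *\<^sub>R a e') = (\<Sum>e'<n. if e' = e then s *\<^sub>R a e' else 0)"
      by (intro sum.cong) auto
    also have "\<dots> = s *\<^sub>R a e" using that by simp
    finally have "s *\<^sub>R a e = (\<Sum>e'<n. (if e' = e then s else 0) *\<^sub>R a e')" by simp
    moreover have "(\<Sum>e'<n. \<bar>if e' = e then s else 0\<bar>) \<le> 1" using that by (simp add: if_distrib[of abs] cong: if_cong)
    ultimately show ?thesis by (intro CollectI exI[of _ "\<lambda>e'. if e' = e then s else 0"]) simp
  qed
  from this[of _ 1] this[of _ "-1"] have "{v. \<exists>e<n. v = a e \<or> v = - a e} \<subseteq> ?Q" by auto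
  ultimately show "?P \<subseteq> ?Q" by (intro hull_minimal)
next
  have mem: "a e \<in> ?P" "- a e \<in> ?P" if "e < n" for e
    using that by (auto intro!: hull_inc)
  have conv: "convex ?P" by (rule convex_convex_hull)
  have "(1 / 2) *\<^sub>R a 0 + (1 / 2) *\<^sub>R - a 0 \<in> ?P"
    using mem[OF assms] by (intro convexD[OF conv]) auto
  then have zero: "0 \<in> ?P" by simp
  show "?Q \<subseteq> ?P"
  proof
    fix x assume "x \<in> ?Q"
    then obtain c where c: "x = (\<Sum>e<n. c e *\<^sub>R a e)" "(\<Sum>e<n. \<bar>c e\<bar>) \<le> 1" by auto
    \<comment> \<open>The weight missing to 1 goes to the extra index \<open>n\<close>, where
      \<open>y\<close> is the origin.\<close>
    define u where "u = (\<lambda>e. if e < n then \<bar>c e\<bar> else 1 - (\<Sum>e<n. \<bar>c e\<bar>))"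
    define y where "y = (\<lambda>e. if e < n then sgn (c e) *\<^sub>R a e else 0)"
    have "(\<Sum>e\<in>{..n}. u e *\<^sub>R y e) \<in> ?P"
    proof (rule convex_sum[OF _ conv])
      show "(\<Sum>e\<in>{..n}. u e) = 1" by (simp add: u_def lessThan_Suc_atMost[symmetric])
      show "0 \<le> u e" for e using c(2) by (simp add: u_def)
      show "y e \<in> ?P" for e using mem[of e] zero by (auto simp: y_def sgn_if)
    qed simp
    also have "(\<Sum>e\<in>{..n}. u e *\<^sub>R y e) = x"
      by (simp add: u_def y_def c(1) lessThan_Suc_atMost[symmetric] abs_mult_sgn)
    finally show "x \<in> ?P" .
  qed
qed

lemma scaled_symmetric_convex_hull:
  fixes a :: "nat \<Rightarrow> 'v::real_vector"
  assumes "n > 0"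
  shows "(\<lambda>v. real m *\<^sub>R v) ` (convex hull {v. \<exists>e<n. v = a e \<or> v = - a e}) =
    {\<Sum>e<n. c e *\<^sub>R a e | c. (\<Sum>e<n. \<bar>c e\<bar>) \<le> real m}"
  unfolding symmetric_convex_hull[OF assms]
proof (intro equalityI subsetI)
  fix x assume "x \<in> (\<lambda>v. real m *\<^sub>R v) ` {\<Sum>e<n. c e *\<^sub>R a e | c. (\<Sum>e<n. \<bar>c e\<bar>) \<le> 1}"
  then obtain c where c: "x = real m *\<^sub>R (\<Sum>e<n. c e *\<^sub>R a e)" "(\<Sum>e<n. \<bar>c e\<bar>) \<le> 1" by auto
  have "x = (\<Sum>e<n. (real m * c e) *\<^sub>R a e)" by (simp add: c(1) scaleR_sum_right)
  moreover have "(\<Sum>e<n. \<bar>real m * c e\<bar>) \<le> real m"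
    using mult_left_mono[OF c(2), of "real m"] by (simp add: abs_mult sum_distrib_left)
  ultimately show "x \<in> {\<Sum>e<n. c e *\<^sub>R a e | c. (\<Sum>e<n. \<bar>c e\<bar>) \<le> real m}"
    by (intro CollectI exI[of _ "\<lambda>e. real m * c e"]) simp
next
  fix x assume "x \<in> {\<Sum>e<n. c e *\<^sub>R a e | c. (\<Sum>e<n. \<bar>c e\<bar>) \<le> real m}"
  then obtain c where c: "x = (\<Sum>e<n. c e *\<^sub>R a e)" "(\<Sum>e<n. \<bar>c e\<bar>) \<le> real m" by auto
  \<comment> \<open>For \<open>m = 0\<close> division yields 0, which is right because the bound
    then forces every \<open>c e\<close> to vanish.\<close>
  define d where "d = (\<lambda>e. c e / real m)"
  have "x = real m *\<^sub>R (\<Sum>e<n. d e *\<^sub>R a e)"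
  proof (cases "m = 0")
    case True
    then have "(\<Sum>e<n. \<bar>c e\<bar>) = 0" using c(2) by (simp add: antisym sum_nonneg)
    then have "\<forall>e<n. c e = 0" by (simp add: sum_nonneg_eq_0_iff)
    then show ?thesis using True by (simp add: c(1))
  next
    case False
    then show ?thesis by (simp add: c(1) d_def scaleR_sum_right)
  qed
  moreover have "(\<Sum>e<n. \<bar>d e\<bar>) \<le> 1"
    using c(2) by (cases "m = 0") (simp_all add: d_def sum_divide_distrib[symmetric] abs_divide)
  ultimately show "x \<in> (\<lambda>v. real m *\<^sub>R v) ` {\<Sum>e<n. c e *\<^sub>R a e | c. (\<Sum>e<n. \<bar>c e\<bar>) \<le> 1}"
    by blast
qed

section \<open>Coefficients modulo cuts as points modulo translation\<close>

lemma cut_vector_iff: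
  "cut_vector k c \<longleftrightarrow> (\<exists>p q. \<forall>j<6. c (3 * j) - c (3 * j + 2) = p \<and> c (3 * j + 1) - c (3 * j + 2) = q) \<and> (\<forall>l<k. c (18 + l) = 0)"
proof -
  have "(\<forall>e\<in>{18..<18 + k}. c e = 0) \<longleftrightarrow> (\<forall>l<k. c (18 + l) = 0)"
    by (metis add_less_cancel_left atLeastLessThan_iff le_add1 le_Suc_ex)
  moreover have "(\<forall>j<5. c (3 * j) - c (3 * j + 2) = c 15 - c 17 \<and> c (3 * j + 1) - c (3 * j + 2) = c 16 - c 17) \<longleftrightarrow>
    (\<exists>p q. \<forall>j<6. c (3 * j) - c (3 * j + 2) = p \<and> c (3 * j + 1) - c (3 * j + 2) = q)"
  proof
    assume *: "\<forall>j<5. c (3 * j) - c (3 * j + 2) = c 15 - c 17 \<and> c (3 * j + 1) - c (3 * j + 2) = c 16 - c 17"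
    have "c (3 * j) - c (3 * j + 2) = c 15 - c 17 \<and> c (3 * j + 1) - c (3 * j + 2) = c 16 - c 17" if "j < 6" for j
      using * that by (cases "j = 5") auto
    then show "\<exists>p q. \<forall>j<6. c (3 * j) - c (3 * j + 2) = p \<and> c (3 * j + 1) - c (3 * j + 2) = q" by blast
  next
    assume "\<exists>p q. \<forall>j<6. c (3 * j) - c (3 * j + 2) = p \<and> c (3 * j + 1) - c (3 * j + 2) = q"
    then obtain p q where *: "\<And>j. j < 6 \<Longrightarrow> c (3 * j) - c (3 * j + 2) = p \<and> c (3 * j + 1) - c (3 * j + 2) = q" by blast
    have "c 15 - c 17 = p" "c 16 - c 17 = q" using *[of 5] by simp_all
    then show "\<forall>j<5. c (3 * j) - c (3 * j + 2) = c 15 - c 17 \<and> c (3 * j + 1) - c (3 * j + 2) = c 16 - c 17"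
      using * by simp
  qed
  ultimately show ?thesis unfolding cut_vector_def by blast
qed

lemma sum_edges:
  fixes f :: "nat \<Rightarrow> 'b::comm_monoid_add"
  shows "(\<Sum>e<18 + k. f e) = (\<Sum>j<6. f (3 * j) + f (3 * j + 1) + f (3 * j + 2)) + (\<Sum>l<k. f (18 + l))"
proof -
  have "(\<Sum>e\<in>{18..<18 + k}. f e) = (\<Sum>l<k. f (18 + l))"
    by (rule sum.reindex_bij_witness[of _ "\<lambda>l. 18 + l" "\<lambda>e. e - 18"]) auto
  then show ?thesis unfolding sum_less_18_plus sum_less_6
    by (simp add: add_ac del: add_2_eq_Suc add_2_eq_Suc')
qed

text \<open>A pair \<open>(xs, zs)\<close> of six points and \<open>k\<close> integers encodes the lattice point with the coefficients
  \<open>coords xs zs\<close>; they vanish on the third edge of each triangle.\<close>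

definition coords :: "(int \<times> int) list \<Rightarrow> int list \<Rightarrow> nat \<Rightarrow> real" where
  "coords xs zs e = (if e \<ge> 18 then of_int (zs ! (e - 18))
     else if e mod 3 = 0 then of_int (fst (xs ! (e div 3)))
     else if e mod 3 = 1 then of_int (snd (xs ! (e div 3))) else 0)"

lemma coords_simps:
  "j < 6 \<Longrightarrow> coords xs zs (3 * j) = of_int (fst (xs ! j))"
  "j < 6 \<Longrightarrow> coords xs zs (3 * j + 1) = of_int (snd (xs ! j))"
  "j < 6 \<Longrightarrow> coords xs zs (3 * j + 2) = 0"
proof -
  assume "j < 6"
  moreover have "(3 * j + 1) mod 3 = 1" "(3 * j + 1) div 3 = j" "(3 * j + 2) mod 3 = 2"
    by (simp_all add: mod_mult_self4 del: add_2_eq_Suc' One_nat_def)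
  ultimately show "coords xs zs (3 * j + 1) = of_int (snd (xs ! j))" "coords xs zs (3 * j + 2) = 0"
    unfolding coords_def by simp_all
qed (simp add: coords_def)

lemma coords_coloop: "coords xs zs (18 + l) = of_int (zs ! l)"
  by (simp add: coords_def)

definition lattice_point :: "(nat \<Rightarrow> 'v) \<Rightarrow> nat \<Rightarrow> (int \<times> int) list \<Rightarrow> int list \<Rightarrow> 'v::real_vector" where
  "lattice_point a k xs zs = (\<Sum>e<18 + k. coords xs zs e *\<^sub>R a e)"

lemma cut_dependencies_eq_iff:
  assumes "cut_dependencies k a"
  shows "(\<Sum>e<18 + k. c e *\<^sub>R a e) = (\<Sum>e<18 + k. d e *\<^sub>R a e) \<longleftrightarrow> cut_vector k (\<lambda>e. c e - d e)"
proof -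
  have "(\<Sum>e<18 + k. c e *\<^sub>R a e) = (\<Sum>e<18 + k. d e *\<^sub>R a e) \<longleftrightarrow> (\<Sum>e<18 + k. (c e - d e) *\<^sub>R a e) = 0"
    by (simp add: scaleR_diff_left sum_subtractf)
  then show ?thesis using assms by (simp add: cut_dependencies_def)
qed

lemma total_hex_nth: "length xs = n \<Longrightarrow> total_hex xs = (\<Sum>j<n. hex (xs ! j))"
  by (simp add: total_hex_def sum_list_sum_nth lessThan_atLeast0)

lemma total_abs_nth: "length zs = n \<Longrightarrow> total_abs zs = (\<Sum>l<n. nat \<bar>zs ! l\<bar>)"
  by (simp add: total_abs_def sum_list_sum_nth lessThan_atLeast0)

lemma distance_sum_nth:
  "length xs = n \<Longrightarrow> distance_sum xs a b = (\<Sum>j<n. hexr (of_int (fst (xs ! j)) - a) (of_int (snd (xs ! j)) - b))"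
  by (simp add: distance_sum_def sum_list_sum_nth lessThan_atLeast0)

text \<open>The left side is the range of \<open>x\<close>, \<open>y\<close>, \<open>z\<close>, so
  it is at most the sum of two of the absolute values.\<close>

lemma hexr_le_abs: "hexr (x - z) (y - z) \<le> \<bar>x\<bar> + \<bar>y\<bar> + \<bar>z\<bar>"
  by (simp add: hexr_def max_def min_def abs_if)

text \<open>Other coefficients of the same point differ by a cut, hence come from a real translation
  of the six points. Canonical lists are minimal even among real translations, so fractional
  coefficients are no cheaper.\<close>

lemma weight_lower_bound:
  assumes dep: "cut_dependencies k a" and xs: "length xs = 6" "canonical xs" and zs: "length zs = k"
    and c: "(\<Sum>e<18 + k. c e *\<^sub>R a e) = lattice_point a k xs zs"
  shows "real (total_hex xs + total_abs zs) \<le> (\<Sum>e<18 + k. \<bar>c e\<bar>)"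
proof -
  obtain p q where
    pq: "\<And>j. j < 6 \<Longrightarrow> c (3 * j) - coords xs zs (3 * j) - (c (3 * j + 2) - coords xs zs (3 * j + 2)) = p"
      "\<And>j. j < 6 \<Longrightarrow> c (3 * j + 1) - coords xs zs (3 * j + 1) - (c (3 * j + 2) - coords xs zs (3 * j + 2)) = q"
    and l: "\<And>l. l < k \<Longrightarrow> c (18 + l) = coords xs zs (18 + l)"
    using c unfolding lattice_point_def cut_dependencies_eq_iff[OF dep] cut_vector_iff by auto
  have x: "c (3 * j) - c (3 * j + 2) = of_int (fst (xs ! j)) - (- p)"
    "c (3 * j + 1) - c (3 * j + 2) = of_int (snd (xs ! j)) - (- q)" if "j < 6" for j
    using pq[OF that] unfolding coords_simps[OF that] by simp_all
  have "real (total_hex xs) \<le> distance_sum xs (- p) (- q)"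
    by (rule canonical_distance_sum(1)[OF xs(2)])
  also have "\<dots> = (\<Sum>j<6. hexr (c (3 * j) - c (3 * j + 2)) (c (3 * j + 1) - c (3 * j + 2)))"
    unfolding distance_sum_nth[OF xs(1)] by (intro sum.cong refl) (simp only: x lessThan_iff)
  also have "\<dots> \<le> (\<Sum>j<6. \<bar>c (3 * j)\<bar> + \<bar>c (3 * j + 1)\<bar> + \<bar>c (3 * j + 2)\<bar>)"
    by (intro sum_mono hexr_le_abs)
  finally have "real (total_hex xs) \<le> (\<Sum>j<6. \<bar>c (3 * j)\<bar> + \<bar>c (3 * j + 1)\<bar> + \<bar>c (3 * j + 2)\<bar>)" .
  moreover have "real (total_abs zs) = (\<Sum>l<k. \<bar>c (18 + l)\<bar>)"
    unfolding total_abs_nth[OF zs] using l by (simp add: coords_coloop)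
  ultimately show ?thesis unfolding sum_edges by simp
qed

lemma weight_attained:
  assumes dep: "cut_dependencies k a" and xs: "length xs = 6" and zs: "length zs = k"
  obtains c where "(\<Sum>e<18 + k. c e *\<^sub>R a e) = lattice_point a k xs zs"
    "(\<Sum>e<18 + k. \<bar>c e\<bar>) = real (total_hex xs + total_abs zs)"
proof -
  \<comment> \<open>Subtracting the median of \<open>fst x\<close>, \<open>snd x\<close>, \<open>0\<close> from all three coefficients of a triangle
    makes the sum of their absolute values equal to the hexagonal norm.\<close>
  define med where "med = (\<lambda>x :: int \<times> int. real_of_int (fst x + snd x - max (max (fst x) (snd x)) 0 - min (min (fst x) (snd x)) 0))"
  define c where "c = (\<lambda>e. coords xs zs e - (if e < 18 then med (xs ! (e div 3)) else 0))"
  have c: "c (3 * j) = of_int (fst (xs ! j)) - med (xs ! j)" "c (3 * j + 1) = of_int (snd (xs ! j)) - med (xs ! j)"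
    "c (3 * j + 2) = - med (xs ! j)" if "j < 6" for j
  proof -
    have "3 * j < 18" "3 * j + 1 < 18" "3 * j + 2 < 18" "3 * j div 3 = j" "(3 * j + 1) div 3 = j" "(3 * j + 2) div 3 = j"
      using that by auto
    then show "c (3 * j) = of_int (fst (xs ! j)) - med (xs ! j)" "c (3 * j + 1) = of_int (snd (xs ! j)) - med (xs ! j)"
      "c (3 * j + 2) = - med (xs ! j)"
      using coords_simps[OF that, of xs zs] unfolding c_def by simp_all
  qed
  have c18: "c (18 + l) = of_int (zs ! l)" for l by (simp add: c_def coords_coloop)
  have "cut_vector k (\<lambda>e. c e - coords xs zs e)"
    unfolding cut_vector_iff
  proof (intro conjI exI allI impI)
    fix j :: nat assume j: "j < 6"
    show "c (3 * j) - coords xs zs (3 * j) - (c (3 * j + 2) - coords xs zs (3 * j + 2)) = 0"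
      "c (3 * j + 1) - coords xs zs (3 * j + 1) - (c (3 * j + 2) - coords xs zs (3 * j + 2)) = 0"
      unfolding c[OF j] coords_simps[OF j] by simp_all
  next
    show "c (18 + l) - coords xs zs (18 + l) = 0" for l unfolding c18 coords_coloop by simp
  qed
  then have "(\<Sum>e<18 + k. c e *\<^sub>R a e) = lattice_point a k xs zs"
    unfolding lattice_point_def cut_dependencies_eq_iff[OF dep] .
  moreover have "\<bar>of_int (fst x) - med x\<bar> + \<bar>of_int (snd x) - med x\<bar> + \<bar>- med x\<bar> = real (hex x)" for x
    unfolding hexr_of_int[symmetric] by (simp add: hexr_def med_def max_def min_def abs_if)
  then have "(\<Sum>j<6. \<bar>c (3 * j)\<bar> + \<bar>c (3 * j + 1)\<bar> + \<bar>c (3 * j + 2)\<bar>) = (\<Sum>j<6. real (hex (xs ! j)))"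
    by (intro sum.cong refl) (simp only: c lessThan_iff)
  then have "(\<Sum>e<18 + k. \<bar>c e\<bar>) = real (total_hex xs + total_abs zs)"
    unfolding sum_edges total_hex_nth[OF xs] total_abs_nth[OF zs] by (simp add: c18)
  ultimately show ?thesis by (rule that)
qed

lemma reduce_to_base:
  assumes dep: "cut_dependencies k a"
  obtains d where "\<And>e. e \<notin> base k \<Longrightarrow> d e = 0" "(\<Sum>e<18 + k. c e *\<^sub>R a e) = (\<Sum>e<18 + k. d e *\<^sub>R a e)"
proof -
  \<comment> \<open>The cut that agrees with \<open>c\<close> on the spanning tree outside
    \<open>base k\<close>.\<close>
  define \<kappa> where "\<kappa> = (\<lambda>e. if e \<ge> 18 then 0 else c (3 * (e div 3) + 2) +
    (if e mod 3 = 0 then c 15 - c 17 else if e mod 3 = 1 then c 16 - c 17 else 0))"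
  define d where "d = (\<lambda>e. if e < 18 + k then c e - \<kappa> e else 0)"
  have "\<forall>e<18. e \<notin> base k \<longrightarrow> d e = 0"
    unfolding all_less_18 by (simp add: base_def d_def \<kappa>_def del: add_2_eq_Suc add_2_eq_Suc' One_nat_def)
  moreover have "d e = 0" if "e \<ge> 18" "e \<notin> base k" for e using that by (simp add: base_def d_def)
  ultimately have "\<And>e. e \<notin> base k \<Longrightarrow> d e = 0" by (meson not_less)
  moreover have "cut_vector k \<kappa>"
    unfolding cut_vector_unroll by (simp add: \<kappa>_def del: add_2_eq_Suc add_2_eq_Suc' One_nat_def)
  then have "cut_vector k (\<lambda>e. c e - d e)"
    unfolding cut_vector_unroll by (simp add: d_def)
  then have "(\<Sum>e<18 + k. c e *\<^sub>R a e) = (\<Sum>e<18 + k. d e *\<^sub>R a e)"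
    unfolding cut_dependencies_eq_iff[OF dep] .
  ultimately show ?thesis by (rule that)
qed

lemma lattice_point_translate:
  assumes dep: "cut_dependencies k a" and "length xs = 6"
  shows "lattice_point a k (translate p q xs) zs = lattice_point a k xs zs"
  unfolding lattice_point_def cut_dependencies_eq_iff[OF dep] cut_vector_iff
proof (intro conjI exI allI impI)
  fix j :: nat assume j: "j < 6"
  show "coords (translate p q xs) zs (3 * j) - coords xs zs (3 * j) -
      (coords (translate p q xs) zs (3 * j + 2) - coords xs zs (3 * j + 2)) = - of_int p"
    "coords (translate p q xs) zs (3 * j + 1) - coords xs zs (3 * j + 1) -
      (coords (translate p q xs) zs (3 * j + 2) - coords xs zs (3 * j + 2)) = - of_int q"
    unfolding coords_simps[OF j] using j assms(2) by (simp_all add: translate_nth)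
qed (simp add: coords_coloop)

text \<open>Coefficients supported on the base are unique, hence integral at an integral point. In
  pairs they are the coordinates of six lattice points, the last being the origin, and a translation
  makes this list canonical.\<close>

lemma lattice_point_surj:
  fixes a :: "nat \<Rightarrow> nat \<Rightarrow> real"
  assumes dep: "cut_dependencies k a"
    and int: "integral_coefficients (18 + k) a"
    and y: "\<And>i. (\<Sum>e<18 + k. c e *\<^sub>R a e) i \<in> \<int>"
  obtains xs zs where "length xs = 6" "canonical xs" "length zs = k" "(\<Sum>e<18 + k. c e *\<^sub>R a e) = lattice_point a k xs zs"
proof -
  obtain d where d: "\<And>e. e \<notin> base k \<Longrightarrow> d e = 0" "(\<Sum>e<18 + k. c e *\<^sub>R a e) = (\<Sum>e<18 + k. d e *\<^sub>R a e)"
    using reduce_to_base[OF dep] by blast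
  have sub: "base k \<subseteq> {..<18 + k}" by (auto simp: base_def)
  have "(\<Sum>e\<in>base k. d e *\<^sub>R a e) = (\<Sum>e<18 + k. d e *\<^sub>R a e)"
    using sub d(1) by (intro sum.mono_neutral_cong_left) auto
  then have "(\<Sum>e\<in>base k. d e *\<^sub>R a e) i \<in> \<int>" for i using y[of i] by (simp only: d(2))
  then have "d e \<in> \<int>" if "e \<in> base k" for e
    by (rule integral_coefficientsD[OF int sub fam_indep_base[OF dep] _ that])
  then have dint: "d e \<in> \<int>" for e using d(1)[of e] by (cases "e \<in> base k") auto
  define ys where "ys = map (\<lambda>j. (\<lfloor>d (3 * j)\<rfloor>, \<lfloor>d (3 * j + 1)\<rfloor>)) [0..<6]"
  define zs where "zs = map (\<lambda>l. \<lfloor>d (18 + l)\<rfloor>) [0..<k]"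
  have len: "length ys = 6" "length zs = k" by (simp_all add: ys_def zs_def)
  have fl: "of_int \<lfloor>d e\<rfloor> = d e" for e using dint[of e] by (metis floor_of_int Ints_cases)
  have ys: "ys ! j = (\<lfloor>d (3 * j)\<rfloor>, \<lfloor>d (3 * j + 1)\<rfloor>)" if "j < 6" for j
    using that by (simp add: ys_def)
  have third: "d (3 * j + 2) = 0" if "j < 6" for j
    using that by (intro d(1)) (auto simp: base_def elim!: less_6_E)
  have "cut_vector k (\<lambda>e. d e - coords ys zs e)"
    unfolding cut_vector_iff
  proof (intro conjI exI allI impI)
    fix j :: nat assume j: "j < 6"
    show "d (3 * j) - coords ys zs (3 * j) - (d (3 * j + 2) - coords ys zs (3 * j + 2)) = 0"
      "d (3 * j + 1) - coords ys zs (3 * j + 1) - (d (3 * j + 2) - coords ys zs (3 * j + 2)) = 0"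
      unfolding coords_simps[OF j] ys[OF j] third[OF j] fst_conv snd_conv fl by simp_all
  next
    fix l assume "l < k"
    then show "d (18 + l) - coords ys zs (18 + l) = 0"
      unfolding coords_coloop by (simp add: zs_def fl)
  qed
  then have eq: "(\<Sum>e<18 + k. c e *\<^sub>R a e) = lattice_point a k ys zs"
    unfolding d(2) lattice_point_def cut_dependencies_eq_iff[OF dep] .
  have "ys \<noteq> []" using len by auto
  then obtain p q where "canonical (translate p q ys)" by (rule canonical_exists)
  then show ?thesis
    using that[of "translate p q ys" zs] len eq lattice_point_translate[OF dep len(1)] by simp
qed

text \<open>Equal points have coefficients that differ by a cut, so the lists differ by a
  translation, which is trivial between canonical lists.\<close>

lemma lattice_point_inject:
  assumes dep: "cut_dependencies k a"
    and xs: "length xs = 6" "canonical xs" "length xs' = 6" "canonical xs'"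
    and zs: "length zs = k" "length zs' = k"
    and eq: "lattice_point a k xs zs = lattice_point a k xs' zs'"
  shows "xs = xs' \<and> zs = zs'"
proof -
  obtain p q where
    pq: "\<And>j. j < 6 \<Longrightarrow> coords xs zs (3 * j) - coords xs' zs' (3 * j) - (coords xs zs (3 * j + 2) - coords xs' zs' (3 * j + 2)) = p"
      "\<And>j. j < 6 \<Longrightarrow> coords xs zs (3 * j + 1) - coords xs' zs' (3 * j + 1) - (coords xs zs (3 * j + 2) - coords xs' zs' (3 * j + 2)) = q"
    and l: "\<And>l. l < k \<Longrightarrow> coords xs zs (18 + l) = coords xs' zs' (18 + l)"
    using eq unfolding lattice_point_def cut_dependencies_eq_iff[OF dep] cut_vector_iff by auto
  have x: "real_of_int (fst (xs ! j)) - of_int (fst (xs' ! j)) = p" "real_of_int (snd (xs ! j)) - of_int (snd (xs' ! j)) = q" if "j < 6" for j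
    using pq[OF that] unfolding coords_simps[OF that] by simp_all
  define p' q' where "p' = fst (xs ! 0) - fst (xs' ! 0)" and "q' = snd (xs ! 0) - snd (xs' ! 0)"
  have p': "of_int p' = p" "of_int q' = q" using x[of 0] by (simp_all add: p'_def q'_def)
  have "xs' = translate p' q' xs"
  proof (rule nth_equalityI)
    fix j assume "j < length xs'"
    then have j: "j < 6" using xs by simp
    have "real_of_int (fst (xs' ! j)) = of_int (fst (xs ! j) - p')" "real_of_int (snd (xs' ! j)) = of_int (snd (xs ! j) - q')"
      using x[OF j] p' by simp_all
    then show "xs' ! j = translate p' q' xs ! j"
      using j xs by (simp only: of_int_eq_iff) (simp add: translate_nth prod_eq_iff)
  qed (simp add: xs)
  moreover from this have "p' = 0 \<and> q' = 0" using canonical_unique[OF xs(2), of p' q'] xs(4) by simp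
  ultimately have "xs = xs'" by (simp add: translate_def)
  moreover have "zs = zs'"
    using l zs by (intro nth_equalityI) (simp_all add: coords_coloop)
  ultimately show ?thesis by simp
qed

lemma lattice_count_symmetric_hull:
  fixes a :: "nat \<Rightarrow> nat \<Rightarrow> real"
  assumes dep: "cut_dependencies k a"
    and int: "integral_coefficients (18 + k) a"
    and aint: "\<And>e i. e < 18 + k \<Longrightarrow> a e i \<in> \<int>"
  shows "lattice_count (convex hull {v. \<exists>e<18 + k. v = a e \<or> v = - a e}) m =
    card {(xs, zs). length xs = 6 \<and> canonical xs \<and> length zs = k \<and> total_hex xs + total_abs zs \<le> m}"
proof -
  let ?P = "convex hull {v. \<exists>e<18 + k. v = a e \<or> v = - a e}"
  let ?L = "{x. x \<in> (\<lambda>v. real m *\<^sub>R v) ` ?P \<and> (\<forall>i. x i \<in> \<int>)}"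
  let ?K = "{(xs, zs). length xs = 6 \<and> canonical xs \<and> length zs = k \<and> total_hex xs + total_abs zs \<le> m}"
  have scaled: "(\<lambda>v. real m *\<^sub>R v) ` ?P = {\<Sum>e<18 + k. c e *\<^sub>R a e | c. (\<Sum>e<18 + k. \<bar>c e\<bar>) \<le> real m}"
    by (rule scaled_symmetric_convex_hull) simp
  have "bij_betw (\<lambda>(xs, zs). lattice_point a k xs zs) ?K ?L"
    unfolding bij_betw_def
  proof (intro conjI equalityI subsetI)
    show "inj_on (\<lambda>(xs, zs). lattice_point a k xs zs) ?K"
      by (rule inj_onI) (use lattice_point_inject[OF dep] in auto)
  next
    fix y assume "y \<in> (\<lambda>(xs, zs). lattice_point a k xs zs) ` ?K"
    then obtain xs zs where y: "y = lattice_point a k xs zs"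
      and K: "length xs = 6" "canonical xs" "length zs = k" "total_hex xs + total_abs zs \<le> m" by auto
    obtain c where c: "(\<Sum>e<18 + k. c e *\<^sub>R a e) = lattice_point a k xs zs"
      "(\<Sum>e<18 + k. \<bar>c e\<bar>) = real (total_hex xs + total_abs zs)"
      using weight_attained[OF dep K(1,3)] .
    have "y \<in> {\<Sum>e<18 + k. c e *\<^sub>R a e | c. (\<Sum>e<18 + k. \<bar>c e\<bar>) \<le> real m}"
      unfolding y c(1)[symmetric] using c(2) K(4) by (intro CollectI exI[of _ c]) simp
    moreover have "y i \<in> \<int>" for i
      unfolding y lattice_point_def sum_fun_apply scaleR_fun_def real_scaleR_def
      by (intro Ints_sum Ints_mult aint) (auto simp: coords_def)
    ultimately show "y \<in> ?L" unfolding scaled by simp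
  next
    fix y assume "y \<in> ?L"
    then obtain c where c: "y = (\<Sum>e<18 + k. c e *\<^sub>R a e)" "(\<Sum>e<18 + k. \<bar>c e\<bar>) \<le> real m" and y: "\<And>i. y i \<in> \<int>"
      unfolding scaled by blast
    obtain xs zs where K: "length xs = 6" "canonical xs" "length zs = k" "(\<Sum>e<18 + k. c e *\<^sub>R a e) = lattice_point a k xs zs"
      using lattice_point_surj[OF dep int y[unfolded c(1)]] by blast
    have "real (total_hex xs + total_abs zs) \<le> real m"
      using weight_lower_bound[OF dep K] c(2) by (rule order_trans)
    then have "total_hex xs + total_abs zs \<le> m" by (simp only: of_nat_le_iff)
    then show "y \<in> (\<lambda>(xs, zs). lattice_point a k xs zs) ` ?K"
      using K c(1) by (intro image_eqI[of _ _ "(xs, zs)"]) simp_all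
  qed
  then have card: "card ?K = card ?L" by (rule bij_betw_same_card)
  show ?thesis
  proof (cases "m = 0")
    case True
    \<comment> \<open>The value at \<open>m = 0\<close> is 1 by definition; it agrees with the count
      because the scaled polytope is the origin alone.\<close>
    have "?P \<noteq> {}" using hull_inc[of "a 0" "{v. \<exists>e<18 + k. v = a e \<or> v = - a e}" convex] by fastforce
    then have "?L = {0}" using True by auto
    then show ?thesis using card True by (simp add: lattice_count_def)
  next
    case False
    then show ?thesis using card by (simp add: lattice_count_def)
  qed
qed

text \<open>The polytope contains \<open>a e\<close> and its negative, so half their difference puts
  \<open>a e\<close> into the direction space, which is therefore spanned by the base.\<close>

lemma polytope_dim_symmetric_hull:
  fixes a :: "nat \<Rightarrow> nat \<Rightarrow> real"
  assumes dep: "cut_dependencies k a"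
  shows "polytope_dim (convex hull {v. \<exists>e<18 + k. v = a e \<or> v = - a e}) = 10 + k"
proof -
  let ?P = "convex hull {v. \<exists>e<18 + k. v = a e \<or> v = - a e}"
  let ?V = "{x - y | x y. x \<in> ?P \<and> y \<in> ?P}"
  have P: "?P = {\<Sum>e<18 + k. c e *\<^sub>R a e | c. (\<Sum>e<18 + k. \<bar>c e\<bar>) \<le> 1}"
    by (rule symmetric_convex_hull) simp
  have sub: "base k \<subseteq> {..<18 + k}" by (auto simp: base_def)
  have fin: "finite (base k)" by (simp add: base_def)
  have "?P \<subseteq> span (a ` base k)"
  proof
    fix x assume "x \<in> ?P"
    then obtain c where "x = (\<Sum>e<18 + k. c e *\<^sub>R a e)" unfolding P by blast
    moreover obtain d where d: "\<And>e. e \<notin> base k \<Longrightarrow> d e = 0" "(\<Sum>e<18 + k. c e *\<^sub>R a e) = (\<Sum>e<18 + k. d e *\<^sub>R a e)"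
      using reduce_to_base[OF dep] by blast
    moreover have "(\<Sum>e<18 + k. d e *\<^sub>R a e) = (\<Sum>e\<in>base k. d e *\<^sub>R a e)"
      using sub d(1) by (intro sum.mono_neutral_cong_right) auto
    moreover have "(\<Sum>e\<in>base k. d e *\<^sub>R a e) \<in> span (a ` base k)"
      by (intro span_sum span_scale span_base imageI)
    ultimately show "x \<in> span (a ` base k)" by simp
  qed
  then have "?V \<subseteq> span (a ` base k)" by (auto intro: span_diff)
  moreover have "a ` base k \<subseteq> span ?V"
  proof (rule image_subsetI)
    fix e assume "e \<in> base k"
    then have e: "e < 18 + k" using sub by auto
    then have "a e \<in> ?P" "- a e \<in> ?P" by (auto intro!: hull_inc)
    then have "a e - (- a e) \<in> span ?V" by (intro span_base) blast
    then have "(1 / 2) *\<^sub>R (a e - (- a e)) \<in> span ?V" by (rule span_scale)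
    moreover have "(1 / 2) *\<^sub>R (a e - (- a e)) = a e" by (simp add: scaleR_fun_def fun_eq_iff)
    ultimately show "a e \<in> span ?V" by (simp only:)
  qed
  ultimately have "span (a ` base k) = span ?V" by (simp add: span_eq)
  moreover have ind: "inj_on a (base k)" "independent (a ` base k)"
    using fam_indep_base[OF dep] fam_indep_iff[OF fin] by auto
  ultimately have "dim ?V = card (a ` base k)" by (intro dim_eq_card)
  also have "\<dots> = card (base k)" using ind(1) by (rule card_image)
  also have "\<dots> = 10 + k" unfolding base_def by (subst card_Un_disjoint) auto
  finally show ?thesis unfolding polytope_dim_def .
qed

section \<open>The \<gamma>-vector\<close>

text \<open>The entries expand \<open>hstar10\<close> in the polynomials
  \<open>t ^ i * (1 + t) ^ (10 - 2 * i)\<close>; at t = -1 only the last term survives, so -148 is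
  minus the value of \<open>hstar10\<close> there. The factor \<open>(1 + t) ^ k\<close> only raises
  the exponents, which keeps these entries and appends zeros.\<close>

definition gamma_list :: "nat \<Rightarrow> real list" where
  "gamma_list k = [1, 16, 124, 596, 914, -148] @ replicate (k div 2) 0"

lemma degree_hstar: "degree (hstar10 * [:1, 1:] ^ k) = 10 + k"
  by (subst degree_mult_eq) (simp_all add: hstar10_def degree_power_eq)

lemma hstar_gamma:
  "hstar10 * [:1, 1:] ^ k = (\<Sum>i\<le>(10 + k) div 2. monom (gamma_list k ! i) i * [:1, 1:] ^ (10 + k - 2 * i))"
proof -
  have "(\<Sum>i\<le>(10 + k) div 2. monom (gamma_list k ! i) i * [:1, 1:] ^ (10 + k - 2 * i)) =
      (\<Sum>i<6. monom (gamma_list k ! i) i * [:1, 1:] ^ (10 + k - 2 * i))"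
  proof (rule sum.mono_neutral_right)
    show "\<forall>i\<in>{..(10 + k) div 2} - {..<6}. monom (gamma_list k ! i) i * [:1, 1:] ^ (10 + k - 2 * i) = 0"
    proof
      fix i assume i: "i \<in> {..(10 + k) div 2} - {..<6}"
      then have "i - Suc (Suc (Suc (Suc (Suc (Suc 0))))) < k div 2" by auto
      then have "gamma_list k ! i = 0" using i by (simp add: gamma_list_def nth_append)
      then show "monom (gamma_list k ! i) i * [:1, 1:] ^ (10 + k - 2 * i) = 0" by simp
    qed
  qed auto
  also have "\<dots> = (\<Sum>i<6. monom (gamma_list k ! i) i * [:1, 1:] ^ (10 - 2 * i)) * [:1, 1:] ^ k"
    unfolding sum_distrib_right mult.assoc power_add[symmetric] by (intro sum.cong refl) simp
  also have "(\<Sum>i<6. monom (gamma_list k ! i) i * [:1, 1:] ^ (10 - 2 * i)) = hstar10"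
    unfolding sum_less_6 hstar10_def gamma_list_def
    by (simp add: monom_altdef eval_nat_numeral)
  finally show ?thesis by simp
qed

section \<open>The counterexample for an arbitrary representation\<close>

theorem theorem4p2:
  fixes D :: nat
  assumes "D \<ge> 10"
  shows "\<exists>M :: nat indep_system. regular_matroid M \<and>
           (\<forall>A. tu_representation A M \<longrightarrow>
              polytope_dim (gen_SEP A) = D \<and>
              (\<exists>g. is_gamma_vector (gen_SEP A) g \<and> (\<exists>x\<in>set g. x < 0)))"
proof -
  define k where "k = D - 10"
  have D: "D = 10 + k" using assms by (simp add: k_def)
  let ?M = "vector_matroid (rep_mat k)" and ?b = "matrix_column (rep_mat k)"
  have "matroid_iso ?M ?M" unfolding matroid_iso_def by (rule exI[of _ id]) simp
  then have "regular_matroid ?M"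
    using matroid_vector_matroid totally_unimodular_rep_mat
    by (auto simp: regular_matroid_def tu_representation_def)
  moreover have "polytope_dim (gen_SEP A) = D \<and> (\<exists>g. is_gamma_vector (gen_SEP A) g \<and> (\<exists>x\<in>set g. x < 0))"
    if A: "tu_representation A ?M" for A
  proof -
    have tu: "totally_unimodular A" using A by (simp add: tu_representation_def)
    obtain f where f: "bij_betw f {..<18 + k} {..<dim_col A}"
      and iso: "\<And>S. S \<subseteq> {..<18 + k} \<Longrightarrow> indep ?M S \<longleftrightarrow> indep (vector_matroid A) (f ` S)"
      using A by (auto simp: tu_representation_def matroid_iso_def)
    \<comment> \<open>The matroid isomorphism lists the columns of \<open>A\<close> by the edges of
      K_{3,6} and the coloops.\<close>
    define a0 where "a0 = matrix_column A \<circ> f"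
    have f_less: "f e < dim_col A" if "e < 18 + k" for e using f that by (auto simp: bij_betw_def)
    have ind: "fam_indep a0 S \<longleftrightarrow> fam_indep ?b S" if S: "S \<subseteq> {..<18 + k}" for S
    proof -
      have inj: "inj_on f S" using f S by (auto simp: bij_betw_def intro: inj_on_subset)
      have "f ` S \<subseteq> {..<dim_col A}" using S f_less by auto
      then show ?thesis
        using iso[OF S] S unfolding indep_vector_matroid a0_def fam_indep_reindex[OF inj] by simp
    qed
    have c_int: "c e \<in> \<int>" if S: "S \<subseteq> {..<18 + k}" and fi: "fam_indep a0 S"
      and y: "\<And>i. (\<Sum>e\<in>S. c e *\<^sub>R a0 e) i \<in> \<int>" and e: "e \<in> S" for S c e
    proof -
      have inj: "inj_on f S" using f S by (auto simp: bij_betw_def intro: inj_on_subset)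
      define c' where "c' = c \<circ> the_inv_into S f"
      have c': "c' (f x) = c x" if "x \<in> S" for x using that inj by (simp add: c'_def the_inv_into_f_f)
      have "(\<Sum>x\<in>f ` S. c' x *\<^sub>R matrix_column A x) = (\<Sum>e\<in>S. c e *\<^sub>R a0 e)"
        by (subst sum.reindex[OF inj]) (auto intro!: sum.cong simp: c' a0_def)
      then have "c' (f e) \<in> \<int>"
        using totally_unimodular_integral[OF tu, of "f ` S" c' "f e"] S f_less fi y e
        by (auto simp: fam_indep_reindex[OF inj] a0_def)
      then show ?thesis using c' e by simp
    qed
    have int0: "integral_coefficients (18 + k) a0"
      unfolding integral_coefficients_def using c_int by blast
    have aint0: "a0 e i \<in> \<int>" if "e < 18 + k" for e i
      using totally_unimodular_entry[OF tu _ f_less[OF that], of i] by (auto simp: a0_def matrix_column_def)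
    obtain \<sigma> where \<sigma>: "\<And>e. \<sigma> e \<in> {-1, 1::real}" and dep: "cut_dependencies k (\<lambda>e. \<sigma> e *\<^sub>R a0 e)"
      using obtain_signs[OF cut_dependencies_rep ind int0 aint0] by blast
    define a where "a = (\<lambda>e. \<sigma> e *\<^sub>R a0 e)"
    note dep = dep[folded a_def]
    have \<sigma>nz: "\<sigma> e \<noteq> 0" for e using \<sigma>[of e] by auto
    have int: "integral_coefficients (18 + k) a"
      unfolding integral_coefficients_def
    proof (intro allI impI ballI)
      fix S c e assume S: "S \<subseteq> {..<18 + k}" and fi: "fam_indep a S"
        and y: "\<forall>i. (\<Sum>e\<in>S. c e *\<^sub>R a e) i \<in> \<int>" and e: "e \<in> S"
      have "c e * \<sigma> e \<in> \<int>"
      proof (rule integral_coefficientsD[OF int0 S _ _ e])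
        show "fam_indep a0 S" using fi unfolding a_def by (subst (asm) fam_indep_scale) (simp_all add: \<sigma>nz)
        show "(\<Sum>e\<in>S. (c e * \<sigma> e) *\<^sub>R a0 e) i \<in> \<int>" for i using y by (simp add: a_def)
      qed
      then show "c e \<in> \<int>" using \<sigma>[of e] by auto
    qed
    have aint: "a e i \<in> \<int>" if "e < 18 + k" for e i
      using aint0[OF that, of i] \<sigma>[of e] by (auto simp: a_def scaleR_fun_def)
    \<comment> \<open>Renaming and sign changes preserve the set of the columns and their negatives,
      so the polytope of \<open>A\<close> itself is counted.\<close>
    have "{v. \<exists>j<dim_col A. v = matrix_column A j \<or> v = - matrix_column A j} = {v. \<exists>e<18 + k. v = a e \<or> v = - a e}"
    proof -
      have "(v = a e \<or> v = - a e) \<longleftrightarrow> (v = matrix_column A (f e) \<or> v = - matrix_column A (f e))" for v e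
        using \<sigma>[of e] by (auto simp: a_def a0_def)
      moreover have "{..<dim_col A} = f ` {..<18 + k}" using f by (simp add: bij_betw_def)
      then have "(\<exists>j<dim_col A. v = matrix_column A j \<or> v = - matrix_column A j) \<longleftrightarrow>
          (\<exists>e<18 + k. v = matrix_column A (f e) \<or> v = - matrix_column A (f e))" for v
        by (metis (no_types, lifting) imageE imageI lessThan_iff)
      ultimately show ?thesis by simp
    qed
    then have SEP: "gen_SEP A = convex hull {v. \<exists>e<18 + k. v = a e \<or> v = - a e}"
      by (simp add: gen_SEP_def)
    have dim: "polytope_dim (gen_SEP A) = 10 + k"
      unfolding SEP by (rule polytope_dim_symmetric_hull[OF dep])
    have count: "lattice_count (convex hull {v. \<exists>e<18 + k. v = a e \<or> v = - a e}) m =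
      card {(xs, zs). length xs = 6 \<and> canonical xs \<and> length zs = k \<and> total_hex xs + total_abs zs \<le> m}" for m
      by (rule lattice_count_symmetric_hull[OF dep int]) (rule aint)
    have "Abs_fps (\<lambda>m. real (lattice_count (gen_SEP A) m)) * (1 - fps_X) ^ (10 + k + 1) = fps_of_poly (hstar10 * [:1, 1:] ^ k)"
      unfolding SEP count by (rule count_canonical_ball)
    moreover have "(1 - fps_X :: real fps) ^ (10 + k + 1) \<noteq> 0" using fps_X_neq_one by simp
    ultimately have "is_hstar (gen_SEP A) (hstar10 * [:1, 1:] ^ k)"
      unfolding is_hstar_def dim by (metis nonzero_mult_div_cancel_right)
    then have "is_gamma_vector (gen_SEP A) (gamma_list k)"
      unfolding is_gamma_vector_def
    proof (intro exI conjI)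
      show "length (gamma_list k) = degree (hstar10 * [:1, 1:] ^ k) div 2 + 1"
        unfolding degree_hstar by (simp add: gamma_list_def)
      show "hstar10 * [:1, 1:] ^ k = (\<Sum>i\<le>degree (hstar10 * [:1, 1:] ^ k) div 2.
          monom (gamma_list k ! i) i * [:1, 1:] ^ (degree (hstar10 * [:1, 1:] ^ k) - 2 * i))"
        unfolding degree_hstar by (rule hstar_gamma)
    qed
    moreover have "-148 \<in> set (gamma_list k)" by (simp add: gamma_list_def)
    ultimately show ?thesis using dim D by (intro conjI exI[of _ "gamma_list k"] bexI[of _ "-148"]) simp_all
  qed
  ultimately show ?thesis by blast
qed

end
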